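(* Let $k$ be a perfect field, let $S=k[x_1,\dots,x_n]$, and let $I\subset S$ be a nonzero proper homogeneous ideal. Assume either $\operatorname{char}(k)=0$, or $\operatorname{char}(k)=p>2$ and $p$ does not divide the degree of any minimal homogeneous generator of $I$. Let $X=\operatorname{Proj}\,\mathcal{RL}(I)$, where $\mathcal{RL}(I)=S[It,t^2]$ is the Rees-like algebra of $I$. Then there is a bijection between the irreducible components of $\operatorname{Sing} X$ and the irreducible components of the scheme defined by $I$ (that is, the minimal primes of $I$). Moreover, $$\operatorname{codim}_X(\operatorname{Sing} X)=\operatorname{ht}(I).$$
   Context: $S=k[x_1,\dots,x_n]$ is standard graded. Let $f_1,\dots,f_m$ be minimal homogeneous generators of $I$. The Rees-like algebra of $I$ is the subring $\mathcal{RL}(I)=S[It,t^2]\subseteq S[t]$, $t$ a new variable. Put $T=S[y_1,\dots,y_m,z]$, graded by $\deg x_i=1$, $\deg y_i=\deg f_i+1$, $\deg z=2$, and let $\mathcal{RLP}(I)$ be the kernel of the surjective $S$-algebra map $T\to\mathcal{RL}(I)$, $y_i\mapsto f_it$, $z\mapsto t^2$; it is a homogeneous prime ideal of height $m$. The singular locus $\operatorname{Sing}X$ of $X=\operatorname{Proj}(T/\mathcal{RLP}(I))$ is understood through the Jacobian criterion on the presentation: it is the closed set defined by the radical homogeneous ideal $J\subset T$ which defines the singular locus of $\operatorname{Spec}(T/\mathcal{RLP}(I))$, i.e. the radical of the sum of $\mathcal{RLP}(I)$ and the ideal of $m\times m$ minors of the Jacobian matrix of a set of generators of $\mathcal{RLP}(I)$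 with respect to all variables of $T$. Its irreducible components correspond to the minimal primes of $J$, and $\operatorname{codim}_X(\operatorname{Sing}X)=\operatorname{ht}(J)-\operatorname{ht}(\mathcal{RLP}(I))$. *)

theory Defs
  imports
    "HOL-Analysis.Analysis"
    "HOL-Algebra.Algebraic_Closure_Type"
    "HOL-Algebra.Generated_Rings"
    "HOL-Library.Poly_Mapping"
begin

section \<open>Commutative algebra\<close>

definition perfect_field :: "'k::field itself \<Rightarrow> bool" where
  "perfect_field _ \<longleftrightarrow> (\<forall>p :: 'k poly. Factorial_Ring.irreducible p \<longrightarrow> coprime p (Polynomial.pderiv p))"

definition radical :: "('a, 'b) ring_scheme \<Rightarrow> 'a set \<Rightarrow> 'a set" where
  "radical R I = {a \<in> carrier R. \<exists>e::nat. a [^]\<^bsub>R\<^esub> e \<in> I}"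

definition minimal_primes :: "('a, 'b) ring_scheme \<Rightarrow> 'a set \<Rightarrow> 'a set set" where
  "minimal_primes R I =
     {p. primeideal p R \<and> I \<subseteq> p \<and> (\<forall>q. primeideal q R \<and> I \<subseteq> q \<and> q \<subseteq> p \<longrightarrow> q = p)}"

definition prime_height :: "('a, 'b) ring_scheme \<Rightarrow> 'a set \<Rightarrow> enat" where
  "prime_height R p =
     (SUP r \<in> {r. \<exists>c. (\<forall>i\<le>r. primeideal (c i) R) \<and> (\<forall>i<r. c i \<subset> c (Suc i)) \<and> c r = p}. enat r)"

definition height :: "('a, 'b) ring_scheme \<Rightarrow> 'a set \<Rightarrow> enat" where
  "height R I = (INF p \<in> {p. primeideal p R \<and> I \<subseteq> p}. prime_height R p)"

text \<open>In the following, \<open>A d\<close> is the degree \<open>d\<close> component (including \<open>0\<close>) of a graded ring.\<close>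

definition homogeneous_ideal :: "('a, 'b) ring_scheme \<Rightarrow> (nat \<Rightarrow> 'a set) \<Rightarrow> 'a set \<Rightarrow> bool" where
  "homogeneous_ideal R A I \<longleftrightarrow> ideal I R \<and> Idl\<^bsub>R\<^esub> (I \<inter> (\<Union>d. A d)) = I"

definition Proj_points :: "('a, 'b) ring_scheme \<Rightarrow> (nat \<Rightarrow> 'a set) \<Rightarrow> 'a set set" where
  "Proj_points R A =
     {q. primeideal q R \<and> homogeneous_ideal R A q \<and> \<not> (\<Union>d\<in>{0<..}. A d) \<subseteq> q}"

definition Proj :: "('a, 'b) ring_scheme \<Rightarrow> (nat \<Rightarrow> 'a set) \<Rightarrow> 'a set topology" where
  "Proj R A = topology_generated_by ((\<lambda>g. {q \<in> Proj_points R A. g \<notin> q}) ` (\<Union>d. A d))"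

definition irreducible_in :: "'a topology \<Rightarrow> 'a set \<Rightarrow> bool" where
  "irreducible_in T A \<longleftrightarrow> A \<subseteq> topspace T \<and> A \<noteq> {} \<and>
     (\<forall>C D. closedin T C \<and> closedin T D \<and> A \<subseteq> C \<union> D \<longrightarrow> A \<subseteq> C \<or> A \<subseteq> D)"

definition irreducible_components :: "'a topology \<Rightarrow> 'a set \<Rightarrow> 'a set set" where
  "irreducible_components T Z =
     {A. irreducible_in T A \<and> A \<subseteq> Z \<and> (\<forall>B. irreducible_in T B \<and> B \<subseteq> Z \<and> A \<subseteq> B \<longrightarrow> B = A)}"


section \<open>Multivariate polynomials\<close>

text \<open>A monomial is the finitely supported family of its exponents.\<close>

type_synonym ('x, 'k) mpoly = "('x \<Rightarrow>\<^sub>0 nat) \<Rightarrow>\<^sub>0 'k"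

definition mconst :: "'k \<Rightarrow> ('x, 'k::comm_ring_1) mpoly" where
  "mconst c = Poly_Mapping.single 0 c"

definition mvar :: "'x \<Rightarrow> ('x, 'k::comm_ring_1) mpoly" where
  "mvar x = Poly_Mapping.single (Poly_Mapping.single x 1) 1"

definition mono_degree :: "('x \<Rightarrow>\<^sub>0 nat) \<Rightarrow> nat" where
  "mono_degree u = (\<Sum>x\<in>Poly_Mapping.keys u. Poly_Mapping.lookup u x)"

definition total_degree :: "('x, 'k::comm_ring_1) mpoly \<Rightarrow> nat" where
  "total_degree p = Max (mono_degree ` Poly_Mapping.keys p)"

definition mpoly_component :: "nat \<Rightarrow> ('x, 'k::comm_ring_1) mpoly set" where
  "mpoly_component d = {p. \<forall>u\<in>Poly_Mapping.keys p. mono_degree u = d}"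

definition mpoly_eval ::
    "('k \<Rightarrow> 'r) \<Rightarrow> ('x \<Rightarrow> 'r) \<Rightarrow> ('x, 'k::comm_ring_1) mpoly \<Rightarrow> 'r::comm_ring_1" where
  "mpoly_eval h g p =
     (\<Sum>u\<in>Poly_Mapping.keys p. h (Poly_Mapping.lookup p u) *
        (\<Prod>x\<in>Poly_Mapping.keys u. g x ^ Poly_Mapping.lookup u x))"

definition mpoly_pderiv :: "'x \<Rightarrow> ('x, 'k::comm_ring_1) mpoly \<Rightarrow> ('x, 'k) mpoly" where
  "mpoly_pderiv x p =
     (\<Sum>u\<in>Poly_Mapping.keys p. Poly_Mapping.single (u - Poly_Mapping.single x 1)
        (of_nat (Poly_Mapping.lookup u x) * Poly_Mapping.lookup p u))"


section \<open>Rees-like algebras\<close>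

abbreviation UR :: "'a::comm_ring_1 ring" where
  "UR \<equiv> ring_of_type_algebra"

text \<open>The third condition makes \<open>f\<close> injective, so \<open>CARD('m)\<close> is the number of generators.\<close>

definition minimal_homogeneous_generators ::
    "('m::finite \<Rightarrow> ('n, 'k::field) mpoly) \<Rightarrow> ('n, 'k) mpoly set \<Rightarrow> bool" where
  "minimal_homogeneous_generators f I \<longleftrightarrow>
     (\<forall>j. \<exists>d. f j \<in> mpoly_component d) \<and>
     Idl\<^bsub>UR\<^esub> (range f) = I \<and>
     (\<forall>j. f j \<notin> Idl\<^bsub>UR\<^esub> (f ` (UNIV - {j})))"

text \<open>The univariate polynomial \<open>[:a\<^sub>0, a\<^sub>1, \<dots>:]\<close> over \<open>S\<close> is \<open>a\<^sub>0 + a\<^sub>1 t + \<dots> \<in> S[t]\<close>.\<close>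

definition rees_like_algebra ::
    "('n, 'k::field) mpoly set \<Rightarrow> ('n, 'k) mpoly poly ring" where
  "rees_like_algebra I =
     UR\<lparr>carrier := generate_ring UR
          ((\<lambda>s. [:s:]) ` UNIV \<union> (\<lambda>a. [:0, a:]) ` I \<union> {[:0, 0, 1:]})\<rparr>"

text \<open>The grading induced from \<open>S[t]\<close> with \<open>deg t = 1\<close>; thus \<open>f\<^sub>j t\<close> has degree \<open>deg f\<^sub>j + 1\<close>
  and \<open>t\<^sup>2\<close> has degree \<open>2\<close>.\<close>

definition rees_like_component ::
    "('n, 'k::field) mpoly set \<Rightarrow> nat \<Rightarrow> ('n, 'k) mpoly poly set" where
  "rees_like_component I d =
     {p \<in> carrier (rees_like_algebra I).
        \<forall>i. Polynomial.coeff p i \<in> (if i \<le> d then mpoly_component (d - i) else {0})}"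

datatype ('n, 'm) rl_var = VarX 'n | VarY 'm | VarZ

text \<open>\<open>T = S[y\<^sub>1, \<dots>, y\<^sub>m, z]\<close> is the polynomial ring over \<open>k\<close> in all variables.\<close>

type_synonym ('n, 'm, 'k) rl_mpoly = "(('n, 'm) rl_var, 'k) mpoly"

definition rees_like_map ::
    "('m \<Rightarrow> ('n, 'k::field) mpoly) \<Rightarrow> ('n, 'm, 'k) rl_mpoly \<Rightarrow> ('n, 'k) mpoly poly" where
  "rees_like_map f =
     mpoly_eval (\<lambda>c. [:mconst c:])
       (\<lambda>v. case v of VarX i \<Rightarrow> [:mvar i:] | VarY j \<Rightarrow> [:0, f j:] | VarZ \<Rightarrow> [:0, 0, 1:])"

definition RLP :: "('m \<Rightarrow> ('n, 'k::field) mpoly) \<Rightarrow> ('n, 'm, 'k) rl_mpoly set" where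
  "RLP f = {p. rees_like_map f p = 0}"

text \<open>Minors of size \<open>m = CARD('m)\<close>, the height of \<open>RLP f\<close>. Since rows and columns are selected by
  injections from \<open>'m\<close>, each minor occurs with all its signs.\<close>

definition jacobian_minors ::
    "('n, 'm::finite, 'k::field) rl_mpoly set \<Rightarrow> ('n, 'm, 'k) rl_mpoly set" where
  "jacobian_minors G =
     {det (\<chi> i j. mpoly_pderiv (c j) (g i)) :: ('n, 'm, 'k) rl_mpoly
       | (g :: 'm \<Rightarrow> ('n, 'm, 'k) rl_mpoly) (c :: 'm \<Rightarrow> ('n, 'm) rl_var).
         inj g \<and> range g \<subseteq> G \<and> inj c}"

definition jacobian_ideal ::
    "('m::finite \<Rightarrow> ('n, 'k::field) mpoly) \<Rightarrow> ('n, 'm, 'k) rl_mpoly set \<Rightarrow>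
      ('n, 'm, 'k) rl_mpoly set" where
  "jacobian_ideal f G = radical UR (RLP f <+>\<^bsub>UR\<^esub> Idl\<^bsub>UR\<^esub> (jacobian_minors G))"

definition ProjRL :: "('n, 'k::field) mpoly set \<Rightarrow> ('n, 'k) mpoly poly set topology" where
  "ProjRL I = Proj (rees_like_algebra I) (rees_like_component I)"

text \<open>The closed set defined by the Jacobian ideal. A prime \<open>q\<close> of \<open>RL(I) = T/RLP\<close> is viewed in \<open>T\<close> through its preimage.\<close>

definition Sing ::
    "('m::finite \<Rightarrow> ('n, 'k::field) mpoly) \<Rightarrow> ('n, 'm, 'k) rl_mpoly set \<Rightarrow>
      ('n, 'k) mpoly set \<Rightarrow> ('n, 'k) mpoly poly set set" where
  "Sing f G I = {q \<in> topspace (ProjRL I). jacobian_ideal f G \<subseteq> rees_like_map f -` q}"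

text \<open>The codimension in \<open>Proj (T/RLP)\<close> of the closed set defined by \<open>J\<close> is
  \<open>ht J - ht RLP\<close>.\<close>

definition codim_Sing ::
    "('m::finite \<Rightarrow> ('n, 'k::field) mpoly) \<Rightarrow> ('n, 'm, 'k) rl_mpoly set \<Rightarrow> enat" where
  "codim_Sing f G = height UR (jacobian_ideal f G) - height UR (RLP f)"

end

theory Submission
  imports Defs
begin

text \<open>Throughout, \<open>S\<close> is the polynomial ring in the variables \<open>x\<close>, \<open>T\<close> the one in \<open>x\<close>, \<open>y\<close>, \<open>z\<close>, and
  \<open>m\<close> is the number of the generators \<open>f\<close>. The proof determines the primes of \<open>T\<close> that contain the
  Jacobian ideal \<open>J\<close>, and then reads off components and heights.
  
  A prime \<open>Q\<close> of \<open>T\<close> contains \<open>J\<close> if and only if it contains \<open>RLP\<close> and \<open>I\<close>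
  (\<open>jacobian_ideal_subset_prime_iff\<close>). If \<open>f i\<close> lies outside \<open>Q\<close>, consider the relations
  \<open>f i * y j - f j * y i\<close> for the \<open>j\<close> other than \<open>i\<close>, and \<open>y i * y i - z * (f i * f i)\<close>. Their
  Jacobian matrix with respect to the \<open>y j\<close> and to \<open>z\<close> is diagonal, and its determinant is, up to
  sign, a power of \<open>f i\<close>; since the relations are combinations of the given generators of \<open>RLP\<close>, some
  minor of the latter is outside \<open>Q\<close> as well. Conversely, let \<open>Q\<close> contain \<open>RLP\<close> and \<open>I\<close>. Then it
  contains each \<open>y j\<close>, because its square is congruent to \<open>z * (f j * f j)\<close>. Modulo \<open>(I, y)\<close> a
  relation only has derivatives in the directions \<open>y\<close>, and these form a vector that is congruent to a
  syzygy of \<open>f\<close> (\<open>jacobian_row\<close>). A square matrix of syzygies of the nonzero vector \<open>f\<close> is singular,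
  so all minors lie in \<open>(I, y)\<close>, hence in \<open>Q\<close>.
  
  For the codimension one needs \<open>ht J = m + ht I\<close> and \<open>ht RLP = m\<close>. Both follow from the dimension
  formula \<open>prime_height_mpoly\<close> for polynomial rings over a field: the height of a prime \<open>P\<close> is the
  number of variables minus the size of a maximal set of variables that are algebraically independent
  modulo \<open>P\<close>. Its upper bound is a count of linearly independent monomials (\<open>prime_chain_to_le\<close>),
  its lower bound an explicit chain of primes (\<open>prime_chain_to_card\<close>). The primes containing \<open>J\<close> are
  those that contain \<open>(P, y)\<close> for some prime \<open>P\<close> of \<open>S\<close> containing \<open>I\<close>. A maximal independent set for
  \<open>P\<close> becomes one for \<open>(P, y)\<close> on adjoining \<open>z\<close>, and for \<open>RLP\<close> one can take the variables \<open>x\<close> and \<open>z\<close>.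
  
  For the components, the points of the singular locus are the homogeneous primes of
  \<open>RL(I)\<close> that contain \<open>I\<close>. Over a prime \<open>P\<close> of \<open>S\<close> containing \<open>I\<close> there is a smallest prime of
  \<open>RL(I)\<close>, namely the polynomials in \<open>t\<close> with coefficients in \<open>P\<close>. For a minimal prime \<open>P\<close> of \<open>I\<close>,
  which is homogeneous, it is a point of the singular locus, and its closure is irreducible. Every
  irreducible subset of the singular locus is contained in such a closure
  (\<open>irreducible_subset_of_Sing\<close>): the elements of \<open>S\<close> in all its points form an ideal that is prime on
  homogeneous elements, so this ideal contains a minimal prime of \<open>I\<close>.\<close>


section \<open>Ideals and morphisms of commutative rings\<close>

text \<open>Polynomial rings are types here, so ideals of them are handled as sets with elementary closure
  properties; \<open>ideal_UR_iff\<close> and \<open>primeideal_UR_iff\<close> translate to and from the carrier-based notions.\<close>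

definition is_ideal :: "'a::comm_ring_1 set \<Rightarrow> bool" where
  "is_ideal N \<longleftrightarrow> 0 \<in> N \<and> (\<forall>a\<in>N. \<forall>b\<in>N. a + b \<in> N) \<and> (\<forall>a\<in>N. \<forall>r. r * a \<in> N)"

definition is_prime :: "'a::comm_ring_1 set \<Rightarrow> bool" where
  "is_prime P \<longleftrightarrow> is_ideal P \<and> 1 \<notin> P \<and> (\<forall>a b. a * b \<in> P \<longrightarrow> a \<in> P \<or> b \<in> P)"

lemma UR_simps [simp]:
  "carrier UR = UNIV" "a \<oplus>\<^bsub>UR\<^esub> b = a + b" "a \<otimes>\<^bsub>UR\<^esub> b = a * b" "\<zero>\<^bsub>UR\<^esub> = 0" "\<one>\<^bsub>UR\<^esub> = 1"
  by (simp_all add: ring_of_type_algebra_def)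

interpretation UR: cring "UR :: 'a::comm_ring_1 ring"
  by (rule cring_from_type_algebra)

lemma is_ideal_zero: "is_ideal N \<Longrightarrow> 0 \<in> N"
  and is_ideal_add: "is_ideal N \<Longrightarrow> a \<in> N \<Longrightarrow> b \<in> N \<Longrightarrow> a + b \<in> N"
  and is_ideal_mult_left: "is_ideal N \<Longrightarrow> a \<in> N \<Longrightarrow> r * a \<in> N"
  and is_ideal_mult_right: "is_ideal N \<Longrightarrow> a \<in> N \<Longrightarrow> a * r \<in> N"
  by (auto simp: is_ideal_def mult.commute)

lemma is_ideal_uminus: "is_ideal N \<Longrightarrow> a \<in> N \<Longrightarrow> - a \<in> N"
  using is_ideal_mult_left[of N a "-1"] by simp

lemma is_ideal_diff: "is_ideal N \<Longrightarrow> a \<in> N \<Longrightarrow> b \<in> N \<Longrightarrow> a - b \<in> N"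
  using is_ideal_add[of N a "-b"] is_ideal_uminus[of N b] by simp

lemma is_ideal_sum: "is_ideal N \<Longrightarrow> (\<And>x. x \<in> A \<Longrightarrow> f x \<in> N) \<Longrightarrow> sum f A \<in> N"
  by (induction A rule: infinite_finite_induct) (auto intro: is_ideal_zero is_ideal_add)

lemma is_ideal_add_cancel: "is_ideal N \<Longrightarrow> a \<in> N \<Longrightarrow> a + b \<in> N \<longleftrightarrow> b \<in> N"
  using is_ideal_add[of N a b] is_ideal_diff[of N "a + b" a] by auto

lemma is_ideal_diff_mem: "is_ideal N \<Longrightarrow> a - b \<in> N \<Longrightarrow> a \<in> N \<longleftrightarrow> b \<in> N"
  using is_ideal_add_cancel[of N "a - b" b] by simp

lemma is_prime_ideal: "is_prime P \<Longrightarrow> is_ideal P"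
  and is_prime_one: "is_prime P \<Longrightarrow> 1 \<notin> P"
  and is_prime_mult: "is_prime P \<Longrightarrow> a * b \<in> P \<longleftrightarrow> a \<in> P \<or> b \<in> P"
  by (auto simp: is_prime_def is_ideal_def) (metis mult.commute)

lemma is_prime_power: "is_prime P \<Longrightarrow> a ^ n \<in> P \<Longrightarrow> a \<in> P"
  by (induction n) (auto simp: is_prime_mult dest: is_prime_one)

lemma is_prime_prod: "is_prime P \<Longrightarrow> prod f A \<in> P \<Longrightarrow> \<exists>x\<in>A. f x \<in> P"
  by (induction A rule: infinite_finite_induct) (auto simp: is_prime_mult dest: is_prime_one)

lemma ideal_UR_iff: "ideal N UR \<longleftrightarrow> is_ideal N" for N :: "'a::comm_ring_1 set"
proof
  assume "ideal N UR"
  then interpret ideal N "UR :: 'a ring" .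
  show "is_ideal N"
    using a_closed I_l_closed zero_closed by (auto simp: is_ideal_def)
next
  assume N: "is_ideal N"
  show "ideal N UR"
  proof (rule idealI)
    show "ring (UR :: 'a ring)" by (rule UR.ring_axioms)
    show "subgroup N (add_monoid UR)"
    proof (rule group.subgroupI)
      show "Group.group (add_monoid (UR :: 'a ring))" by (rule UR.a_group)
      show "inv\<^bsub>add_monoid UR\<^esub> a \<in> N" if "a \<in> N" for a
      proof -
        have "\<ominus>\<^bsub>UR\<^esub> a = - a"
          using UR.minus_equality[of "- a" a] by simp
        then show ?thesis
          using is_ideal_uminus[OF N that] by (simp add: a_inv_def)
      qed
    qed (use N in \<open>auto simp: is_ideal_def\<close>)
  qed (use N in \<open>auto simp: is_ideal_def mult.commute\<close>)
qed

lemma primeideal_UR_iff: "primeideal P UR \<longleftrightarrow> is_prime P" for P :: "'a::comm_ring_1 set"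
proof
  assume "primeideal P UR"
  then interpret primeideal P "UR :: 'a ring" .
  have "is_ideal P"
    using ideal_axioms ideal_UR_iff by blast
  moreover have "1 \<notin> P"
    using I_notcarr one_imp_carrier by auto
  ultimately show "is_prime P"
    using I_prime by (auto simp: is_prime_def)
next
  assume P: "is_prime P"
  show "primeideal P UR"
    by (rule primeidealI)
      (use P in \<open>auto simp: ideal_UR_iff is_prime_def UR.is_cring\<close>)
qed

lemma genideal_UR_least: "is_ideal N \<Longrightarrow> A \<subseteq> N \<Longrightarrow> Idl\<^bsub>UR\<^esub> A \<subseteq> N"
  by (rule UR.genideal_minimal) (auto simp: ideal_UR_iff)

lemma genideal_UR_superset: "A \<subseteq> Idl\<^bsub>UR\<^esub> A"
  by (rule UR.genideal_self) simp

lemma is_ideal_genideal: "is_ideal (Idl\<^bsub>UR\<^esub> A)"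
  using UR.genideal_ideal[of A] by (simp add: ideal_UR_iff)

lemma genideal_UR_finite:
  assumes "finite A" and "x \<in> Idl\<^bsub>UR\<^esub> A"
  shows "\<exists>c. x = (\<Sum>a\<in>A. c a * a)"
proof -
  let ?N = "{x. \<exists>c. x = (\<Sum>a\<in>A. c a * a)}"
  have "is_ideal ?N"
    unfolding is_ideal_def
  proof (intro conjI ballI allI)
    show "0 \<in> ?N" by (auto intro: exI[of _ "\<lambda>_. 0"])
    show "x + y \<in> ?N" if x: "x \<in> ?N" and y: "y \<in> ?N" for x y
    proof -
      from x y obtain c d where "x = (\<Sum>a\<in>A. c a * a)" "y = (\<Sum>a\<in>A. d a * a)" by auto
      then have "x + y = (\<Sum>a\<in>A. (c a + d a) * a)"
        by (simp add: sum.distrib distrib_right)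
      then show ?thesis by (intro CollectI exI[of _ "\<lambda>a. c a + d a"])
    qed
    show "r * x \<in> ?N" if x: "x \<in> ?N" for x r
    proof -
      from x obtain c where "x = (\<Sum>a\<in>A. c a * a)" by auto
      then have "r * x = (\<Sum>a\<in>A. (r * c a) * a)"
        by (simp add: sum_distrib_left mult.assoc)
      then show ?thesis by (intro CollectI exI[of _ "\<lambda>a. r * c a"])
    qed
  qed
  moreover have "A \<subseteq> ?N"
  proof
    fix a assume a: "a \<in> A"
    have "a = (\<Sum>b\<in>A. (if b = a then 1 else 0) * b)"
      using assms(1) a by (simp add: if_distrib[of "\<lambda>c. c * _"] sum.delta' cong: if_cong)
    then show "a \<in> ?N"
      by (intro CollectI exI[of _ "\<lambda>b. if b = a then 1 else 0"])
  qed
  ultimately have "Idl\<^bsub>UR\<^esub> A \<subseteq> ?N" by (rule genideal_UR_least)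
  with assms(2) show ?thesis by auto
qed

locale ring_morphism =
  fixes H :: "'a::comm_ring_1 \<Rightarrow> 'b::comm_ring_1"
  assumes one: "H 1 = 1"
    and add: "H (a + b) = H a + H b"
    and mult: "H (a * b) = H a * H b"
begin

lemma zero: "H 0 = 0"
  using add[of 0 0] by simp

lemma uminus: "H (- a) = - H a"
  using add[of a "- a"] zero by (simp add: eq_neg_iff_add_eq_0 add.commute)

lemma diff: "H (a - b) = H a - H b"
  using add[of a "- b"] uminus[of b] by simp

lemma sum: "H (sum f A) = (\<Sum>x\<in>A. H (f x))"
  by (induction A rule: infinite_finite_induct) (auto simp: zero add)

lemma prod: "H (prod f A) = (\<Prod>x\<in>A. H (f x))"
  by (induction A rule: infinite_finite_induct) (auto simp: one mult)

lemma power: "H (a ^ n) = H a ^ n"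
  by (induction n) (auto simp: one mult)

lemma of_int: "H (of_int i) = of_int i"
proof (cases i)
  case (nonneg n)
  have "H (of_nat n) = of_nat n"
    by (induction n) (auto simp: zero one add)
  then show ?thesis using nonneg by simp
next
  case (neg n)
  have "H (of_nat n) = of_nat n" for n
    by (induction n) (auto simp: zero one add)
  from this[of "Suc n"] show ?thesis using neg by (simp only: of_int_minus of_int_of_nat_eq uminus)
qed

lemma det: "H (det A) = det (\<chi> i j. H (A $ i $ j))"
  by (simp add: det_def sum prod mult of_int)

lemma is_ideal_vimage: "is_ideal N \<Longrightarrow> is_ideal (H -` N)"
  by (auto simp: is_ideal_def zero add mult)

lemma is_prime_vimage: "is_prime P \<Longrightarrow> is_prime (H -` P)"
  by (auto simp: is_prime_def is_ideal_vimage one mult)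

end

lemmas morphism_simps = ring_morphism.one ring_morphism.zero ring_morphism.add ring_morphism.mult
  ring_morphism.uminus ring_morphism.diff ring_morphism.sum ring_morphism.prod ring_morphism.power

lemma ring_morphism_comp: "ring_morphism F \<Longrightarrow> ring_morphism G \<Longrightarrow> ring_morphism (\<lambda>x. F (G x))"
  by (simp add: ring_morphism_def)

lemma ring_morphism_id: "ring_morphism (\<lambda>x. x)"
  by (simp add: ring_morphism_def)

lemma ring_morphism_pCons: "ring_morphism (\<lambda>a. [:a:])"
  by (simp add: ring_morphism_def)

lemma ring_morphism_pcompose: "ring_morphism (\<lambda>p. pcompose p q)"
  by (simp add: ring_morphism_def pcompose_add pcompose_mult pcompose_1)

lemma ring_morphism_poly: "ring_morphism (\<lambda>p. poly p a)"
  by (simp add: ring_morphism_def)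

lemma ring_morphism_map_poly:
  assumes "ring_morphism H"
  shows "ring_morphism (map_poly H)"
proof -
  interpret ring_morphism H by fact
  show ?thesis
  proof
    show "map_poly H 1 = 1" by (simp add: one map_poly_1)
    show "map_poly H (a + b) = map_poly H a + map_poly H b" for a b
      by (rule poly_eqI) (simp add: coeff_map_poly zero add)
    show "map_poly H (a * b) = map_poly H a * map_poly H b" for a b
      by (rule poly_eqI) (simp add: coeff_map_poly zero coeff_mult sum mult)
  qed
qed


section \<open>Polynomials with coefficients in an ideal\<close>

definition coeffs_in :: "'a::comm_ring_1 set \<Rightarrow> 'a poly set" where
  "coeffs_in N = {p. \<forall>i. Polynomial.coeff p i \<in> N}"

lemma coeffs_inD: "p \<in> coeffs_in N \<Longrightarrow> Polynomial.coeff p i \<in> N"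
  by (simp add: coeffs_in_def)

lemma coeffs_in_mono: "N \<subseteq> N' \<Longrightarrow> coeffs_in N \<subseteq> coeffs_in N'"
  by (auto simp: coeffs_in_def)

lemma const_in_coeffs_in: "is_ideal N \<Longrightarrow> [:a:] \<in> coeffs_in N \<longleftrightarrow> a \<in> N"
  by (auto simp: coeffs_in_def coeff_pCons is_ideal_zero split: nat.splits)

lemma is_ideal_coeffs_in:
  assumes "is_ideal N"
  shows "is_ideal (coeffs_in N)"
  using assms
  by (auto simp: is_ideal_def coeffs_in_def coeff_mult intro!: is_ideal_sum[OF assms])

text \<open>Gauss's argument: the product of the lowest coefficients of \<open>p\<close> and \<open>q\<close> outside \<open>N\<close> is, up to
  elements of \<open>N\<close>, a coefficient of \<open>p * q\<close>. The hypothesis asks for primality of \<open>N\<close> on the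
  coefficients of \<open>p\<close> and \<open>q\<close> alone, so that the lemma also applies to ideals that are only known
  to be prime on homogeneous elements.\<close>

lemma coeffs_in_mult_cases:
  assumes N: "is_ideal N" and pq: "p * q \<in> coeffs_in N"
    and prime: "\<And>i j. Polynomial.coeff p i * Polynomial.coeff q j \<in> N \<Longrightarrow>
                  Polynomial.coeff p i \<in> N \<or> Polynomial.coeff q j \<in> N"
  shows "p \<in> coeffs_in N \<or> q \<in> coeffs_in N"
proof (rule ccontr)
  assume "\<not> ?thesis"
  then obtain i0 j0 where ij0: "Polynomial.coeff p i0 \<notin> N" "Polynomial.coeff q j0 \<notin> N"
    by (auto simp: coeffs_in_def)
  define i where "i = (LEAST i. Polynomial.coeff p i \<notin> N)"
  define j where "j = (LEAST j. Polynomial.coeff q j \<notin> N)"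
  have i: "Polynomial.coeff p i \<notin> N"
    unfolding i_def using LeastI[of "\<lambda>i. Polynomial.coeff p i \<notin> N", OF ij0(1)] .
  have j: "Polynomial.coeff q j \<notin> N"
    unfolding j_def using LeastI[of "\<lambda>i. Polynomial.coeff q i \<notin> N", OF ij0(2)] .
  have i_least: "Polynomial.coeff p a \<in> N" if "a < i" for a
    using not_less_Least that i_def by auto
  have j_least: "Polynomial.coeff q a \<in> N" if "a < j" for a
    using not_less_Least that j_def by auto
  have "Polynomial.coeff (p * q) (i + j) =
      (\<Sum>a\<le>i + j. Polynomial.coeff p a * Polynomial.coeff q (i + j - a))"
    by (simp add: coeff_mult)
  also have "\<dots> = Polynomial.coeff p i * Polynomial.coeff q j +
      (\<Sum>a\<in>{..i + j} - {i}. Polynomial.coeff p a * Polynomial.coeff q (i + j - a))"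
    by (subst sum.remove[of _ i]) auto
  finally have eq: "Polynomial.coeff p i * Polynomial.coeff q j = Polynomial.coeff (p * q) (i + j) -
      (\<Sum>a\<in>{..i + j} - {i}. Polynomial.coeff p a * Polynomial.coeff q (i + j - a))"
    by simp
  have "(\<Sum>a\<in>{..i + j} - {i}. Polynomial.coeff p a * Polynomial.coeff q (i + j - a)) \<in> N"
  proof (rule is_ideal_sum[OF N])
    fix a assume "a \<in> {..i + j} - {i}"
    then have "a < i \<or> i + j - a < j" by auto
    then show "Polynomial.coeff p a * Polynomial.coeff q (i + j - a) \<in> N"
      using i_least j_least is_ideal_mult_left[OF N] is_ideal_mult_right[OF N] by blast
  qed
  then have "Polynomial.coeff p i * Polynomial.coeff q j \<in> N"
    unfolding eq using pq by (intro is_ideal_diff[OF N]) (auto simp: coeffs_in_def)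
  with prime i j show False by blast
qed

lemma is_prime_coeffs_in:
  assumes "is_prime P"
  shows "is_prime (coeffs_in P)"
proof -
  have P: "is_ideal P" using assms by (rule is_prime_ideal)
  have "1 \<notin> coeffs_in P"
    using const_in_coeffs_in[OF P, of 1] is_prime_one[OF assms] by (simp add: one_pCons)
  moreover have "p \<in> coeffs_in P \<or> q \<in> coeffs_in P" if "p * q \<in> coeffs_in P" for p q
    by (rule coeffs_in_mult_cases[OF P that]) (simp add: is_prime_mult[OF assms])
  ultimately show ?thesis
    using is_ideal_coeffs_in[OF P] by (auto simp: is_prime_def)
qed


section \<open>Multivariate polynomials\<close>

subsection \<open>Evaluation\<close>

definition mono_eval :: "('x \<Rightarrow> 'r::comm_ring_1) \<Rightarrow> ('x \<Rightarrow>\<^sub>0 nat) \<Rightarrow> 'r" where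
  "mono_eval g u = (\<Prod>x\<in>Poly_Mapping.keys u. g x ^ Poly_Mapping.lookup u x)"

lemma mono_eval_superset:
  assumes "finite A" "Poly_Mapping.keys u \<subseteq> A"
  shows "mono_eval g u = (\<Prod>x\<in>A. g x ^ Poly_Mapping.lookup u x)"
  unfolding mono_eval_def
  by (rule prod.mono_neutral_left) (use assms in \<open>auto simp: in_keys_iff\<close>)

lemma mono_eval_0: "mono_eval g 0 = 1"
  by (simp add: mono_eval_def)

lemma mono_eval_add: "mono_eval g (u + v) = mono_eval g u * mono_eval g v"
proof -
  let ?A = "Poly_Mapping.keys u \<union> Poly_Mapping.keys v"
  have "mono_eval g (u + v) = (\<Prod>x\<in>?A. g x ^ Poly_Mapping.lookup (u + v) x)"
    by (rule mono_eval_superset) (use Poly_Mapping.keys_add[of u v] in auto)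
  also have "\<dots> = mono_eval g u * mono_eval g v"
    by (simp add: mono_eval_superset[of ?A] lookup_add power_add prod.distrib)
  finally show ?thesis .
qed

lemma mpoly_eval_superset:
  assumes "finite A" "Poly_Mapping.keys p \<subseteq> A" and "ring_morphism h"
  shows "mpoly_eval h g p = (\<Sum>u\<in>A. h (Poly_Mapping.lookup p u) * mono_eval g u)"
  unfolding mpoly_eval_def mono_eval_def
  by (rule sum.mono_neutral_left)
    (use assms in \<open>auto simp: in_keys_iff ring_morphism.zero\<close>)

lemma mpoly_sum_monomials:
  "p = (\<Sum>u\<in>Poly_Mapping.keys p. Poly_Mapping.single u (Poly_Mapping.lookup p u))"
  by (rule poly_mapping_eqI)
    (auto simp: lookup_sum lookup_single when_def in_keys_iff sum.delta')

lemma mpoly_monomial_induct [case_names monomial add]: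
  fixes p :: "('x, 'k::comm_ring_1) mpoly"
  assumes "\<And>u c. P (Poly_Mapping.single u c)" and "\<And>p q. P p \<Longrightarrow> P q \<Longrightarrow> P (p + q)"
  shows "P p"
proof -
  have "P (\<Sum>u\<in>A. Poly_Mapping.single u (Poly_Mapping.lookup p u))" if "finite A" for A
    using that
  proof (induction A rule: finite_induct)
    case empty
    show ?case using assms(1)[of 0 0] by simp
  qed (use assms in auto)
  from this[of "Poly_Mapping.keys p"] mpoly_sum_monomials[of p] show ?thesis by simp
qed

lemma mpoly_eval_single:
  "ring_morphism h \<Longrightarrow> mpoly_eval h g (Poly_Mapping.single u c) = h c * mono_eval g u"
  using mpoly_eval_superset[of "{u}" "Poly_Mapping.single u c" h g] by auto

lemma ring_morphism_mpoly_eval: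
  assumes h: "ring_morphism h"
  shows "ring_morphism (mpoly_eval h g)"
proof -
  interpret h: ring_morphism h by fact
  have add: "mpoly_eval h g (p + q) = mpoly_eval h g p + mpoly_eval h g q" for p q
  proof -
    let ?A = "Poly_Mapping.keys p \<union> Poly_Mapping.keys q"
    have "mpoly_eval h g (p + q) = (\<Sum>u\<in>?A. h (Poly_Mapping.lookup (p + q) u) * mono_eval g u)"
      by (rule mpoly_eval_superset) (use Poly_Mapping.keys_add[of p q] h in auto)
    also have "\<dots> = mpoly_eval h g p + mpoly_eval h g q"
      by (simp add: mpoly_eval_superset[of ?A] h lookup_add h.add sum.distrib distrib_right)
    finally show ?thesis .
  qed
  show ?thesis
  proof
    show "mpoly_eval h g 1 = 1"
      using mpoly_eval_single[OF h, of g 0 1] by (simp add: h.one mono_eval_0)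
    show "mpoly_eval h g (p * q) = mpoly_eval h g p * mpoly_eval h g q" for p q
    proof (induction p rule: mpoly_monomial_induct)
      case (monomial u c)
      show ?case
        by (induction q rule: mpoly_monomial_induct)
          (simp_all add: mult_single mpoly_eval_single h h.mult mono_eval_add add distrib_left)
    qed (simp add: distrib_right add)
  qed (rule add)
qed

lemma mpoly_eval_mconst: "ring_morphism h \<Longrightarrow> mpoly_eval h g (mconst c) = h c"
  by (simp add: mconst_def mpoly_eval_single mono_eval_0)

lemma mpoly_eval_mvar: "ring_morphism h \<Longrightarrow> mpoly_eval h g (mvar x) = g x"
  by (simp add: mvar_def mpoly_eval_single mono_eval_def ring_morphism.one)

lemma ring_morphism_mconst: "ring_morphism mconst"
  by (simp add: ring_morphism_def mconst_def single_add mult_single)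

lemma mvar_power: "mvar x ^ n = Poly_Mapping.single (Poly_Mapping.single x n) (1::'k::comm_ring_1)"
  by (induction n) (simp_all add: mvar_def mult_single flip: single_add)

lemma mono_eval_mvar:
  "mono_eval mvar u = (Poly_Mapping.single u 1 :: ('x, 'k::comm_ring_1) mpoly)"
proof -
  have "(\<Prod>x\<in>A. (mvar x :: ('x, 'k) mpoly) ^ Poly_Mapping.lookup u x) =
      Poly_Mapping.single (\<Sum>x\<in>A. Poly_Mapping.single x (Poly_Mapping.lookup u x)) 1" if "finite A" for A
    using that by (induction A rule: finite_induct) (simp_all add: mvar_power mult_single)
  moreover have "(\<Sum>x\<in>Poly_Mapping.keys u. Poly_Mapping.single x (Poly_Mapping.lookup u x)) = u"
    by (rule poly_mapping_eqI)
      (auto simp: lookup_sum lookup_single when_def in_keys_iff sum.delta')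
  ultimately show ?thesis by (simp add: mono_eval_def)
qed

lemma mpoly_eval_id: "mpoly_eval mconst mvar p = p"
  unfolding mpoly_eval_superset[OF finite_keys subset_refl ring_morphism_mconst] mono_eval_mvar
  using mpoly_sum_monomials[of p] by (simp add: mconst_def mult_single)


definition polys_in :: "'x set \<Rightarrow> ('x, 'k::comm_ring_1) mpoly set" where
  "polys_in D = {p. \<forall>u\<in>Poly_Mapping.keys p. Poly_Mapping.keys u \<subseteq> D}"

lemma polys_in_mono: "D \<subseteq> E \<Longrightarrow> polys_in D \<subseteq> polys_in E"
  by (auto simp: polys_in_def)

lemma polys_in_UNIV: "p \<in> polys_in UNIV"
  by (simp add: polys_in_def)

lemma mconst_polys_in: "mconst c \<in> polys_in D"
  by (simp add: polys_in_def mconst_def)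

lemma zero_polys_in: "0 \<in> polys_in D"
  and one_polys_in: "1 \<in> polys_in D"
  by (simp_all add: polys_in_def)

lemma mvar_polys_in: "x \<in> D \<Longrightarrow> mvar x \<in> polys_in D"
  by (simp add: polys_in_def mvar_def)

lemma polys_in_add: "p \<in> polys_in D \<Longrightarrow> q \<in> polys_in D \<Longrightarrow> p + q \<in> polys_in D"
  using Poly_Mapping.keys_add[of p q] unfolding polys_in_def by blast

lemma polys_in_uminus: "p \<in> polys_in D \<Longrightarrow> - p \<in> polys_in D"
  by (simp add: polys_in_def in_keys_iff)

lemma polys_in_mult:
  assumes "p \<in> polys_in D" "q \<in> polys_in D"
  shows "p * q \<in> polys_in D"
  unfolding polys_in_def
proof (intro CollectI ballI)
  fix w assume "w \<in> Poly_Mapping.keys (p * q)"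
  then obtain u v where "w = u + v" "u \<in> Poly_Mapping.keys p" "v \<in> Poly_Mapping.keys q"
    using Poly_Mapping.keys_mult[of p q] by auto
  with assms show "Poly_Mapping.keys w \<subseteq> D"
    using Poly_Mapping.keys_add[of u v] unfolding polys_in_def by blast
qed

text \<open>The common source of all statements that a value of a polynomial in the variables \<open>D\<close> has a
  certain shape: these values form the subring generated by the constants and the images of \<open>D\<close>.\<close>

lemma mpoly_eval_closed:
  assumes p: "p \<in> polys_in D" and h: "ring_morphism h"
    and const: "\<And>c. h c \<in> B" and var: "\<And>x. x \<in> D \<Longrightarrow> g x \<in> B"
    and add: "\<And>a b. a \<in> B \<Longrightarrow> b \<in> B \<Longrightarrow> a + b \<in> B" and mult: "\<And>a b. a \<in> B \<Longrightarrow> b \<in> B \<Longrightarrow> a * b \<in> B"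
  shows "mpoly_eval h g p \<in> B"
proof -
  have 0: "0 \<in> B" and 1: "1 \<in> B"
    using const[of 0] const[of 1] by (simp_all add: morphism_simps[OF h])
  have pow: "a ^ n \<in> B" if "a \<in> B" for a n
    using that by (induction n) (auto intro: 1 mult)
  have prod: "prod f A \<in> B" if "\<And>x. x \<in> A \<Longrightarrow> f x \<in> B" for f :: "'a \<Rightarrow> 'c" and A
    using that by (induction A rule: infinite_finite_induct) (auto intro: 1 mult)
  have sum: "sum f A \<in> B" if "\<And>x. x \<in> A \<Longrightarrow> f x \<in> B" for f :: "('a \<Rightarrow>\<^sub>0 nat) \<Rightarrow> 'c" and A
    using that by (induction A rule: infinite_finite_induct) (auto intro: 0 add)
  show ?thesis
    unfolding mpoly_eval_def
    by (rule sum, rule mult[OF const], rule prod, rule pow, rule var) (use p in \<open>auto simp: polys_in_def\<close>)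
qed

lemma mpoly_induct [consumes 1, case_names const var add mult]:
  assumes "p \<in> polys_in D" and "\<And>c. P (mconst c)" and "\<And>x. x \<in> D \<Longrightarrow> P (mvar x)"
    and "\<And>p q. P p \<Longrightarrow> P q \<Longrightarrow> P (p + q)" and "\<And>p q. P p \<Longrightarrow> P q \<Longrightarrow> P (p * q)"
  shows "P p"
  using mpoly_eval_closed[OF assms(1) ring_morphism_mconst, of "Collect P" mvar] assms(2-)
  by (simp add: mpoly_eval_id)

lemma polys_in_empty:
  assumes "p \<in> polys_in {}"
  obtains c where "p = mconst c"
proof -
  from assms have "\<exists>c. p = mconst c"
    by (induction p rule: mpoly_induct)
      (auto intro: morphism_simps(3,4)[OF ring_morphism_mconst, symmetric])
  then show thesis using that by blast
qed

text \<open>Multiplication is only by variables, so an inductive claim about decompositions of \<open>p\<close> need not be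
  shown to be compatible with products.\<close>

lemma mpoly_var_mult_induct [case_names const var_mult add]:
  assumes const: "\<And>c. P (mconst c)" and var_mult: "\<And>x p. P p \<Longrightarrow> P (mvar x * p)"
    and add: "\<And>p q. P p \<Longrightarrow> P q \<Longrightarrow> P (p + q)"
  shows "P p"
proof -
  have "\<forall>q. P q \<longrightarrow> P (p * q)"
  proof (induction p rule: mpoly_induct[OF polys_in_UNIV, case_names const var add mult])
    case (const c)
    show ?case
    proof (intro allI impI)
      fix q assume "P q"
      have "\<forall>q. P (mconst c * q)"
      proof
        fix q
        show "P (mconst c * q)"
        proof (induction q rule: mpoly_monomial_induct)
          case (monomial u d)
          have "P (mconst e * (\<Prod>x\<in>A. mvar x ^ Poly_Mapping.lookup u x))" if "finite A" for A e
            using that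
          proof (induction A rule: finite_induct)
            case empty
            show ?case using assms(1) by simp
          next
            case (insert x A)
            have "P (mvar x ^ n * (mconst e * (\<Prod>x\<in>A. mvar x ^ Poly_Mapping.lookup u x)))" for n
              by (induction n) (use insert.IH var_mult in \<open>auto simp: mult.assoc\<close>)
            with insert.hyps show ?case by (simp add: mult.left_commute)
          qed
          from this[of "Poly_Mapping.keys u" "c * d"]
          have "P (mconst (c * d) * mono_eval mvar u)"
            by (simp add: mono_eval_def)
          also have "mconst (c * d) * mono_eval mvar u = mconst c * Poly_Mapping.single u d"
            by (simp add: mono_eval_mvar mconst_def mult_single)
          finally show ?case .
        next
          case (add p q)
          then show ?case using assms(3) by (simp add: distrib_left)
        qed
      qed
      then show "P (mconst c * q)" by blast
    qed
  qed (use var_mult add in \<open>auto simp: distrib_right mult.assoc\<close>)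
  from this[THEN spec, of "mconst 1"] const[of 1] show ?thesis
    by (simp add: ring_morphism.one[OF ring_morphism_mconst])
qed

text \<open>All identities between composites of evaluation maps below are instances of this principle.\<close>

lemma morphism_agree:
  assumes F: "ring_morphism F" and G: "ring_morphism G"
    and const: "\<And>c. F (mconst c) = G (mconst c)"
    and var: "\<And>x. x \<in> D \<Longrightarrow> F (mvar x) = G (mvar x)" and p: "p \<in> polys_in D"
  shows "F p = G p"
  using p by (induction p rule: mpoly_induct) (simp_all add: const var morphism_simps[OF F] morphism_simps[OF G])


subsection \<open>Partial derivatives\<close>

lemma mpoly_pderiv_superset:
  assumes "finite A" "Poly_Mapping.keys p \<subseteq> A"
  shows "mpoly_pderiv x p = (\<Sum>u\<in>A. Poly_Mapping.single (u - Poly_Mapping.single x 1)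
        (of_nat (Poly_Mapping.lookup u x) * Poly_Mapping.lookup p u))"
  unfolding mpoly_pderiv_def
  by (rule sum.mono_neutral_left) (use assms in \<open>auto simp: in_keys_iff\<close>)

lemma mpoly_pderiv_single:
  "mpoly_pderiv x (Poly_Mapping.single u c) =
    Poly_Mapping.single (u - Poly_Mapping.single x 1) (of_nat (Poly_Mapping.lookup u x) * c)"
  using mpoly_pderiv_superset[of "{u}" "Poly_Mapping.single u c" x] by auto

lemma mpoly_pderiv_add: "mpoly_pderiv x (p + q) = mpoly_pderiv x p + mpoly_pderiv x q"
proof -
  let ?A = "Poly_Mapping.keys p \<union> Poly_Mapping.keys q"
  have "mpoly_pderiv x (p + q) = (\<Sum>u\<in>?A. Poly_Mapping.single (u - Poly_Mapping.single x 1)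
        (of_nat (Poly_Mapping.lookup u x) * Poly_Mapping.lookup (p + q) u))"
    by (rule mpoly_pderiv_superset) (use Poly_Mapping.keys_add[of p q] in auto)
  also have "\<dots> = mpoly_pderiv x p + mpoly_pderiv x q"
    by (simp add: mpoly_pderiv_superset[of ?A] lookup_add distrib_left single_add sum.distrib)
  finally show ?thesis .
qed

lemma mpoly_pderiv_mconst: "mpoly_pderiv x (mconst c) = 0"
  by (simp add: mconst_def mpoly_pderiv_single)

lemma mpoly_pderiv_mvar: "mpoly_pderiv x (mvar y) = (if x = y then 1 else 0)"
  by (simp add: mvar_def mpoly_pderiv_single lookup_single)

lemma mpoly_pderiv_mult:
  fixes p q :: "('x, 'k::comm_ring_1) mpoly"
  shows "mpoly_pderiv x (p * q) = mpoly_pderiv x p * q + p * mpoly_pderiv x q"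
proof (induction p rule: mpoly_monomial_induct)
  case (monomial u c)
  show ?case
  proof (induction q rule: mpoly_monomial_induct)
    case (monomial v d)
    let ?e = "Poly_Mapping.single x (1::nat)"
    have shift: "(u' - ?e) + v' = (u' + v') - ?e" if "Poly_Mapping.lookup u' x \<noteq> 0" for u' v' :: "'x \<Rightarrow>\<^sub>0 nat"
      by (rule poly_mapping_eqI) (use that in \<open>auto simp: lookup_add lookup_minus lookup_single when_def\<close>)
    have left: "Poly_Mapping.single (u' - ?e + v') (of_nat (Poly_Mapping.lookup u' x) * a) =
        Poly_Mapping.single (u' + v' - ?e) (of_nat (Poly_Mapping.lookup u' x) * a)"
      for u' v' :: "'x \<Rightarrow>\<^sub>0 nat" and a :: 'k
    proof (cases "Poly_Mapping.lookup u' x = 0")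
      case False
      show ?thesis by (simp only: shift[OF False])
    qed simp
    have "mpoly_pderiv x (Poly_Mapping.single u c) * Poly_Mapping.single v d =
        Poly_Mapping.single (u + v - ?e) (of_nat (Poly_Mapping.lookup u x) * (c * d))"
      using left[of u v "c * d"] by (simp add: mpoly_pderiv_single mult_single mult.assoc)
    moreover have "Poly_Mapping.single u c * mpoly_pderiv x (Poly_Mapping.single v d) =
        Poly_Mapping.single (u + v - ?e) (of_nat (Poly_Mapping.lookup v x) * (c * d))"
      using left[of v u "c * d"]
      by (simp add: mpoly_pderiv_single mult_single add.commute mult.left_commute)
    ultimately show ?case
      by (simp add: mpoly_pderiv_single mult_single lookup_add distrib_right flip: single_add)
  qed (simp add: mpoly_pderiv_add algebra_simps)
qed (simp add: mpoly_pderiv_add algebra_simps)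

lemma mpoly_pderiv_0: "mpoly_pderiv x 0 = 0"
  by (simp add: mpoly_pderiv_def)

lemma mpoly_pderiv_sum: "mpoly_pderiv x (sum f A) = (\<Sum>a\<in>A. mpoly_pderiv x (f a))"
  by (induction A rule: infinite_finite_induct) (simp_all add: mpoly_pderiv_0 mpoly_pderiv_add)

lemma mpoly_pderiv_uminus: "mpoly_pderiv x (- p) = - mpoly_pderiv x p"
  using mpoly_pderiv_add[of x p "- p"] by (simp add: mpoly_pderiv_0 eq_neg_iff_add_eq_0 add.commute)

lemma mpoly_pderiv_diff: "mpoly_pderiv x (p - q) = mpoly_pderiv x p - mpoly_pderiv x q"
  using mpoly_pderiv_add[of x p "- q"] by (simp add: mpoly_pderiv_uminus)

lemma mpoly_pderiv_polys_in: "p \<in> polys_in D \<Longrightarrow> x \<notin> D \<Longrightarrow> mpoly_pderiv x p = 0"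
  by (induction p rule: mpoly_induct)
    (auto simp: mpoly_pderiv_mconst mpoly_pderiv_mvar mpoly_pderiv_add mpoly_pderiv_mult)


subsection \<open>Expansion in one variable\<close>

definition expand :: "'x \<Rightarrow> ('x, 'k::comm_ring_1) mpoly \<Rightarrow> ('x, 'k) mpoly poly" where
  "expand v = mpoly_eval (\<lambda>c. [:mconst c:]) (\<lambda>x. if x = v then [:0, 1:] else [:mvar x:])"

lemma ring_morphism_poly_const: "ring_morphism (\<lambda>c. [:mconst c:])"
  by (rule ring_morphism_comp[OF ring_morphism_pCons ring_morphism_mconst])

lemma ring_morphism_expand: "ring_morphism (expand v)"
  unfolding expand_def by (rule ring_morphism_mpoly_eval[OF ring_morphism_poly_const])

lemma expand_mconst: "expand v (mconst c) = [:mconst c:]"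
  and expand_mvar: "expand v (mvar x) = (if x = v then [:0, 1:] else [:mvar x:])"
  by (simp_all add: expand_def mpoly_eval_mconst mpoly_eval_mvar ring_morphism_poly_const)

lemma poly_expand: "poly (expand v p) (mvar v) = p"
proof -
  have "(\<lambda>p. poly (expand v p) (mvar v)) p = (\<lambda>p. p) p"
    by (rule morphism_agree[OF ring_morphism_comp[OF ring_morphism_poly ring_morphism_expand] ring_morphism_id])
      (auto simp: expand_mconst expand_mvar intro: polys_in_UNIV)
  then show ?thesis .
qed

lemma expand_const: "p \<in> polys_in D \<Longrightarrow> v \<notin> D \<Longrightarrow> expand v p = [:p:]"
  by (rule morphism_agree[OF ring_morphism_expand ring_morphism_pCons, of _ D])
    (auto simp: expand_mconst expand_mvar)

lemma coeff_mpoly_eval_polys_in: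
  assumes p: "p \<in> polys_in D" and h: "ring_morphism h"
    and "\<And>c. h c \<in> {q. \<forall>i. Polynomial.coeff q i \<in> polys_in E}"
    and "\<And>x. x \<in> D \<Longrightarrow> g x \<in> {q. \<forall>i. Polynomial.coeff q i \<in> polys_in E}"
  shows "Polynomial.coeff (mpoly_eval h g p) i \<in> polys_in E"
proof -
  have sum: "sum f A \<in> polys_in E" if "\<And>x. x \<in> A \<Longrightarrow> f x \<in> polys_in E" for f :: "nat \<Rightarrow> ('c, 'd) mpoly" and A
    using that by (induction A rule: infinite_finite_induct) (auto intro: zero_polys_in polys_in_add)
  have "mpoly_eval h g p \<in> {q. \<forall>i. Polynomial.coeff q i \<in> polys_in E}"
    by (rule mpoly_eval_closed[OF p h assms(3,4)])
      (auto simp: coeff_mult intro!: polys_in_add polys_in_mult sum)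
  then show ?thesis by blast
qed

lemma coeff_expand_polys_in:
  assumes "p \<in> polys_in (insert v D)"
  shows "Polynomial.coeff (expand v p) i \<in> polys_in D"
  unfolding expand_def
  by (rule coeff_mpoly_eval_polys_in[OF assms ring_morphism_poly_const])
    (auto simp: coeff_pCons intro: zero_polys_in one_polys_in mconst_polys_in mvar_polys_in split: nat.splits)

text \<open>The ideal generated by the elements of \<open>P\<close> that do not involve \<open>v\<close>. It is stated through the
  coefficients in \<open>v\<close>, so that its primality is an instance of Gauss's argument.\<close>

definition expand_ideal :: "'x \<Rightarrow> ('x, 'k::comm_ring_1) mpoly set \<Rightarrow> ('x, 'k) mpoly set" where
  "expand_ideal v P = expand v -` coeffs_in P"

lemma is_prime_expand_ideal: "is_prime P \<Longrightarrow> is_prime (expand_ideal v P)"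
  unfolding expand_ideal_def
  by (intro ring_morphism.is_prime_vimage[OF ring_morphism_expand] is_prime_coeffs_in)

lemma poly_mem_ideal: "is_ideal N \<Longrightarrow> p \<in> coeffs_in N \<Longrightarrow> poly p a \<in> N"
  unfolding poly_altdef by (intro is_ideal_sum is_ideal_mult_right coeffs_inD)

lemma expand_ideal_subset: "is_ideal P \<Longrightarrow> expand_ideal v P \<subseteq> P"
  by (metis expand_ideal_def poly_expand poly_mem_ideal subsetI vimage_eq)

lemma expand_ideal_const: "is_ideal P \<Longrightarrow> p \<in> polys_in D \<Longrightarrow> v \<notin> D \<Longrightarrow> p \<in> P \<Longrightarrow> p \<in> expand_ideal v P"
  by (simp add: expand_ideal_def expand_const const_in_coeffs_in)


section \<open>Dimension theory of polynomial rings\<close>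

definition prime_chain_to :: "'a::comm_ring_1 set \<Rightarrow> nat \<Rightarrow> bool" where
  "prime_chain_to P r \<longleftrightarrow>
     (\<exists>c. (\<forall>i\<le>r. is_prime (c i)) \<and> (\<forall>i<r. c i \<subset> c (Suc i)) \<and> c r = P)"

lemma prime_height_eq: "prime_height UR P = (SUP r\<in>{r. prime_chain_to P r}. enat r)"
  by (simp add: prime_height_def prime_chain_to_def primeideal_UR_iff)

lemma prime_chain_to_0: "prime_chain_to P 0 \<longleftrightarrow> is_prime P"
  by (auto simp: prime_chain_to_def)

lemma prime_chain_to_Suc:
  "prime_chain_to P (Suc r) \<longleftrightarrow> is_prime P \<and> (\<exists>Q. Q \<subset> P \<and> prime_chain_to Q r)"
proof
  assume "prime_chain_to P (Suc r)"
  then obtain c where c: "\<forall>i\<le>Suc r. is_prime (c i)" "\<forall>i<Suc r. c i \<subset> c (Suc i)" "c (Suc r) = P"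
    by (auto simp: prime_chain_to_def)
  then have "prime_chain_to (c r) r"
    unfolding prime_chain_to_def by (intro exI[of _ c]) auto
  moreover have "is_prime P" "c r \<subset> P"
    using c(1)[rule_format, of "Suc r"] c(2)[rule_format, of r] c(3) by simp_all
  ultimately show "is_prime P \<and> (\<exists>Q. Q \<subset> P \<and> prime_chain_to Q r)" by (intro conjI exI)
next
  assume "is_prime P \<and> (\<exists>Q. Q \<subset> P \<and> prime_chain_to Q r)"
  then obtain c where c: "is_prime P" "c r \<subset> P" "\<forall>i\<le>r. is_prime (c i)" "\<forall>i<r. c i \<subset> c (Suc i)"
    by (auto simp: prime_chain_to_def)
  let ?c = "\<lambda>i. if i = Suc r then P else c i"
  have "is_prime (?c i)" if "i \<le> Suc r" for i
    using c that by auto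
  moreover have "?c i \<subset> ?c (Suc i)" if "i < Suc r" for i
    using c that by (cases "i = r") auto
  ultimately show "prime_chain_to P (Suc r)"
    unfolding prime_chain_to_def by (intro exI[of _ ?c]) auto
qed

lemma prime_chain_to_mono:
  "prime_chain_to P r \<Longrightarrow> P \<subseteq> Q \<Longrightarrow> is_prime Q \<Longrightarrow> prime_chain_to Q r"
  by (cases r) (simp_all add: prime_chain_to_0 prime_chain_to_Suc, blast)

lemma prime_height_mono: "P \<subseteq> Q \<Longrightarrow> is_prime Q \<Longrightarrow> prime_height UR P \<le> prime_height UR Q"
  unfolding prime_height_eq by (rule SUP_subset_mono) (auto intro: prime_chain_to_mono)

lemma height_UR_eq: "height UR I = (INF P\<in>{P. is_prime P \<and> I \<subseteq> P}. prime_height UR P)"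
  by (simp add: height_def primeideal_UR_iff)

lemma height_prime: "is_prime P \<Longrightarrow> height UR P = prime_height UR P"
  unfolding height_UR_eq
  by (rule antisym) (auto intro: INF_lower INF_greatest prime_height_mono)

text \<open>Passing from \<open>P\<close> to \<open>expand_ideal v P\<close> frees the variable \<open>v\<close> and loses the relation between \<open>v\<close>
  and \<open>D\<close>, so it is a strict step down; relations that do not involve \<open>v\<close> survive. Repeating this for
  all variables of \<open>A\<close> gives a chain of length \<open>card A\<close>.\<close>

lemma prime_chain_to_card:
  assumes "finite A" and "is_prime P" and "D \<inter> A = {}" and "polys_in D \<inter> P \<subseteq> {0}"
    and "\<And>v. v \<in> A \<Longrightarrow> \<exists>g\<in>polys_in (insert v D) \<inter> P. g \<noteq> 0"
  shows "prime_chain_to P (card A)"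
  using assms
proof (induction A arbitrary: P rule: finite_induct)
  case empty
  then show ?case by (simp add: prime_chain_to_0)
next
  case (insert v A)
  let ?Q = "expand_ideal v P"
  have P: "is_ideal P" using insert.prems(1) by (rule is_prime_ideal)
  have sub: "?Q \<subseteq> P" by (rule expand_ideal_subset[OF P])
  have "prime_chain_to ?Q (card A)"
  proof (rule insert.IH)
    show "is_prime ?Q" using insert.prems(1) by (rule is_prime_expand_ideal)
    show "\<exists>g\<in>polys_in (insert w D) \<inter> ?Q. g \<noteq> 0" if w: "w \<in> A" for w
    proof -
      obtain g where g: "g \<in> polys_in (insert w D)" "g \<in> P" "g \<noteq> 0"
        using insert.prems(4)[of w] w by blast
      have "v \<notin> insert w D"
        using w insert.hyps insert.prems(2) by auto
      with g show ?thesis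
        using expand_ideal_const[OF P g(1)] by blast
    qed
  qed (use insert.prems sub in auto)
  moreover obtain g where g: "g \<in> polys_in (insert v D)" "g \<in> P" "g \<noteq> 0"
    using insert.prems(4)[OF insertI1] by blast
  have "g \<notin> ?Q"
  proof
    assume "g \<in> ?Q"
    then have "Polynomial.coeff (expand v g) i \<in> P" for i
      by (simp add: expand_ideal_def coeffs_in_def)
    then have "Polynomial.coeff (expand v g) i = 0" for i
      using coeff_expand_polys_in[OF g(1)] insert.prems(3) by blast
    then have "expand v g = 0" by (simp add: poly_eq_iff)
    then show False using poly_expand[of v g] g(3) by simp
  qed
  with g sub have "?Q \<subset> P" by blast
  ultimately show ?case
    using insert.prems(1) insert.hyps by (auto simp: prime_chain_to_Suc)
qed

text \<open>Linear independence of the residue classes modulo \<open>P\<close> over the field of constants.\<close>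

definition indep_mod :: "('x, 'k::field) mpoly set \<Rightarrow> ('x, 'k) mpoly set \<Rightarrow> bool" where
  "indep_mod P S \<longleftrightarrow> (\<forall>c. (\<Sum>s\<in>S. mconst (c s) * s) \<in> P \<longrightarrow> (\<forall>s\<in>S. c s = 0))"

text \<open>Let \<open>g\<close> be in \<open>P\<close> but not in \<open>Q\<close>. In a relation modulo \<open>Q\<close> the terms without \<open>g\<close> give a relation
  modulo \<open>P\<close>, so their coefficients vanish; the rest is divisible by \<open>g\<close>, which can be cancelled
  because \<open>Q\<close> is prime. Thus \<open>g\<close> acts like a new variable over the family \<open>S\<close>.\<close>

lemma indep_mod_powers_family:
  fixes P :: "('x, 'k::field) mpoly set"
  assumes P: "is_prime P" and Q: "is_prime Q" and "Q \<subseteq> P" and g: "g \<in> P" "g \<notin> Q"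
    and S: "finite S" "indep_mod P S"
    and sum: "(\<Sum>s\<in>S. \<Sum>a<M. mconst (c s a) * (s * g ^ a)) \<in> Q"
  shows "\<forall>s\<in>S. \<forall>a<M. c s a = 0"
  using sum
proof (induction M arbitrary: c)
  case (Suc M)
  have iP: "is_ideal P" using P by (rule is_prime_ideal)
  let ?low = "\<Sum>s\<in>S. mconst (c s 0) * s"
  let ?high = "\<Sum>s\<in>S. \<Sum>a<M. mconst (c s (Suc a)) * (s * g ^ a)"
  have split: "(\<Sum>s\<in>S. \<Sum>a<Suc M. mconst (c s a) * (s * g ^ a)) = ?low + ?high * g"
    by (subst sum.lessThan_Suc_shift) (simp add: sum.distrib sum_distrib_left mult_ac)
  have "?high * g \<in> P" by (rule is_ideal_mult_left[OF iP g(1)])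
  then have "?low \<in> P"
    using Suc.prems \<open>Q \<subseteq> P\<close> is_ideal_add_cancel[OF iP, of "?high * g" ?low]
    unfolding split by (auto simp: add.commute)
  then have low: "\<forall>s\<in>S. c s 0 = 0"
    using S(2)[unfolded indep_mod_def, THEN spec[of _ "\<lambda>s. c s 0"]] by blast
  then have "?low = 0"
    by (simp add: ring_morphism.zero[OF ring_morphism_mconst])
  then have "?high * g \<in> Q"
    using Suc.prems unfolding split by simp
  then have "?high \<in> Q"
    using g(2) is_prime_mult[OF Q] by blast
  from Suc.IH[OF this] low show ?case
    by (auto simp: less_Suc_eq_0_disj)
qed simp

definition exps_le :: "nat \<Rightarrow> ('x, 'k::comm_ring_1) mpoly \<Rightarrow> bool" where
  "exps_le d p \<longleftrightarrow> (\<forall>u\<in>Poly_Mapping.keys p. \<forall>x. Poly_Mapping.lookup u x \<le> d)"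

lemma exps_le_mono: "exps_le d p \<Longrightarrow> d \<le> e \<Longrightarrow> exps_le e p"
  by (meson exps_le_def le_trans)

lemma exps_le_mult:
  assumes "exps_le d p" "exps_le e q"
  shows "exps_le (d + e) (p * q)"
  unfolding exps_le_def
proof (intro ballI allI)
  fix w x assume "w \<in> Poly_Mapping.keys (p * q)"
  then obtain u v where "w = u + v" "u \<in> Poly_Mapping.keys p" "v \<in> Poly_Mapping.keys q"
    using Poly_Mapping.keys_mult[of p q] by auto
  with assms show "Poly_Mapping.lookup w x \<le> d + e"
    by (auto simp: exps_le_def lookup_add intro!: add_mono)
qed

lemma exps_le_power: "exps_le d p \<Longrightarrow> exps_le (n * d) (p ^ n)"
  by (induction n) (auto simp: exps_le_def[of 0] intro: exps_le_mult)

lemma exps_le_exists: "\<exists>d. exps_le d p"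
proof -
  let ?A = "(\<lambda>(u, x). Poly_Mapping.lookup u x) ` Sigma (Poly_Mapping.keys p) Poly_Mapping.keys"
  have "Poly_Mapping.lookup u x \<le> Max ?A" if "u \<in> Poly_Mapping.keys p" for u x
  proof (cases "x \<in> Poly_Mapping.keys u")
    case True
    then show ?thesis using that by (intro Max_ge) force+
  qed (simp add: in_keys_iff)
  then show ?thesis by (auto simp: exps_le_def)
qed

lemma indep_mod_powers:
  fixes P :: "('x, 'k::field) mpoly set" and M :: nat
  assumes P: "is_prime P" and Q: "is_prime Q" and "Q \<subseteq> P" and g: "g \<in> P" "g \<notin> Q"
    and S: "finite S" "indep_mod P S"
  defines "S' \<equiv> (\<lambda>(s, a). s * g ^ a) ` (S \<times> {..<M})"
  shows "card S' = card S * M" and "indep_mod Q S'"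
proof -
  note family = indep_mod_powers_family[OF P Q \<open>Q \<subseteq> P\<close> g S]
  have reindex: "(\<Sum>s\<in>S. \<Sum>a<M. mconst (c s a) * (s * g ^ a)) =
      (\<Sum>(s, a)\<in>S \<times> {..<M}. mconst (c s a) * (s * g ^ a))" for c :: "_ \<Rightarrow> _ \<Rightarrow> 'k"
    by (simp add: sum.cartesian_product)
  have inj: "inj_on (\<lambda>(s, a). s * g ^ a) (S \<times> {..<M})"
  proof (rule inj_onI)
    fix y z assume y: "y \<in> S \<times> {..<M}" and z: "z \<in> S \<times> {..<M}"
      and eq: "(\<lambda>(s, a). s * g ^ a) y = (\<lambda>(s, a). s * g ^ a) z"
    show "y = z"
    proof (rule ccontr)
      assume "y \<noteq> z"
      (* two equal products would be a nontrivial relation with coefficients 1 and -1 *)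
      define c where "c = (\<lambda>w. if w = y then 1 else if w = z then - 1 else (0::'k))"
      have "(\<Sum>w\<in>S \<times> {..<M}. mconst (c w) * (case w of (s, a) \<Rightarrow> s * g ^ a)) =
          (\<Sum>w\<in>{y, z}. mconst (c w) * (case w of (s, a) \<Rightarrow> s * g ^ a))"
        by (rule sum.mono_neutral_right)
          (use y z S in \<open>auto simp: c_def morphism_simps[OF ring_morphism_mconst]\<close>)
      also have "\<dots> = 0"
        using \<open>y \<noteq> z\<close> eq by (simp add: c_def morphism_simps[OF ring_morphism_mconst])
      finally have "(\<Sum>s\<in>S. \<Sum>a<M. mconst (c (s, a)) * (s * g ^ a)) = 0"
        by (simp add: reindex case_prod_beta)
      then have "\<forall>s\<in>S. \<forall>a<M. c (s, a) = 0"
        using is_ideal_zero[OF is_prime_ideal[OF Q]] by (intro family) simp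
      with y have "c y = 0" by (cases y) auto
      then show False by (simp add: c_def)
    qed
  qed
  then show "card S' = card S * M"
    by (simp add: S'_def card_image card_cartesian_product)
  show "indep_mod Q S'"
    unfolding indep_mod_def
  proof (intro allI impI)
    fix c assume "(\<Sum>s\<in>S'. mconst (c s) * s) \<in> Q"
    then have "(\<Sum>s\<in>S. \<Sum>a<M. mconst (c (s * g ^ a)) * (s * g ^ a)) \<in> Q"
      unfolding reindex S'_def sum.reindex[OF inj] by (simp add: case_prod_beta)
    from family[OF this] show "\<forall>s\<in>S'. c s = 0" by (auto simp: S'_def)
  qed
qed

text \<open>Each step of a chain of primes multiplies the size of an independent family by \<open>M\<close>, while the
  exponents grow only linearly in \<open>M\<close>. The constant \<open>e\<close> depends on the chain alone, not on \<open>M\<close>.\<close>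

lemma indep_mod_descend_chain:
  fixes P :: "('x, 'k::field) mpoly set"
  assumes "prime_chain_to P r"
  shows "\<exists>e. \<forall>M d S. finite S \<and> indep_mod P S \<and> (\<forall>s\<in>S. exps_le d s) \<longrightarrow>
    (\<exists>S' :: ('x, 'k) mpoly set. finite S' \<and> indep_mod {0} S' \<and> card S' = card S * M ^ r \<and> (\<forall>s\<in>S'. exps_le (d + e * M) s))"
  using assms
proof (induction r arbitrary: P)
  case 0
  then have "0 \<in> P" using is_prime_ideal is_ideal_zero by (auto simp: prime_chain_to_0)
  then have bottom: "indep_mod {0} S" if "indep_mod P S" for S
    using that by (auto simp: indep_mod_def)
  show ?case
    by (rule exI[of _ 0]) (use bottom in \<open>auto\<close>)
next
  case (Suc r)
  then obtain Q where P: "is_prime P" and "Q \<subset> P" and chain: "prime_chain_to Q r"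
    by (auto simp: prime_chain_to_Suc)
  then obtain g where g: "g \<in> P" "g \<notin> Q" by auto
  have Q: "is_prime Q"
    using chain by (cases r) (auto simp: prime_chain_to_0 prime_chain_to_Suc)
  obtain e where e: "\<forall>M d S. finite S \<and> indep_mod Q S \<and> (\<forall>s\<in>S. exps_le d s) \<longrightarrow>
    (\<exists>S' :: ('x, 'k) mpoly set. finite S' \<and> indep_mod {0} S' \<and> card S' = card S * M ^ r \<and> (\<forall>s\<in>S'. exps_le (d + e * M) s))"
    using Suc.IH[OF chain] ..
  obtain e' where e': "exps_le e' g" using exps_le_exists by blast
  show ?case
  proof (intro exI[of _ "e' + e"] allI impI)
    fix M d S assume S: "finite S \<and> indep_mod P S \<and> (\<forall>s\<in>S. exps_le d s)"
    let ?S1 = "(\<lambda>(s, a). s * g ^ a) ` (S \<times> {..<M})"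
    have "card ?S1 = card S * M" "indep_mod Q ?S1"
      using indep_mod_powers[OF P Q _ g, of S M] S \<open>Q \<subset> P\<close> by auto
    moreover have "exps_le (d + M * e') (s * g ^ a)" if "s \<in> S" "a < M" for s a
      by (rule exps_le_mult) (use S that exps_le_power[OF e', of a] in \<open>auto intro: exps_le_mono\<close>)
    then have "\<forall>s\<in>?S1. exps_le (d + M * e') s" by auto
    ultimately obtain S' :: "('x, 'k) mpoly set" where "finite S'" "indep_mod {0} S'" "card S' = card ?S1 * M ^ r"
      "\<forall>s\<in>S'. exps_le (d + M * e' + e * M) s"
      using e[THEN spec[of _ M], THEN spec[of _ "d + M * e'"], THEN spec[of _ ?S1]] S by auto
    then show "\<exists>S' :: ('x, 'k) mpoly set. finite S' \<and> indep_mod {0} S' \<and> card S' = card S * M ^ Suc r \<and>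
        (\<forall>s\<in>S'. exps_le (d + (e' + e) * M) s)"
      using \<open>card ?S1 = card S * M\<close> by (intro exI[of _ S']) (auto simp: algebra_simps)
  qed
qed

lemma monomials_bounded:
  fixes D :: "'x set" and d :: nat
  assumes "finite D"
  defines "U \<equiv> {u :: 'x \<Rightarrow>\<^sub>0 nat. Poly_Mapping.keys u \<subseteq> D \<and> (\<forall>x. Poly_Mapping.lookup u x \<le> d)}"
  shows "finite U" and "card U = Suc d ^ card D"
proof -
  have "bij_betw (\<lambda>u. restrict (Poly_Mapping.lookup u) D) U (PiE D (\<lambda>_. {..d}))"
  proof (rule bij_betw_byWitness[where f' = "\<lambda>f. Abs_poly_mapping (\<lambda>x. if x \<in> D then f x else 0)"])
    have fin: "finite {x. (if x \<in> D then f x else 0) \<noteq> (0::nat)}" for f :: "'x \<Rightarrow> nat"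
      by (rule finite_subset[OF _ assms(1)]) auto
    then have lookup: "Poly_Mapping.lookup (Abs_poly_mapping (\<lambda>x. if x \<in> D then f x else 0)) =
        (\<lambda>x. if x \<in> D then f x else (0::nat))" for f
      by (simp add: Abs_poly_mapping_inverse)
    show "\<forall>u\<in>U. Abs_poly_mapping (\<lambda>x. if x \<in> D then restrict (Poly_Mapping.lookup u) D x else 0) = u"
      by (auto simp: U_def in_keys_iff subset_iff lookup intro!: poly_mapping_eqI)
    show "\<forall>f\<in>PiE D (\<lambda>_. {..d}).
        restrict (Poly_Mapping.lookup (Abs_poly_mapping (\<lambda>x. if x \<in> D then f x else 0))) D = f"
      by (auto simp: lookup fun_eq_iff PiE_def extensional_def)
    show "(\<lambda>u. restrict (Poly_Mapping.lookup u) D) ` U \<subseteq> PiE D (\<lambda>_. {..d})"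
      by (auto simp: U_def)
    show "(\<lambda>f. Abs_poly_mapping (\<lambda>x. if x \<in> D then f x else 0)) ` PiE D (\<lambda>_. {..d}) \<subseteq> U"
      by (auto simp: U_def lookup in_keys_iff split: if_splits)
  qed
  moreover have "finite (PiE D (\<lambda>_. {..d}))" "card (PiE D (\<lambda>_. {..d})) = Suc d ^ card D"
    using assms(1) by (auto simp: card_PiE finite_PiE)
  ultimately show "finite U" "card U = Suc d ^ card D"
    by (auto simp: bij_betw_finite bij_betw_same_card)
qed

lemma card_indep_le:
  fixes S :: "('x::finite, 'k::field) mpoly set"
  assumes S: "finite S" "indep_mod {0} S" "\<forall>s\<in>S. exps_le d s"
  shows "card S \<le> Suc d ^ CARD('x)"
proof -
  interpret V: vector_space "\<lambda>c (p :: ('x, 'k) mpoly). mconst c * p"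
    by unfold_locales (simp_all add: algebra_simps morphism_simps[OF ring_morphism_mconst])
  let ?U = "{u :: 'x \<Rightarrow>\<^sub>0 nat. Poly_Mapping.keys u \<subseteq> UNIV \<and> (\<forall>x. Poly_Mapping.lookup u x \<le> d)}"
  let ?T = "(\<lambda>u. Poly_Mapping.single u (1::'k)) ` ?U"
  have U: "finite ?U" "card ?U = Suc d ^ CARD('x)"
    using monomials_bounded[of "UNIV :: 'x set" d] by simp_all
  have "V.independent S"
    using S(1,2) unfolding V.dependent_finite[OF S(1)] by (auto simp: indep_mod_def)
  moreover have "s \<in> V.span ?T" if "s \<in> S" for s
  proof -
    have "s = (\<Sum>u\<in>Poly_Mapping.keys s. mconst (Poly_Mapping.lookup s u) * Poly_Mapping.single u 1)"
      using mpoly_sum_monomials[of s] by (simp add: mconst_def mult_single)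
    also have "\<dots> \<in> V.span ?T"
      by (intro V.span_sum V.span_scale V.span_base) (use S(3) that in \<open>auto simp: exps_le_def\<close>)
    finally show ?thesis .
  qed
  ultimately have "card S \<le> card ?T"
    using V.independent_span_bound[of ?T S] U(1) by blast
  also have "\<dots> \<le> card ?U" by (rule card_image_le[OF U(1)])
  finally show ?thesis using U(2) by simp
qed

text \<open>Start with the monomials in \<open>D\<close> with exponents below \<open>M\<close> and descend along the chain. This yields
  \<open>M ^ (card D + r)\<close> independent polynomials with exponents bounded by a multiple of \<open>M\<close>, and there are
  only \<open>O(M ^ n)\<close> monomials of this kind in \<open>n\<close> variables.\<close>

lemma prime_chain_to_le:
  fixes P :: "('x::finite, 'k::field) mpoly set"
  assumes chain: "prime_chain_to P r" and D: "polys_in D \<inter> P \<subseteq> {0}"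
  shows "card D + r \<le> CARD('x)"
proof (rule ccontr)
  assume "\<not> ?thesis"
  then have less: "Suc (CARD('x)) \<le> card D + r" by simp
  obtain e where e: "\<forall>M d S. finite S \<and> indep_mod P S \<and> (\<forall>s\<in>S. exps_le d s) \<longrightarrow>
    (\<exists>S' :: ('x, 'k) mpoly set. finite S' \<and> indep_mod {0} S' \<and> card S' = card S * M ^ r \<and> (\<forall>s\<in>S'. exps_le (d + e * M) s))"
    using indep_mod_descend_chain[OF chain] ..
  (* any M above (e + 1) ^ n contradicts M ^ (n + 1) \<le> (e + 1) ^ n * M ^ n *)
  define M where "M = Suc ((e + 1) ^ CARD('x))"
  then obtain d where M: "M = Suc d" by simp
  let ?U = "{u :: 'x \<Rightarrow>\<^sub>0 nat. Poly_Mapping.keys u \<subseteq> D \<and> (\<forall>x. Poly_Mapping.lookup u x \<le> d)}"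
  let ?S = "(\<lambda>u. Poly_Mapping.single u (1::'k)) ` ?U"
  have U: "finite ?U" "card ?U = M ^ card D"
    using monomials_bounded[of D d] M by simp_all
  have inj: "inj_on (\<lambda>u. Poly_Mapping.single u (1::'k)) ?U"
    by (rule inj_onI) (metis lookup_single_eq lookup_single_not_eq one_neq_zero)
  have "indep_mod P ?S"
    unfolding indep_mod_def
  proof (intro allI impI ballI)
    fix c s assume mem: "(\<Sum>s\<in>?S. mconst (c s) * s) \<in> P" and "s \<in> ?S"
    then obtain v where v: "v \<in> ?U" "s = Poly_Mapping.single v 1" by auto
    let ?p = "\<Sum>u\<in>?U. Poly_Mapping.single u (c (Poly_Mapping.single u 1))"
    have eq: "(\<Sum>s\<in>?S. mconst (c s) * s) = ?p"
      by (simp add: sum.reindex[OF inj] mconst_def mult_single)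
    have lookup: "Poly_Mapping.lookup ?p w = (if w \<in> ?U then c (Poly_Mapping.single w 1) else 0)" for w
      using U(1) by (simp add: lookup_sum lookup_single when_def sum.delta')
    have "w \<in> ?U" if "w \<in> Poly_Mapping.keys ?p" for w
    proof (rule ccontr)
      assume "w \<notin> ?U"
      then have "Poly_Mapping.lookup ?p w = 0" by (simp only: lookup if_False)
      from that[unfolded in_keys_iff] this show False by contradiction
    qed
    then have "?p \<in> polys_in D" unfolding polys_in_def by blast
    with D mem eq have "?p = 0" by auto
    then show "c s = 0" using lookup[of v] v by (simp only: lookup_zero if_True)
  qed
  moreover have "\<forall>s\<in>?S. exps_le d s" by (auto simp: exps_le_def)
  ultimately obtain S' :: "('x, 'k) mpoly set" where S': "finite S'" "indep_mod {0} S'" "card S' = card ?S * M ^ r"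
    "\<forall>s\<in>S'. exps_le (d + e * M) s"
    using e[THEN spec[of _ M], THEN spec[of _ d], THEN spec[of _ ?S]] U(1) by auto
  have "M ^ Suc (CARD('x)) \<le> M ^ (card D + r)"
    using less M by (intro power_increasing) auto
  also have "\<dots> = card S'"
    using S'(3) U by (simp add: card_image[OF inj] power_add)
  also have "\<dots> \<le> Suc (d + e * M) ^ CARD('x)"
    by (rule card_indep_le[OF S'(1,2,4)])
  also have "\<dots> = (e + 1) ^ CARD('x) * M ^ CARD('x)"
    by (simp add: M flip: power_mult_distrib) (simp add: algebra_simps)
  finally have "M * M ^ CARD('x) \<le> (e + 1) ^ CARD('x) * M ^ CARD('x)" by simp
  then have "M \<le> (e + 1) ^ CARD('x)"
    using M by (subst (asm) mult_le_cancel2) auto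
  then show False by (simp add: M_def)
qed

text \<open>The dimension formula, with the transcendence degree of the residue ring replaced by the size of
  a set \<open>D\<close> of variables that is independent modulo \<open>P\<close> and maximal with this property.\<close>

theorem prime_height_mpoly:
  fixes P :: "('x::finite, 'k::field) mpoly set"
  assumes P: "is_prime P" and D: "polys_in D \<inter> P \<subseteq> {0}"
    and dep: "\<And>v. v \<notin> D \<Longrightarrow> \<exists>g\<in>polys_in (insert v D) \<inter> P. g \<noteq> 0"
  shows "prime_height UR P = enat (CARD('x) - card D)"
proof (rule antisym)
  show "prime_height UR P \<le> enat (CARD('x) - card D)"
    unfolding prime_height_eq
    by (rule SUP_least) (use prime_chain_to_le[OF _ D] in fastforce)
  have "prime_chain_to P (card (- D))"
    by (rule prime_chain_to_card[OF _ P _ D dep]) auto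
  then have "enat (card (- D)) \<le> prime_height UR P"
    unfolding prime_height_eq by (intro SUP_upper) simp
  then show "enat (CARD('x) - card D) \<le> prime_height UR P"
    by (simp add: card_Diff_subset Compl_eq_Diff_UNIV)
qed

lemma maximal_independent_variables:
  fixes P :: "('x::finite, 'k::field) mpoly set"
  assumes "is_prime P"
  obtains D where "polys_in D \<inter> P \<subseteq> {0}" and "\<And>v. v \<notin> D \<Longrightarrow> \<exists>g\<in>polys_in (insert v D) \<inter> P. g \<noteq> 0"
proof -
  have "polys_in {} \<inter> P \<subseteq> {0}"
  proof
    fix p assume p: "p \<in> polys_in {} \<inter> P"
    from p have "p \<in> polys_in {}" by simp
    then obtain c where c: "p = mconst c" by (rule polys_in_empty)
    have "c = 0"
    proof (rule ccontr)
      assume "c \<noteq> 0"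
      then have "mconst (inverse c) * p = 1"
        using morphism_simps(4)[OF ring_morphism_mconst, of "inverse c" c]
        by (simp add: c morphism_simps(1)[OF ring_morphism_mconst])
      then show False
        using p is_ideal_mult_left[OF is_prime_ideal[OF assms], of p "mconst (inverse c)"]
          is_prime_one[OF assms] by simp
    qed
    then show "p \<in> {0}" by (simp add: c morphism_simps[OF ring_morphism_mconst])
  qed
  then have "{D. polys_in D \<inter> P \<subseteq> {0}} \<noteq> {}" by blast
  then obtain D where D: "polys_in D \<inter> P \<subseteq> {0}" "\<And>E. polys_in E \<inter> P \<subseteq> {0} \<Longrightarrow> D \<subseteq> E \<Longrightarrow> D = E"
    using finite_has_maximal[of "{D. polys_in D \<inter> P \<subseteq> {0}}"] by auto
  show thesis
  proof (rule that[OF D(1)])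
    fix v assume "v \<notin> D"
    then have "\<not> polys_in (insert v D) \<inter> P \<subseteq> {0}" using D(2) by blast
    then show "\<exists>g\<in>polys_in (insert v D) \<inter> P. g \<noteq> 0" by blast
  qed
qed


unbundle no fps_syntax

section \<open>Determinants\<close>

text \<open>Cramer's rule over a commutative ring, for a matrix with \<open>w\<close> in its kernel.\<close>

lemma det_mult_kernel:
  fixes A :: "'a::comm_ring_1^'m^'m"
  assumes "\<And>i. (\<Sum>j\<in>UNIV. A $ i $ j * w j) = 0"
  shows "det A * w k = 0"
proof -
  let ?B = "transpose A"
  have "(\<Sum>j\<in>UNIV. w j *s row j ?B) = 0"
    using assms by (simp add: vec_eq_iff row_def transpose_def sum_component mult.commute)
  then have "0 = det (\<chi> i. if i = k then \<Sum>j\<in>UNIV. w j *s row j ?B else row i ?B)"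
    by (simp add: det_row_0 cong: if_cong)
  also have "\<dots> = (\<Sum>j\<in>UNIV. w j * det (\<chi> i. if i = k then row j ?B else row i ?B))"
    by (subst det_linear_row_sum) (simp_all add: det_row_mul)
  also have "\<dots> = (\<Sum>j\<in>UNIV. if j = k then w j * det A else 0)"
  proof (rule sum.cong[OF refl])
    fix j
    show "w j * det (\<chi> i. if i = k then row j ?B else row i ?B) = (if j = k then w j * det A else 0)"
    proof (cases "j = k")
      case True
      then have "(\<chi> i. if i = k then row j ?B else row i ?B) = ?B"
        by (simp add: vec_eq_iff row_def)
      then show ?thesis using True by simp
    next
      case False
      have "det (\<chi> i. if i = k then row j ?B else row i ?B) = 0"
        by (rule det_identical_rows[OF False]) (use False in \<open>simp add: vec_eq_iff row_def\<close>)
      then show ?thesis using False by simp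
    qed
  qed
  finally show ?thesis by (simp add: mult.commute)
qed

lemma det_cong_mod_ideal:
  fixes A B :: "'a::comm_ring_1^'m^'m"
  assumes N: "is_ideal N" and "\<And>i j. A $ i $ j - B $ i $ j \<in> N"
  shows "det A - det B \<in> N"
proof -
  have prod: "prod f T - prod g T \<in> N" if "\<And>x. f x - g x \<in> N" for f g :: "'m \<Rightarrow> 'a" and T
  proof (induction T rule: infinite_finite_induct)
    case (insert x T)
    have "prod f (insert x T) - prod g (insert x T) =
        f x * (prod f T - prod g T) + (f x - g x) * prod g T"
      using insert.hyps by (simp add: algebra_simps)
    then show ?case
      using insert.IH that[of x] by (auto intro: is_ideal_add is_ideal_mult_left is_ideal_mult_right N)
  qed (simp_all add: is_ideal_zero[OF N])
  show ?thesis
    unfolding det_def sum_subtractf[symmetric] right_diff_distrib[symmetric]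
    by (intro is_ideal_sum[OF N] is_ideal_mult_left[OF N] prod assms(2))
qed

text \<open>By multilinearity, the determinant is a combination of those obtained by selecting one of the
  vectors \<open>b g\<close> for each row. The inductive claim has the combinations in the rows \<open>T\<close> only and a
  selection elsewhere.\<close>

lemma det_rows_combination_in_ideal:
  fixes b :: "'b \<Rightarrow> 'a::comm_ring_1^'m"
  assumes N: "is_ideal N" and G: "finite G"
    and sel: "\<And>h :: 'm \<Rightarrow> 'b. range h \<subseteq> G \<Longrightarrow> det (\<chi> i. b (h i)) \<in> N"
  shows "det (\<chi> i. \<Sum>g\<in>G. a i g *s b g) \<in> N"
proof (cases "G = {}")
  case True
  have "det (\<chi> i. \<Sum>g\<in>G. a i g *s b g) = 0"
    using det_mult_kernel[of "\<chi> i. \<Sum>g\<in>G. a i g *s b g" "\<lambda>_. 1"] True by simp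
  then show ?thesis by (simp add: is_ideal_zero[OF N])
next
  case False
  have "det (\<chi> i. if i \<in> T then \<Sum>g\<in>G. a i g *s b g else b (h i)) \<in> N"
    if "range h \<subseteq> G" for T :: "'m set" and h
    using finite[of T] that
  proof (induction T arbitrary: h rule: finite_induct)
    case empty
    then show ?case using sel by simp
  next
    case (insert k T)
    let ?c = "\<lambda>i. if i \<in> T then \<Sum>g\<in>G. a i g *s b g else b (h i)"
    have "det (\<chi> i. if i \<in> insert k T then \<Sum>g\<in>G. a i g *s b g else b (h i)) =
        det (\<chi> i. if i = k then \<Sum>g\<in>G. a k g *s b g else ?c i)"
      by (rule arg_cong[of _ _ det]) (auto simp: vec_eq_iff)
    also have "\<dots> = (\<Sum>g\<in>G. a k g * det (\<chi> i. if i = k then b g else ?c i))"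
      by (subst det_linear_row_sum[OF G]) (simp add: det_row_mul)
    also have "\<dots> \<in> N"
    proof (intro is_ideal_sum[OF N] is_ideal_mult_left[OF N])
      fix g assume "g \<in> G"
      then have "det (\<chi> i. if i \<in> T then \<Sum>g\<in>G. a i g *s b g else b ((h(k := g)) i)) \<in> N"
        using insert.prems by (intro insert.IH) auto
      also have "(\<chi> i. if i \<in> T then \<Sum>g\<in>G. a i g *s b g else b ((h(k := g)) i)) =
          (\<chi> i. if i = k then b g else ?c i)"
        using insert.hyps by (auto simp: vec_eq_iff)
      finally show "det (\<chi> i. if i = k then b g else ?c i) \<in> N" .
    qed
    finally show ?case .
  qed
  from this[of "\<lambda>_. SOME g. g \<in> G" UNIV] show ?thesis
    using False by (simp add: some_in_eq image_subset_iff)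
qed


section \<open>Even and odd parts of univariate polynomials\<close>

text \<open>On \<open>S[z]\<close>, viewed in \<open>T\<close>, the map to the Rees-like algebra is the substitution of \<open>t\<close> squared, which has only
  even coefficients; the linear part in \<open>y\<close> contributes odd ones. Separating parities separates the
  parts of a relation.\<close>

abbreviation square_subst :: "'a::comm_ring_1 poly \<Rightarrow> 'a poly" where
  "square_subst p \<equiv> pcompose p [:0, 0, 1:]"

lemma coeff_square_subst:
  "Polynomial.coeff (square_subst p) n = (if even n then Polynomial.coeff p (n div 2) else 0)"
proof (induction p arbitrary: n)
  case (pCons a p)
  have shift: "[:0, 0, 1:] * q = pCons 0 (pCons 0 q)" for q :: "'a poly" by simp
  show ?case
  proof (cases n)
    case (Suc m)
    show ?thesis
      by (cases m) (simp_all add: Suc pcompose_pCons shift pCons.IH coeff_pCons)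
  qed (simp add: pcompose_pCons coeff_pCons)
qed simp

lemma even_odd_decomposition:
  "\<exists>a b. p = square_subst a + [:0, 1:] * square_subst b" for p :: "'a::comm_ring_1 poly"
proof (induction p)
  case 0
  show ?case by (intro exI[of _ 0]) simp
next
  case (pCons c p)
  then obtain a b where "p = square_subst a + [:0, 1:] * square_subst b" by blast
  then have "pCons c p = square_subst (pCons c b) + [:0, 1:] * square_subst a"
    by (simp add: pcompose_pCons)
  then show ?case by blast
qed

lemma even_odd_eq_0:
  assumes "square_subst a + [:0, 1:] * square_subst b = 0"
  shows "a = 0" and "b = 0"
proof -
  have eq: "Polynomial.coeff (square_subst a) n + Polynomial.coeff (pCons 0 (square_subst b)) n = 0" for n
    using arg_cong[OF assms, of "\<lambda>p. Polynomial.coeff p n"] by simp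
  show "a = 0"
  proof (rule poly_eqI)
    fix n
    show "Polynomial.coeff a n = Polynomial.coeff 0 n"
      using eq[of "2 * n"] by (cases n) (simp_all add: coeff_square_subst poly_0_coeff_0)
  qed
  show "b = 0"
  proof (rule poly_eqI)
    fix n
    show "Polynomial.coeff b n = Polynomial.coeff 0 n"
      using eq[of "Suc (2 * n)"] by (simp add: coeff_square_subst)
  qed
qed

lemma poly_morphism_agree:
  assumes F: "ring_morphism F" and G: "ring_morphism G"
    and const: "\<And>a. F [:a:] = G [:a:]" and var: "F [:0, 1:] = G [:0, 1:]"
  shows "F p = G p"
proof (induction p)
  case (pCons a p)
  have "pCons a p = [:a:] + [:0, 1:] * p" by simp
  then show ?case
    using pCons.IH const var by (simp only: morphism_simps[OF F] morphism_simps[OF G])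
qed (simp add: morphism_simps[OF F] morphism_simps[OF G])


section \<open>The presentation of the Rees-like algebra\<close>

text \<open>The maps \<open>embX\<close> and \<open>liftZ\<close> include \<open>S\<close> and \<open>S[z]\<close> in \<open>T\<close>, the latter written as \<open>S[t]\<close>, and \<open>killY\<close>
  reduces modulo \<open>y\<close>. Here \<open>z\<close> goes to \<open>t\<close> and not to its square, so that \<open>liftZ\<close> is a section of
  \<open>killY\<close>.\<close>

definition embX :: "('n, 'k::field) mpoly \<Rightarrow> ('n, 'm, 'k) rl_mpoly" where
  "embX = mpoly_eval mconst (\<lambda>i. mvar (VarX i))"

definition killY :: "('n, 'm, 'k::field) rl_mpoly \<Rightarrow> ('n, 'k) mpoly poly" where
  "killY = mpoly_eval (\<lambda>c. [:mconst c:])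
     (\<lambda>v. case v of VarX i \<Rightarrow> [:mvar i:] | VarY j \<Rightarrow> 0 | VarZ \<Rightarrow> [:0, 1:])"

definition liftZ :: "('n, 'k::field) mpoly poly \<Rightarrow> ('n, 'm, 'k) rl_mpoly" where
  "liftZ p = poly (map_poly embX p) (mvar VarZ)"

lemma ring_morphism_embX: "ring_morphism embX"
  unfolding embX_def by (rule ring_morphism_mpoly_eval[OF ring_morphism_mconst])

lemma ring_morphism_killY: "ring_morphism killY"
  unfolding killY_def by (rule ring_morphism_mpoly_eval[OF ring_morphism_poly_const])

lemma ring_morphism_liftZ: "ring_morphism liftZ"
  unfolding liftZ_def
  by (rule ring_morphism_comp[OF ring_morphism_poly ring_morphism_map_poly[OF ring_morphism_embX]])

lemma ring_morphism_rees_like_map: "ring_morphism (rees_like_map f)"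
  unfolding rees_like_map_def by (rule ring_morphism_mpoly_eval[OF ring_morphism_poly_const])

lemma embX_mconst [simp]: "embX (mconst c) = mconst c"
  and embX_mvar [simp]: "embX (mvar i) = mvar (VarX i)"
  by (simp_all add: embX_def mpoly_eval_mconst mpoly_eval_mvar ring_morphism_mconst)

lemma killY_gens [simp]:
  "killY (mconst c) = [:mconst c:]" "killY (mvar (VarX i)) = [:mvar i:]"
  "killY (mvar (VarY j)) = 0" "killY (mvar VarZ) = [:0, 1:]"
  by (simp_all add: killY_def mpoly_eval_mconst mpoly_eval_mvar ring_morphism_poly_const)

lemma rees_like_map_gens [simp]:
  "rees_like_map f (mconst c) = [:mconst c:]" "rees_like_map f (mvar (VarX i)) = [:mvar i:]"
  "rees_like_map f (mvar (VarY j)) = [:0, f j:]" "rees_like_map f (mvar VarZ) = [:0, 0, 1:]"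
  by (simp_all add: rees_like_map_def mpoly_eval_mconst mpoly_eval_mvar ring_morphism_poly_const)

lemma liftZ_const [simp]: "liftZ [:a:] = embX a"
  by (simp add: liftZ_def map_poly_pCons ring_morphism.zero[OF ring_morphism_embX])

lemma liftZ_var [simp]: "liftZ [:0, 1:] = mvar VarZ"
  by (simp add: liftZ_def map_poly_pCons morphism_simps[OF ring_morphism_embX])

lemma killY_embX [simp]: "killY (embX s) = [:s:]"
  by (rule morphism_agree[OF ring_morphism_comp[OF ring_morphism_killY ring_morphism_embX]
        ring_morphism_pCons _ _ polys_in_UNIV]) simp_all

lemma killY_liftZ [simp]: "killY (liftZ p) = p"
  by (rule poly_morphism_agree[OF ring_morphism_comp[OF ring_morphism_killY ring_morphism_liftZ]
        ring_morphism_id]) simp_all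

lemma rees_like_map_embX [simp]: "rees_like_map f (embX s) = [:s:]"
  by (rule morphism_agree[OF ring_morphism_comp[OF ring_morphism_rees_like_map ring_morphism_embX]
        ring_morphism_pCons _ _ polys_in_UNIV]) simp_all

lemma rees_like_map_liftZ [simp]: "rees_like_map f (liftZ p) = square_subst p"
  by (rule poly_morphism_agree[OF ring_morphism_comp[OF ring_morphism_rees_like_map ring_morphism_liftZ]
        ring_morphism_pcompose]) (simp_all add: pcompose_pCons)

lemma embX_polys_in: "s \<in> polys_in D \<Longrightarrow> embX s \<in> polys_in (VarX ` D)"
  unfolding embX_def
  by (rule mpoly_eval_closed[OF _ ring_morphism_mconst])
    (auto intro: mconst_polys_in mvar_polys_in polys_in_add polys_in_mult)

lemma mpoly_pderiv_embX:
  "mpoly_pderiv (VarY j) (embX s) = 0" "mpoly_pderiv VarZ (embX s) = 0"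
  by (rule mpoly_pderiv_polys_in[OF embX_polys_in[OF polys_in_UNIV]]; auto)+

text \<open>The Taylor expansion in \<open>y\<close> up to second order. Only the first two terms are normalised; the
  coefficients \<open>r i j\<close> of the remainder may involve \<open>y\<close> again.\<close>

lemma rl_mpoly_decomposition:
  fixes q :: "('n, 'm::finite, 'k::field) rl_mpoly"
  shows "\<exists>p0 p r. q = liftZ p0 + (\<Sum>j\<in>UNIV. mvar (VarY j) * liftZ (p j)) +
    (\<Sum>i\<in>UNIV. \<Sum>j\<in>UNIV. mvar (VarY i) * mvar (VarY j) * r i j)"
    (is "\<exists>p0 p r. q = ?form p0 p r")
proof (induction q rule: mpoly_var_mult_induct)
  case (const c)
  have "mconst c = ?form [:mconst c:] (\<lambda>_. 0) (\<lambda>_ _. 0)"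
    by (simp add: ring_morphism.zero[OF ring_morphism_liftZ])
  then show ?case by - (rule exI, rule exI, rule exI)
next
  case (add q q')
  then obtain p0 p r p0' p' r' where "q = ?form p0 p r" "q' = ?form p0' p' r'" by blast
  then have "q + q' = ?form (p0 + p0') (\<lambda>j. p j + p' j) (\<lambda>i j. r i j + r' i j)"
    by (simp add: morphism_simps[OF ring_morphism_liftZ] distrib_left sum.distrib algebra_simps)
  then show ?case by - (rule exI, rule exI, rule exI)
next
  case (var_mult x q)
  then obtain p0 p r where q: "q = ?form p0 p r" by blast
  have lift: ?case if "mvar x = liftZ a" for a :: "('n, 'k) mpoly poly"
  proof -
    have "mvar x * q = ?form (a * p0) (\<lambda>j. a * p j) (\<lambda>i j. mvar x * r i j)"
      unfolding q by (simp add: that morphism_simps[OF ring_morphism_liftZ] distrib_left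
          sum_distrib_left mult_ac)
    then show ?thesis by - (rule exI, rule exI, rule exI)
  qed
  show ?case
  proof (cases x)
    case (VarX i)
    then show ?thesis using lift[of "[:mvar i:]"] by simp
  next
    case VarZ
    then show ?thesis using lift[of "[:0, 1:]"] by simp
  next
    case (VarY l)
    let ?w = "\<lambda>j. liftZ (p j) + (\<Sum>k\<in>UNIV. mvar (VarY k) * r j k)"
    have q': "q = liftZ p0 + (\<Sum>j\<in>UNIV. mvar (VarY j) * ?w j)"
      unfolding q by (simp add: sum.distrib distrib_left sum_distrib_left mult_ac)
    have linear: "(\<Sum>j\<in>UNIV. mvar (VarY j) * liftZ (if j = l then p0 else 0)) = mvar (VarY l) * liftZ p0"
      by (subst sum.remove[of _ l]) (simp_all add: ring_morphism.zero[OF ring_morphism_liftZ])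
    have quad: "(\<Sum>i\<in>UNIV. \<Sum>j\<in>UNIV. mvar (VarY i) * mvar (VarY j) * (if i = l then ?w j else 0)) =
        (\<Sum>j\<in>UNIV. mvar (VarY l) * mvar (VarY j) * ?w j)"
      by (subst sum.remove[of _ l]) simp_all
    have "mvar x * q = ?form 0 (\<lambda>j. if j = l then p0 else 0) (\<lambda>i j. if i = l then ?w j else 0)"
      unfolding linear quad VarY q'
      by (simp add: ring_morphism.zero[OF ring_morphism_liftZ] distrib_left sum_distrib_left mult.assoc)
    then show ?thesis
      by (intro exI[of _ 0] exI[of _ "\<lambda>j. if j = l then p0 else 0"]
          exI[of _ "\<lambda>i j. if i = l then ?w j else 0"])
  qed
qed

text \<open>Apply the map to \<open>S[t]\<close> to the expansion of \<open>q\<close> and compare parities. The even part shows that the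
  constant term \<open>p0\<close> is a combination of the products \<open>f i * f j\<close>. The odd part shows that the linear
  coefficients \<open>p\<close> become a syzygy \<open>s\<close> of \<open>f\<close> after a correction by multiples of the \<open>f j\<close>.\<close>

lemma RLP_decomposition:
  fixes f :: "'m::finite \<Rightarrow> ('n, 'k::field) mpoly"
  assumes q: "q \<in> RLP f" and I: "is_ideal I" and f: "range f \<subseteq> I"
  shows "\<exists>e p r s.
    q = (\<Sum>i\<in>UNIV. \<Sum>j\<in>UNIV. embX (f i) * (embX (f j) * liftZ (e i j))) +
      (\<Sum>j\<in>UNIV. mvar (VarY j) * liftZ (p j)) +
      (\<Sum>i\<in>UNIV. \<Sum>j\<in>UNIV. mvar (VarY i) * (mvar (VarY j) * r i j)) \<and>
    (\<Sum>j\<in>UNIV. s j * [:f j:]) = 0 \<and> (\<forall>j. p j - s j \<in> coeffs_in I)"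
proof -
  obtain p0 p r where q_eq: "q = liftZ p0 + (\<Sum>j\<in>UNIV. mvar (VarY j) * liftZ (p j)) +
      (\<Sum>i\<in>UNIV. \<Sum>j\<in>UNIV. mvar (VarY i) * mvar (VarY j) * r i j)"
    using rl_mpoly_decomposition[of q] by auto
  have "\<forall>i j. \<exists>a b. rees_like_map f (r i j) = square_subst a + [:0, 1:] * square_subst b"
    using even_odd_decomposition by blast
  then obtain a b where ab: "\<And>i j. rees_like_map f (r i j) = square_subst (a i j) + [:0, 1:] * square_subst (b i j)"
    by metis
  let ?t = "[:0, 1:] :: ('n, 'k) mpoly poly"
  let ?e = "\<lambda>i j. - (?t * a i j)"
  let ?s = "\<lambda>i. p i + (\<Sum>j\<in>UNIV. [:f j:] * (?t * b i j))"
  let ?even = "p0 - (\<Sum>i\<in>UNIV. \<Sum>j\<in>UNIV. [:f i:] * ([:f j:] * ?e i j))"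
  let ?odd = "\<Sum>i\<in>UNIV. ?s i * [:f i:]"
  have t2: "square_subst ?t = ?t * ?t" by (simp add: pcompose_pCons)
  have fc: "square_subst [:f i:] = [:f i:]" "[:0, f i:] = ?t * [:f i:]" for i by simp_all
  note comp = morphism_simps[OF ring_morphism_pcompose]
  have "square_subst ?even + ?t * square_subst ?odd = rees_like_map f q"
    unfolding q_eq morphism_simps[OF ring_morphism_rees_like_map] rees_like_map_liftZ
      rees_like_map_gens ab
    unfolding fc(2) comp fc(1) t2
    by (simp only: sum.distrib distrib_left distrib_right sum_distrib_left sum_distrib_right
        mult_minus_right minus_mult_right[symmetric] sum_negf diff_minus_eq_add mult_ac add_ac)
  also have "\<dots> = 0" using q by (simp add: RLP_def)
  finally have "?even = 0" and odd: "?odd = 0"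
    by (rule even_odd_eq_0)+
  then have p0: "p0 = (\<Sum>i\<in>UNIV. \<Sum>j\<in>UNIV. [:f i:] * ([:f j:] * ?e i j))" by simp
  have lift: "liftZ p0 = (\<Sum>i\<in>UNIV. \<Sum>j\<in>UNIV. embX (f i) * (embX (f j) * liftZ (?e i j)))"
    unfolding p0 morphism_simps[OF ring_morphism_liftZ] liftZ_const ..
  have "p j - ?s j \<in> coeffs_in I" for j
  proof -
    have "[:f i:] \<in> coeffs_in I" for i
      using f const_in_coeffs_in[OF I] by blast
    then have "(\<Sum>i\<in>UNIV. [:f i:] * (?t * b j i)) \<in> coeffs_in I"
      by (intro is_ideal_sum is_ideal_mult_right is_ideal_coeffs_in[OF I])
    then show ?thesis
      using is_ideal_uminus[OF is_ideal_coeffs_in[OF I]] by simp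
  qed
  then show ?thesis
    using q_eq lift odd
    by (intro exI[of _ ?e] exI[of _ p] exI[of _ r] exI[of _ ?s]) (simp add: mult.assoc)
qed

text \<open>Modulo \<open>(I, y)\<close> all derivatives of the products \<open>f i * f j\<close> and of the quadratic remainder vanish,
  which leaves the linear coefficients \<open>p\<close> from \<open>RLP_decomposition\<close>.\<close>

lemma jacobian_row:
  fixes f :: "'m::finite \<Rightarrow> ('n, 'k::field) mpoly"
  assumes q: "q \<in> RLP f" and I: "is_ideal I" and f: "range f \<subseteq> I"
  shows "\<exists>s. (\<Sum>j\<in>UNIV. s j * [:f j:]) = 0 \<and>
    (\<forall>v. killY (mpoly_pderiv v q) - (case v of VarY j \<Rightarrow> s j | _ \<Rightarrow> 0) \<in> coeffs_in I)"
proof -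
  obtain e p r s where q_eq:
    "q = (\<Sum>i\<in>UNIV. \<Sum>j\<in>UNIV. embX (f i) * (embX (f j) * liftZ (e i j))) +
      (\<Sum>j\<in>UNIV. mvar (VarY j) * liftZ (p j)) +
      (\<Sum>i\<in>UNIV. \<Sum>j\<in>UNIV. mvar (VarY i) * (mvar (VarY j) * r i j))"
    and s: "(\<Sum>j\<in>UNIV. s j * [:f j:]) = 0" and ps: "\<And>j. p j - s j \<in> coeffs_in I"
    using RLP_decomposition[OF assms] by blast
  note N = is_ideal_coeffs_in[OF I]
  note killY = morphism_simps[OF ring_morphism_killY]
  have fI: "[:f i:] \<in> coeffs_in I" for i
    using f const_in_coeffs_in[OF I] by blast
  have "killY (mpoly_pderiv v q) - (case v of VarY j \<Rightarrow> s j | _ \<Rightarrow> 0) \<in> coeffs_in I" for v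
  proof -
    let ?A = "\<Sum>i\<in>UNIV. \<Sum>j\<in>UNIV. embX (f i) * (embX (f j) * liftZ (e i j))"
    have "killY (mpoly_pderiv v (embX (f i) * (embX (f j) * liftZ (e i j)))) \<in> coeffs_in I" for i j
      unfolding mpoly_pderiv_mult killY killY_embX
      by (intro is_ideal_add[OF N] is_ideal_mult_right[OF N, OF fI] is_ideal_mult_left[OF N])
    then have "killY (mpoly_pderiv v ?A) \<in> coeffs_in I"
      unfolding mpoly_pderiv_sum killY by (intro is_ideal_sum[OF N])
    moreover have "killY (mpoly_pderiv v (\<Sum>j\<in>UNIV. mvar (VarY j) * liftZ (p j))) =
        (case v of VarY j \<Rightarrow> p j | _ \<Rightarrow> 0)"
    proof (cases v)
      case (VarY l)
      have "(\<Sum>j\<in>UNIV. killY (mpoly_pderiv v (mvar (VarY j))) * p j) = (\<Sum>j\<in>UNIV. if l = j then p j else 0)"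
        by (rule sum.cong) (auto simp: VarY mpoly_pderiv_mvar killY)
      then show ?thesis
        by (simp add: VarY mpoly_pderiv_sum mpoly_pderiv_mult killY)
    qed (simp_all add: mpoly_pderiv_sum mpoly_pderiv_mult mpoly_pderiv_mvar killY)
    moreover have "killY (mpoly_pderiv v
        (\<Sum>i\<in>UNIV. \<Sum>j\<in>UNIV. mvar (VarY i) * (mvar (VarY j) * r i j))) = 0"
      by (simp add: mpoly_pderiv_sum mpoly_pderiv_mult killY)
    moreover have "(case v of VarY j \<Rightarrow> p j | _ \<Rightarrow> 0) - (case v of VarY j \<Rightarrow> s j | _ \<Rightarrow> 0) \<in> coeffs_in I"
      using ps is_ideal_zero[OF N] by (cases v) auto
    ultimately show ?thesis
      unfolding q_eq mpoly_pderiv_add killY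
      using is_ideal_add[OF N] by (simp add: add_diff_eq[symmetric])
  qed
  with s show ?thesis by blast
qed


section \<open>The Jacobian ideal\<close>

text \<open>Monomials in an arbitrary finite set of variables carry no order, so the absence of zero divisors is
  not obtained from leading terms: instead, starting with the prime of all polynomials that vanish at
  the origin, the variables are freed one after the other.\<close>

lemma is_prime_zero_mpoly: "is_prime {0 :: ('x::finite, 'k::field) mpoly}"
proof -
  have "\<exists>P :: ('x, 'k) mpoly set. is_prime P \<and> polys_in A \<inter> P \<subseteq> {0}" if "finite A" for A
    using that
  proof (induction A rule: finite_induct)
    case empty
    (* evaluation at the origin *)
    let ?ev = "mpoly_eval (\<lambda>c. c) (\<lambda>_. 0) :: ('x, 'k) mpoly \<Rightarrow> 'k"
    have ev: "ring_morphism ?ev" by (rule ring_morphism_mpoly_eval[OF ring_morphism_id])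
    have "is_prime {0 :: 'k}" by (auto simp: is_prime_def is_ideal_def)
    then have "is_prime (?ev -` {0})" by (rule ring_morphism.is_prime_vimage[OF ev])
    moreover have "p = 0" if p: "p \<in> polys_in {}" and "?ev p = 0" for p
    proof -
      from p obtain c where "p = mconst c" by (rule polys_in_empty)
      with \<open>?ev p = 0\<close> show ?thesis
        by (simp add: mpoly_eval_mconst ring_morphism_id morphism_simps[OF ring_morphism_mconst])
    qed
    ultimately show ?case by (intro exI[of _ "?ev -` {0}"]) auto
  next
    case (insert v A)
    then obtain P :: "('x, 'k) mpoly set" where P: "is_prime P" "polys_in A \<inter> P \<subseteq> {0}" by blast
    have "g = 0" if g: "g \<in> polys_in (insert v A)" "g \<in> expand_ideal v P" for g
    proof -
      have "Polynomial.coeff (expand v g) i = 0" for i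
        using g(2) coeff_expand_polys_in[OF g(1)] P(2) by (auto simp: expand_ideal_def coeffs_in_def)
      then have "expand v g = 0" by (simp add: poly_eq_iff)
      then show ?thesis using poly_expand[of v g] by simp
    qed
    then show ?case
      using is_prime_expand_ideal[OF P(1), of v] by (intro exI[of _ "expand_ideal v P"]) auto
  qed
  from this[of UNIV] obtain P :: "('x, 'k) mpoly set" where "is_prime P" "P \<subseteq> {0}"
    by (auto simp: polys_in_def)
  moreover from this have "0 \<in> P" using is_prime_ideal is_ideal_zero by blast
  ultimately have "P = {0}" by blast
  with \<open>is_prime P\<close> show ?thesis by simp
qed

lemma is_prime_zero_mpoly_poly: "is_prime {0 :: ('x::finite, 'k::field) mpoly poly}"
proof -
  have "coeffs_in {0} = {0 :: ('x, 'k) mpoly poly}"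
    by (auto simp: coeffs_in_def poly_eq_iff)
  then show ?thesis using is_prime_coeffs_in[OF is_prime_zero_mpoly] by metis
qed

text \<open>The preimage of \<open>coeffs_in I\<close> under \<open>killY\<close> is the ideal \<open>(I, y)\<close>. A column for a variable other than
  the \<open>y j\<close> vanishes modulo this ideal. Otherwise the columns are a permutation of all \<open>y j\<close>, and the
  rows are syzygies of \<open>f\<close>.\<close>

lemma jacobian_minors_subset_IY:
  fixes f :: "'m::finite \<Rightarrow> ('n::finite, 'k::field) mpoly"
  assumes I: "is_ideal I" and f: "range f \<subseteq> I" and nz: "\<And>j. f j \<noteq> 0" and G: "G \<subseteq> RLP f"
  shows "jacobian_minors G \<subseteq> killY -` coeffs_in I"
proof
  fix d assume "d \<in> jacobian_minors G"
  then obtain g :: "'m \<Rightarrow> ('n, 'm, 'k) rl_mpoly" and c :: "'m \<Rightarrow> ('n, 'm) rl_var"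
    where d: "d = det (\<chi> i j. mpoly_pderiv (c j) (g i))" and g: "range g \<subseteq> G" and c: "inj c"
    by (auto simp: jacobian_minors_def)
  have "\<forall>i. \<exists>s. (\<Sum>j\<in>UNIV. s j * [:f j:]) = 0 \<and>
      (\<forall>v. killY (mpoly_pderiv v (g i)) - (case v of VarY j \<Rightarrow> s j | _ \<Rightarrow> 0) \<in> coeffs_in I)"
    using g G by (intro allI jacobian_row[OF _ I f]) auto
  then obtain s where s': "\<forall>i. (\<Sum>j\<in>UNIV. s i j * [:f j:]) = 0 \<and>
      (\<forall>v. killY (mpoly_pderiv v (g i)) - (case v of VarY j \<Rightarrow> s i j | _ \<Rightarrow> 0) \<in> coeffs_in I)"
    unfolding choice_iff ..
  have s0: "(\<Sum>j\<in>UNIV. s i j * [:f j:]) = 0" for i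
    using s'[rule_format, of i] by (rule conjunct1)
  have s: "killY (mpoly_pderiv v (g i)) - (case v of VarY j \<Rightarrow> s i j | _ \<Rightarrow> 0) \<in> coeffs_in I" for i v
    using s'[rule_format, of i] by (rule conjE) (rule spec)
  let ?A = "\<chi> i j. case c j of VarY l \<Rightarrow> s i l | _ \<Rightarrow> 0"
  have "det (\<chi> i j. killY (mpoly_pderiv (c j) (g i))) - det ?A \<in> coeffs_in I"
    by (rule det_cong_mod_ideal[OF is_ideal_coeffs_in[OF I]]) (simp add: s)
  moreover have "det ?A = 0"
  proof (cases "\<exists>k. c k \<notin> range VarY")
    case True
    then obtain k where k: "c k \<notin> range VarY" ..
    then have "(case c k of VarY l \<Rightarrow> s i l | _ \<Rightarrow> 0) = 0" for i
      by (cases "c k") auto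
    then have "(\<Sum>j\<in>UNIV. ?A $ i $ j * (if j = k then 1 else 0)) = 0" for i
      by (subst sum.remove[of _ k]) auto
    from det_mult_kernel[OF this, of k] show ?thesis by simp
  next
    case False
    then have "\<forall>k. \<exists>l. c k = VarY l" by blast
    then obtain \<sigma> where \<sigma>: "\<And>k. c k = VarY (\<sigma> k)" by metis
    with c have "inj \<sigma>" by (auto simp: inj_def)
    then have "bij \<sigma>" by (simp add: finite_UNIV_inj_surj bij_def)
    then have "(\<Sum>j\<in>UNIV. ?A $ i $ j * [:f (\<sigma> j):]) = 0" for i
      using s0[of i] sum.reindex_bij_betw[of \<sigma> UNIV UNIV "\<lambda>j. s i j * [:f j:]"]
      by (simp add: \<sigma>)
    from det_mult_kernel[OF this] have "det ?A * [:f (\<sigma> k):] \<in> {0}" for k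
      by (simp only: singleton_iff)
    then have "det ?A \<in> {0} \<or> [:f (\<sigma> k):] \<in> {0}" for k
      by (simp only: is_prime_mult[OF is_prime_zero_mpoly_poly])
    moreover have "[:f (\<sigma> k):] \<notin> {0}" for k using nz by simp
    ultimately show ?thesis by blast
  qed
  ultimately show "d \<in> killY -` coeffs_in I"
    by (simp add: d ring_morphism.det[OF ring_morphism_killY])
qed

lemma RLP_relation: "embX (f i) * mvar (VarY j) - embX (f j) * mvar (VarY i) \<in> RLP f"
  by (simp add: RLP_def morphism_simps[OF ring_morphism_rees_like_map])

lemma RLP_square: "mvar (VarY i) * mvar (VarY i) - mvar VarZ * (embX (f i) * embX (f i)) \<in> RLP f"
  by (simp add: RLP_def morphism_simps[OF ring_morphism_rees_like_map])

lemma is_ideal_RLP: "is_ideal (RLP f)"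
proof -
  have "is_ideal (rees_like_map f -` {0})"
    by (rule ring_morphism.is_ideal_vimage[OF ring_morphism_rees_like_map]) (simp add: is_ideal_def)
  then show ?thesis by (simp add: RLP_def vimage_def)
qed

text \<open>The relations \<open>\<rho>\<close> and the variables \<open>c\<close> are chosen such that the Jacobian matrix is diagonal with
  entries \<open>f i\<close>, except for one entry minus the square of \<open>f i\<close>. Since \<open>Q\<close> contains \<open>RLP\<close>,
  differentiating \<open>\<rho> l = (\<Sum>g\<in>G. a l g * g)\<close> shows that, modulo \<open>Q\<close>, its rows are combinations of the rows of derivatives of the elements of \<open>G\<close>; this is why
  minors of an arbitrary generating set suffice.\<close>

lemma generators_in_prime:
  fixes f :: "'m::finite \<Rightarrow> ('n, 'k::field) mpoly"
  assumes Q: "is_prime Q" and R: "RLP f \<subseteq> Q" and minors: "jacobian_minors G \<subseteq> Q"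
    and G: "finite G" "Idl\<^bsub>UR\<^esub> G = RLP f"
  shows "embX (f i) \<in> Q"
proof -
  have N: "is_ideal Q" by (rule is_prime_ideal[OF Q])
  have GQ: "G \<subseteq> Q" using R G(2) genideal_UR_superset by blast
  define \<rho> :: "'m \<Rightarrow> ('n, 'm, 'k) rl_mpoly" where
    "\<rho> l = (if l = i then mvar (VarY i) * mvar (VarY i) - mvar VarZ * (embX (f i) * embX (f i))
            else embX (f i) * mvar (VarY l) - embX (f l) * mvar (VarY i))" for l
  define c :: "'m \<Rightarrow> ('n, 'm) rl_var" where "c j = (if j = i then VarZ else VarY j)" for j
  have c: "inj c" by (auto simp: inj_def c_def)
  have "\<rho> l \<in> RLP f" for l
    by (simp add: \<rho>_def RLP_relation RLP_square)
  then have "\<forall>l. \<exists>a. \<rho> l = (\<Sum>g\<in>G. a g * g)"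
    by (intro allI genideal_UR_finite[OF G(1)]) (simp only: G(2))
  then obtain a where "\<forall>l. \<rho> l = (\<Sum>g\<in>G. a l g * g)"
    unfolding choice_iff ..
  then have a: "\<rho> l = (\<Sum>g\<in>G. a l g * g)" for l by (rule spec)
  let ?D = "\<chi> l j. mpoly_pderiv (c j) (\<rho> l)"
  let ?b = "\<lambda>g. \<chi> j. mpoly_pderiv (c j) g"
  have "det (\<chi> l. ?b (h l)) \<in> Q" if h: "range h \<subseteq> G" for h :: "'m \<Rightarrow> ('n, 'm, 'k) rl_mpoly"
  proof (cases "inj h")
    case True
    then show ?thesis
      using h c minors unfolding jacobian_minors_def by blast
  next
    case False
    then obtain k l where "k \<noteq> l" "h k = h l" by (auto simp: inj_def)
    then have "det (\<chi> l. ?b (h l)) = 0"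
      by (intro det_identical_rows[of k l]) (simp_all add: row_def)
    then show ?thesis by (simp add: is_ideal_zero[OF N])
  qed
  then have "det (\<chi> l. \<Sum>g\<in>G. a l g *s ?b g) \<in> Q"
    by (rule det_rows_combination_in_ideal[OF N G(1)])
  moreover have "det ?D - det (\<chi> l. \<Sum>g\<in>G. a l g *s ?b g) \<in> Q"
  proof (rule det_cong_mod_ideal[OF N])
    fix l j
    have "?D $ l $ j - (\<chi> l. \<Sum>g\<in>G. a l g *s ?b g) $ l $ j = (\<Sum>g\<in>G. mpoly_pderiv (c j) (a l g) * g)"
      by (simp add: a mpoly_pderiv_sum mpoly_pderiv_mult sum.distrib)
    also have "\<dots> \<in> Q"
      using GQ by (intro is_ideal_sum[OF N] is_ideal_mult_left[OF N]) auto
    finally show "?D $ l $ j - (\<chi> l. \<Sum>g\<in>G. a l g *s ?b g) $ l $ j \<in> Q" .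
  qed
  ultimately have "det ?D \<in> Q" using is_ideal_diff_mem[OF N] by blast
  have diag: "det ?D = (\<Prod>l\<in>UNIV. ?D $ l $ l)"
    by (rule det_diagonal)
      (auto simp: \<rho>_def c_def mpoly_pderiv_diff mpoly_pderiv_mult mpoly_pderiv_mvar mpoly_pderiv_embX)
  have "(\<Prod>l\<in>UNIV. ?D $ l $ l) \<in> Q"
    using \<open>det ?D \<in> Q\<close> unfolding diag .
  then obtain l where "?D $ l $ l \<in> Q"
    by (rule is_prime_prod[OF Q, THEN bexE])
  moreover have "?D $ l $ l = (if l = i then - (embX (f i) * embX (f i)) else embX (f i))"
    by (auto simp: \<rho>_def c_def mpoly_pderiv_diff mpoly_pderiv_mult mpoly_pderiv_mvar mpoly_pderiv_embX)
  ultimately show ?thesis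
    using is_prime_mult[OF Q, of "embX (f i)" "embX (f i)"] is_ideal_uminus[OF N, of "- (embX (f i) * embX (f i))"]
    by (auto split: if_splits)
qed

lemma nat_pow_UR: "a [^]\<^bsub>UR\<^esub> (e::nat) = a ^ e"
  by (induction e) (simp_all add: nat_pow_def mult.commute)

lemma IY_subset_prime:
  fixes f :: "'m::finite \<Rightarrow> ('n, 'k::field) mpoly"
  assumes Q: "is_prime Q" and R: "RLP f \<subseteq> Q" and I: "embX ` I \<subseteq> Q" and f: "range f \<subseteq> I"
  shows "killY -` coeffs_in I \<subseteq> Q"
proof
  fix q :: "('n, 'm, 'k) rl_mpoly" assume q: "q \<in> killY -` coeffs_in I"
  have N: "is_ideal Q" by (rule is_prime_ideal[OF Q])
  obtain p0 p r where q_eq: "q = liftZ p0 + (\<Sum>j\<in>UNIV. mvar (VarY j) * liftZ (p j)) +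
      (\<Sum>i\<in>UNIV. \<Sum>j\<in>UNIV. mvar (VarY i) * mvar (VarY j) * r i j)"
    using rl_mpoly_decomposition[of q] by auto
  have "p0 \<in> coeffs_in I"
    using q by (simp add: q_eq morphism_simps[OF ring_morphism_killY])
  then have "map_poly embX p0 \<in> coeffs_in Q"
    using I by (auto simp: coeffs_in_def coeff_map_poly ring_morphism.zero[OF ring_morphism_embX])
  then have lift: "liftZ p0 \<in> Q"
    unfolding liftZ_def by (rule poly_mem_ideal[OF N])
  have Y: "mvar (VarY j) \<in> Q" for j
  proof -
    have "mvar (VarY j) * mvar (VarY j) - mvar VarZ * (embX (f j) * embX (f j)) \<in> Q"
      by (rule subsetD[OF R RLP_square])
    moreover have "mvar VarZ * (embX (f j) * embX (f j)) \<in> Q"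
      by (intro is_ideal_mult_left[OF N] subsetD[OF I] imageI subsetD[OF f] rangeI)
    ultimately have "mvar (VarY j) * mvar (VarY j) \<in> Q"
      by (simp only: is_ideal_diff_mem[OF N])
    then show ?thesis by (simp only: is_prime_mult[OF Q] disj_absorb)
  qed
  show "q \<in> Q"
    unfolding q_eq
    by (intro is_ideal_add[OF N] is_ideal_sum[OF N] lift is_ideal_mult_right[OF N] Y)
qed

theorem jacobian_ideal_subset_prime_iff:
  fixes f :: "'m::finite \<Rightarrow> ('n::finite, 'k::field) mpoly"
  assumes I: "Idl\<^bsub>UR\<^esub> (range f) = I" and nz: "\<And>j. f j \<noteq> 0"
    and G: "finite G" "Idl\<^bsub>UR\<^esub> G = RLP f" and Q: "is_prime Q"
  shows "jacobian_ideal f G \<subseteq> Q \<longleftrightarrow> RLP f \<subseteq> Q \<and> embX ` I \<subseteq> Q"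
proof
  have N: "is_ideal Q" by (rule is_prime_ideal[OF Q])
  assume J: "jacobian_ideal f G \<subseteq> Q"
  have sum: "RLP f <+>\<^bsub>UR\<^esub> Idl\<^bsub>UR\<^esub> (jacobian_minors G) \<subseteq> jacobian_ideal f G"
    unfolding jacobian_ideal_def radical_def nat_pow_UR
    by (auto intro: exI[of _ 1])
  have "a + b \<in> Q" if "a \<in> RLP f" "b \<in> Idl\<^bsub>UR\<^esub> (jacobian_minors G)" for a b
    using that sum J by (auto simp: set_add_def')
  note * = this
  have R: "RLP f \<subseteq> Q"
    using *[of _ 0] is_ideal_zero[OF is_ideal_genideal] by fastforce
  have "jacobian_minors G \<subseteq> Q"
    using *[of 0] is_ideal_zero[OF is_ideal_RLP[of f]] genideal_UR_superset[of "jacobian_minors G"] by fastforce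
  then have "embX (f i) \<in> Q" for i by (rule generators_in_prime[OF Q R _ G])
  then have "range f \<subseteq> embX -` Q" by auto
  then have "I \<subseteq> embX -` Q"
    unfolding I[symmetric]
    by (intro genideal_UR_least ring_morphism.is_ideal_vimage[OF ring_morphism_embX] N)
  with R show "RLP f \<subseteq> Q \<and> embX ` I \<subseteq> Q" by auto
next
  assume RI: "RLP f \<subseteq> Q \<and> embX ` I \<subseteq> Q"
  have iI: "is_ideal I" and fI: "range f \<subseteq> I"
    using I is_ideal_genideal genideal_UR_superset by blast+
  have KQ: "killY -` coeffs_in I \<subseteq> Q"
    using IY_subset_prime[OF Q _ _ fI] RI by blast
  have K: "is_ideal (killY -` coeffs_in I :: ('n, 'm, 'k) rl_mpoly set)"
    by (intro ring_morphism.is_ideal_vimage[OF ring_morphism_killY] is_ideal_coeffs_in iI)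
  have "G \<subseteq> RLP f" using G(2) genideal_UR_superset by blast
  then have "Idl\<^bsub>UR\<^esub> (jacobian_minors G) \<subseteq> killY -` coeffs_in I"
    by (intro genideal_UR_least K jacobian_minors_subset_IY[OF iI fI nz])
  with KQ RI have "RLP f <+>\<^bsub>UR\<^esub> Idl\<^bsub>UR\<^esub> (jacobian_minors G) \<subseteq> Q"
    by (auto simp: set_add_def' intro!: is_ideal_add[OF is_prime_ideal[OF Q]])
  then show "jacobian_ideal f G \<subseteq> Q"
    using is_prime_power[OF Q] by (auto simp: jacobian_ideal_def radical_def nat_pow_UR)
qed


section \<open>Heights\<close>

lemma UNIV_rl_var: "(UNIV :: ('n, 'm) rl_var set) = range VarX \<union> range VarY \<union> {VarZ}"
proof -
  have "v \<in> range VarX \<union> range VarY \<union> {VarZ}" for v :: "('n, 'm) rl_var"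
    by (cases v) auto
  then show ?thesis by blast
qed

instance rl_var :: (finite, finite) finite
  by standard (simp add: UNIV_rl_var)

lemma card_rl_var: "CARD(('n::finite, 'm::finite) rl_var) = CARD('n) + CARD('m) + 1"
proof -
  have "card (range VarX \<union> range VarY :: ('n, 'm) rl_var set) = CARD('n) + CARD('m)"
    by (subst card_Un_disjoint) (auto simp: card_image inj_def)
  moreover have "VarZ \<notin> (range VarX \<union> range VarY :: ('n, 'm) rl_var set)" by auto
  ultimately show ?thesis unfolding UNIV_rl_var by simp
qed

lemma card_VarX_Z: "card (insert VarZ (VarX ` D) :: ('n::finite, 'm) rl_var set) = card D + 1"
  by (subst card_insert_disjoint) (auto simp: card_image inj_on_def)

lemma liftZ_killY:
  assumes "q \<in> polys_in (insert VarZ (range VarX))"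
  shows "liftZ (killY q) = q"
  by (rule morphism_agree[OF ring_morphism_comp[OF ring_morphism_liftZ ring_morphism_killY]
        ring_morphism_id _ _ assms]) auto

lemma coeff_killY_polys_in:
  assumes "q \<in> polys_in (insert VarZ (VarX ` D))"
  shows "Polynomial.coeff (killY q) i \<in> polys_in D"
  unfolding killY_def
  by (rule coeff_mpoly_eval_polys_in[OF assms ring_morphism_poly_const])
    (auto simp: coeff_pCons intro: zero_polys_in one_polys_in mconst_polys_in mvar_polys_in split: nat.splits)

lemma square_subst_eq_0: "square_subst p = 0 \<Longrightarrow> p = 0"
  using even_odd_eq_0(1)[of p 0] by simp

lemma is_prime_RLP: "is_prime (RLP f)" for f :: "'m \<Rightarrow> ('n::finite, 'k::field) mpoly"
  using ring_morphism.is_prime_vimage[OF ring_morphism_rees_like_map is_prime_zero_mpoly_poly, of f]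
  by (simp add: RLP_def vimage_def)

text \<open>The variables \<open>x\<close> and \<open>z\<close> are independent modulo \<open>RLP\<close> because \<open>x\<close> and \<open>t\<close> squared are independent in \<open>S[t]\<close>,
  and each \<open>y j\<close> is algebraic over them by \<open>y j * y j = z * (f j * f j)\<close>.\<close>

lemma prime_height_RLP:
  fixes f :: "'m::finite \<Rightarrow> ('n::finite, 'k::field) mpoly"
  shows "prime_height UR (RLP f) = enat (CARD('m))"
proof -
  let ?D = "insert VarZ (VarX ` UNIV) :: ('n, 'm) rl_var set"
  have "prime_height UR (RLP f) = enat (CARD(('n, 'm) rl_var) - card ?D)"
  proof (rule prime_height_mpoly[OF is_prime_RLP])
    show "polys_in ?D \<inter> RLP f \<subseteq> {0}"
    proof
      fix q assume q: "q \<in> polys_in ?D \<inter> RLP f"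
      then have lift: "liftZ (killY q) = q" by (intro liftZ_killY) auto
      have "square_subst (killY q) = rees_like_map f (liftZ (killY q))" by simp
      also have "\<dots> = 0" unfolding lift using q by (simp add: RLP_def)
      finally have "killY q = 0" by (rule square_subst_eq_0)
      with lift show "q \<in> {0}" by (simp add: ring_morphism.zero[OF ring_morphism_liftZ])
    qed
    show "\<exists>g\<in>polys_in (insert v ?D) \<inter> RLP f. g \<noteq> 0" if v: "v \<notin> ?D" for v
    proof -
      obtain j where j: "v = VarY j" using v by (cases v) auto
      let ?g = "mvar (VarY j) * mvar (VarY j) - mvar VarZ * (embX (f j) * embX (f j)) :: ('n, 'm, 'k) rl_mpoly"
      (* the square relation is nonzero, since it has the value 1 at the unit point of y j *)
      let ?ev = "mpoly_eval (\<lambda>c. c) (\<lambda>w. if w = VarY j then 1 else 0) :: ('n, 'm, 'k) rl_mpoly \<Rightarrow> 'k"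
      have "?ev ?g = 1"
        by (simp add: morphism_simps[OF ring_morphism_mpoly_eval[OF ring_morphism_id]]
            mpoly_eval_mvar ring_morphism_id)
      then have "?g \<noteq> 0"
        by (metis zero_neq_one morphism_simps(2)[OF ring_morphism_mpoly_eval[OF ring_morphism_id]])
      moreover have "embX (f j) \<in> polys_in (insert v ?D)"
        using embX_polys_in[OF polys_in_UNIV] polys_in_mono[of "VarX ` UNIV" "insert v ?D"] by blast
      then have "?g \<in> polys_in (insert v ?D)"
        unfolding diff_conv_add_uminus minus_mult_left
        by (intro polys_in_add polys_in_mult polys_in_uminus mvar_polys_in) (auto simp: j)
      ultimately show ?thesis using RLP_square[of j f] by blast
    qed
  qed
  then show ?thesis
    by (simp add: card_rl_var card_VarX_Z)
qed

text \<open>The prime \<open>(P, y)\<close>, with residue ring \<open>(S/P)[z]\<close>.\<close>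

definition prime_above :: "('n, 'k::field) mpoly set \<Rightarrow> ('n, 'm, 'k) rl_mpoly set" where
  "prime_above P = killY -` coeffs_in P"

lemma is_prime_prime_above: "is_prime P \<Longrightarrow> is_prime (prime_above P)"
  unfolding prime_above_def
  by (intro ring_morphism.is_prime_vimage[OF ring_morphism_killY] is_prime_coeffs_in)

lemma embX_in_prime_above: "is_ideal P \<Longrightarrow> embX s \<in> prime_above P \<longleftrightarrow> s \<in> P"
  by (simp add: prime_above_def const_in_coeffs_in)

lemma RLP_subset_prime_above:
  fixes f :: "'m::finite \<Rightarrow> ('n, 'k::field) mpoly"
  assumes P: "is_ideal P" and f: "range f \<subseteq> P"
  shows "RLP f \<subseteq> prime_above P"
proof
  fix q assume "q \<in> RLP f"
  from RLP_decomposition[OF this P f] obtain e p r where q: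
    "q = (\<Sum>i\<in>UNIV. \<Sum>j\<in>UNIV. embX (f i) * (embX (f j) * liftZ (e i j))) +
      (\<Sum>j\<in>UNIV. mvar (VarY j) * liftZ (p j)) +
      (\<Sum>i\<in>UNIV. \<Sum>j\<in>UNIV. mvar (VarY i) * (mvar (VarY j) * r i j))"
    by (elim exE conjE)
  have "[:f i:] \<in> coeffs_in P" for i
    using f const_in_coeffs_in[OF P] by blast
  then have "killY q \<in> coeffs_in P"
    unfolding q morphism_simps[OF ring_morphism_killY] killY_embX killY_gens
    by (auto intro!: is_ideal_sum is_ideal_mult_right is_ideal_coeffs_in[OF P]
        simp del: mult_pCons_left)
  then show "q \<in> prime_above P" by (simp add: prime_above_def)
qed

lemma prime_height_prime_above:
  fixes P :: "('n::finite, 'k::field) mpoly set"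
  assumes P: "is_prime P"
  shows "prime_height UR (prime_above P :: ('n, 'm::finite, 'k) rl_mpoly set) =
    enat (CARD('m)) + prime_height UR P"
proof -
  have iP: "is_ideal P" by (rule is_prime_ideal[OF P])
  obtain D where D: "polys_in D \<inter> P \<subseteq> {0}"
    and dep: "\<And>v. v \<notin> D \<Longrightarrow> \<exists>g\<in>polys_in (insert v D) \<inter> P. g \<noteq> 0"
    by (rule maximal_independent_variables[OF P], rule that)
  let ?Q = "prime_above P :: ('n, 'm, 'k) rl_mpoly set"
  let ?D = "insert VarZ (VarX ` D) :: ('n, 'm) rl_var set"
  have "prime_height UR ?Q = enat (CARD(('n, 'm) rl_var) - card ?D)"
  proof (rule prime_height_mpoly[OF is_prime_prime_above[OF P]])
    show "polys_in ?D \<inter> ?Q \<subseteq> {0}"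
    proof
      fix q assume q: "q \<in> polys_in ?D \<inter> ?Q"
      then have "Polynomial.coeff (killY q) i \<in> polys_in D \<inter> P" for i
        using coeff_killY_polys_in by (auto simp: prime_above_def coeffs_in_def)
      then have "killY q = 0" using D by (auto simp: poly_eq_iff)
      moreover have "liftZ (killY q) = q"
        using q polys_in_mono[of ?D "insert VarZ (range VarX)"] by (intro liftZ_killY) auto
      ultimately show "q \<in> {0}" by (simp add: ring_morphism.zero[OF ring_morphism_liftZ])
    qed
    show "\<exists>g\<in>polys_in (insert v ?D) \<inter> ?Q. g \<noteq> 0" if v: "v \<notin> ?D" for v
    proof (cases v)
      case (VarX i)
      then obtain g where g: "g \<in> polys_in (insert i D)" "g \<in> P" "g \<noteq> 0"
        using dep[of i] v by blast
      have "embX g \<in> polys_in (insert v ?D)"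
        using embX_polys_in[OF g(1)] polys_in_mono[of "VarX ` insert i D" "insert v ?D"] VarX by auto
      moreover have "embX g \<noteq> (0 :: ('n, 'm, 'k) rl_mpoly)"
        using g(3) killY_embX[of g] ring_morphism.zero[OF ring_morphism_killY] by (metis pCons_eq_0_iff)
      ultimately show ?thesis
        using g(2) embX_in_prime_above[OF iP] by blast
    next
      case (VarY j)
      have "mvar v \<in> ?Q"
        by (simp add: VarY prime_above_def is_ideal_zero[OF is_ideal_coeffs_in[OF iP]])
      moreover have "mvar v \<noteq> (0 :: ('n, 'm, 'k) rl_mpoly)"
        by (metis mpoly_pderiv_mvar mpoly_pderiv_0 zero_neq_one)
      ultimately show ?thesis using mvar_polys_in[of v "insert v ?D"] by blast
    qed (use v in auto)
  qed
  moreover have "prime_height UR P = enat (CARD('n) - card D)"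
    by (rule prime_height_mpoly[OF P D dep])
  moreover have "card D \<le> CARD('n)" by (rule card_mono) auto
  ultimately show ?thesis by (simp add: card_rl_var card_VarX_Z)
qed

lemma enat_INF_add:
  fixes h :: "'a \<Rightarrow> enat"
  assumes "A \<noteq> {}"
  shows "(INF x\<in>A. enat m + h x) = enat m + (INF x\<in>A. h x)"
proof (rule antisym)
  obtain x where "x \<in> A" "(INF x\<in>A. h x) = h x"
    using assms by (metis (mono_tags, lifting) INF_eq_minf empty_is_image imageE wellorder_InfI ex_in_conv)
  then show "(INF x\<in>A. enat m + h x) \<le> enat m + (INF x\<in>A. h x)"
    by (auto intro: INF_lower)
  show "enat m + (INF x\<in>A. h x) \<le> (INF x\<in>A. enat m + h x)"
    by (rule INF_greatest) (intro add_left_mono INF_lower)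
qed

text \<open>A prime \<open>Q\<close> containing \<open>J\<close> contains \<open>prime_above P\<close> for its contraction \<open>P\<close> to \<open>S\<close>, so the infimum
  that defines the height of \<open>J\<close> may be taken over the primes \<open>prime_above P\<close>.\<close>

theorem codim_Sing_eq_height:
  fixes f :: "'m::finite \<Rightarrow> ('n::finite, 'k::field) mpoly"
  assumes I: "Idl\<^bsub>UR\<^esub> (range f) = I" and nz: "\<And>j. f j \<noteq> 0"
    and G: "finite G" "Idl\<^bsub>UR\<^esub> G = RLP f"
  shows "codim_Sing f G = height UR I"
proof -
  let ?A = "{P. is_prime P \<and> I \<subseteq> P}"
  have f: "range f \<subseteq> I" unfolding I[symmetric] by (rule genideal_UR_superset)
  note iff = jacobian_ideal_subset_prime_iff[OF I nz G]
  have "height UR (jacobian_ideal f G) = (INF P\<in>?A. enat (CARD('m)) + prime_height UR P)"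
  proof (rule antisym)
    show "height UR (jacobian_ideal f G) \<le> (INF P\<in>?A. enat (CARD('m)) + prime_height UR P)"
    proof (rule INF_greatest)
      fix P assume P: "P \<in> ?A"
      let ?Q = "prime_above P :: ('n, 'm, 'k) rl_mpoly set"
      have iP: "is_ideal P" using P is_prime_ideal by blast
      have R: "RLP f \<subseteq> ?Q"
        by (rule RLP_subset_prime_above[OF iP]) (use f P in blast)
      have "is_prime ?Q" using P is_prime_prime_above by blast
      moreover from this have "jacobian_ideal f G \<subseteq> ?Q"
        using P R by (subst iff) (auto simp: embX_in_prime_above[OF iP])
      ultimately have "height UR (jacobian_ideal f G) \<le> prime_height UR ?Q"
        unfolding height_UR_eq by (intro INF_lower) blast
      then show "height UR (jacobian_ideal f G) \<le> enat (CARD('m)) + prime_height UR P"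
        using prime_height_prime_above[of P, where 'm = 'm] P by simp
    qed
    show "(INF P\<in>?A. enat (CARD('m)) + prime_height UR P) \<le> height UR (jacobian_ideal f G)"
      unfolding height_UR_eq[of "jacobian_ideal f G"]
    proof (rule INF_greatest)
      fix Q assume "Q \<in> {Q. is_prime Q \<and> jacobian_ideal f G \<subseteq> Q}"
      then have Q: "is_prime Q" and J: "jacobian_ideal f G \<subseteq> Q" by auto
      then have R: "RLP f \<subseteq> Q" and IQ: "embX ` I \<subseteq> Q" using iff by auto
      define P where "P = (embX :: _ \<Rightarrow> ('n, 'm, 'k) rl_mpoly) -` Q"
      have P: "is_prime P"
        unfolding P_def by (rule ring_morphism.is_prime_vimage[OF ring_morphism_embX Q])
      have IP: "I \<subseteq> P" using IQ by (auto simp: P_def)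
      have PQ: "prime_above P \<subseteq> Q"
        unfolding prime_above_def
        by (rule IY_subset_prime[OF Q R]) (use f IP in \<open>auto simp: P_def\<close>)
      have "enat (CARD('m)) + prime_height UR P \<le> prime_height UR Q"
        using prime_height_mono[OF PQ Q] by (simp only: prime_height_prime_above[OF P])
      moreover have "(INF P\<in>?A. enat (CARD('m)) + prime_height UR P) \<le> enat (CARD('m)) + prime_height UR P"
        using P IP by (intro INF_lower) auto
      ultimately show "(INF P\<in>?A. enat (CARD('m)) + prime_height UR P) \<le> prime_height UR Q" by simp
    qed
  qed
  also have "\<dots> = enat (CARD('m)) + height UR I"
    unfolding height_UR_eq[of I]
  proof (cases "?A = {}")
    case False
    then show "(INF P\<in>?A. enat (CARD('m)) + prime_height UR P) = enat (CARD('m)) + (INF P\<in>?A. prime_height UR P)"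
      by (rule enat_INF_add)
  next
    case True
    show "(INF P\<in>?A. enat (CARD('m)) + prime_height UR P) = enat (CARD('m)) + (INF P\<in>?A. prime_height UR P)"
      unfolding True by (simp add: top_enat_def)
  qed
  finally show ?thesis
    unfolding codim_Sing_def height_prime[OF is_prime_RLP] prime_height_RLP by simp
qed


section \<open>Homogeneous components\<close>

lemma mono_degree_superset:
  assumes "finite A" "Poly_Mapping.keys u \<subseteq> A"
  shows "mono_degree u = (\<Sum>x\<in>A. Poly_Mapping.lookup u x)"
  unfolding mono_degree_def
  by (rule sum.mono_neutral_left) (use assms in \<open>auto simp: in_keys_iff\<close>)

lemma mono_degree_add: "mono_degree (u + v) = mono_degree u + mono_degree v"
proof -
  let ?A = "Poly_Mapping.keys u \<union> Poly_Mapping.keys v"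
  have "mono_degree (u + v) = (\<Sum>x\<in>?A. Poly_Mapping.lookup (u + v) x)"
    by (rule mono_degree_superset) (use Poly_Mapping.keys_add[of u v] in auto)
  also have "\<dots> = mono_degree u + mono_degree v"
    by (simp add: mono_degree_superset[of ?A] lookup_add sum.distrib)
  finally show ?thesis .
qed

lemma mpoly_component_zero: "0 \<in> mpoly_component d"
  by (simp add: mpoly_component_def)

lemma mpoly_component_add:
  "p \<in> mpoly_component d \<Longrightarrow> q \<in> mpoly_component d \<Longrightarrow> p + q \<in> mpoly_component d"
  using Poly_Mapping.keys_add[of p q] by (auto simp: mpoly_component_def)

lemma mpoly_component_sum:
  "(\<And>x. x \<in> A \<Longrightarrow> f x \<in> mpoly_component d) \<Longrightarrow> sum f A \<in> mpoly_component d"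
  by (induction A rule: infinite_finite_induct) (auto intro: mpoly_component_zero mpoly_component_add)

lemma mpoly_component_mult:
  assumes "p \<in> mpoly_component d" "q \<in> mpoly_component e"
  shows "p * q \<in> mpoly_component (d + e)"
  unfolding mpoly_component_def
proof (intro CollectI ballI)
  fix w assume "w \<in> Poly_Mapping.keys (p * q)"
  then obtain u v where "w = u + v" "u \<in> Poly_Mapping.keys p" "v \<in> Poly_Mapping.keys q"
    using Poly_Mapping.keys_mult[of p q] by auto
  with assms show "mono_degree w = d + e"
    by (simp add: mono_degree_add mpoly_component_def)
qed

text \<open>The substitution of \<open>x * t\<close> for each variable \<open>x\<close>: its coefficients at the powers of \<open>t\<close> are the
  homogeneous components. In this form compatibility with products is that of a ring morphism, and
  the argument of Gauss applies.\<close>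

definition components_poly :: "('x, 'k::comm_ring_1) mpoly \<Rightarrow> ('x, 'k) mpoly poly" where
  "components_poly = mpoly_eval (\<lambda>c. [:mconst c:]) (\<lambda>x. [:0, mvar x:])"

lemma ring_morphism_components_poly: "ring_morphism components_poly"
  unfolding components_poly_def by (rule ring_morphism_mpoly_eval[OF ring_morphism_poly_const])

lemma poly_components_poly: "poly (components_poly p) 1 = p"
  by (rule morphism_agree[OF ring_morphism_comp[OF ring_morphism_poly ring_morphism_components_poly]
        ring_morphism_id _ _ polys_in_UNIV])
    (simp_all add: components_poly_def mpoly_eval_mconst mpoly_eval_mvar ring_morphism_poly_const)

lemma coeff_components_poly: "Polynomial.coeff (components_poly p) d \<in> mpoly_component d"
proof -
  have "components_poly p \<in> {q. \<forall>d. Polynomial.coeff q d \<in> mpoly_component d}"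
    unfolding components_poly_def
  proof (rule mpoly_eval_closed[OF polys_in_UNIV ring_morphism_poly_const])
    show "[:mconst c:] \<in> {q. \<forall>d. Polynomial.coeff q d \<in> mpoly_component d}" for c
      by (auto simp: coeff_pCons mpoly_component_def mconst_def mono_degree_def split: nat.splits)
    show "[:0, mvar x:] \<in> {q. \<forall>d. Polynomial.coeff q d \<in> mpoly_component d}" for x
      by (auto simp: coeff_pCons mpoly_component_def mvar_def mono_degree_def split: nat.splits)
    show "a * b \<in> {q. \<forall>d. Polynomial.coeff q d \<in> mpoly_component d}"
      if "a \<in> {q. \<forall>d. Polynomial.coeff q d \<in> mpoly_component d}"
        "b \<in> {q. \<forall>d. Polynomial.coeff q d \<in> mpoly_component d}" for a b
    proof (intro CollectI allI)
      fix d
      have "Polynomial.coeff a i * Polynomial.coeff b (d - i) \<in> mpoly_component d" if "i \<le> d" for i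
        using mpoly_component_mult[of "Polynomial.coeff a i" i "Polynomial.coeff b (d - i)" "d - i"]
          \<open>a \<in> _\<close> \<open>b \<in> _\<close> that by simp
      then show "Polynomial.coeff (a * b) d \<in> mpoly_component d"
        unfolding coeff_mult by (intro mpoly_component_sum) simp
    qed
  qed (simp add: mpoly_component_add)
  then show ?thesis by blast
qed

lemma lookup_coeff_components_poly:
  "Poly_Mapping.lookup (Polynomial.coeff (components_poly p) d) u =
    (if mono_degree u = d then Poly_Mapping.lookup p u else 0)"
proof -
  let ?c = "Polynomial.coeff (components_poly p)"
  have zero: "Poly_Mapping.lookup (?c e) u = 0" if "e \<noteq> mono_degree u" for e
    using coeff_components_poly[of p e] that by (auto simp: mpoly_component_def in_keys_iff)
  have "Poly_Mapping.lookup p u = (\<Sum>e\<le>Polynomial.degree (components_poly p). Poly_Mapping.lookup (?c e) u)"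
    by (subst poly_components_poly[symmetric, of p]) (simp add: poly_altdef lookup_sum)
  also have "\<dots> = (\<Sum>e\<le>Polynomial.degree (components_poly p). if e = mono_degree u then Poly_Mapping.lookup (?c e) u else 0)"
    by (rule sum.cong) (auto simp: zero)
  also have "\<dots> = Poly_Mapping.lookup (?c (mono_degree u)) u"
    by (auto simp: coeff_eq_0 not_le)
  finally show ?thesis using zero by auto
qed

lemma components_poly_homogeneous:
  assumes "p \<in> mpoly_component d"
  shows "components_poly p = Polynomial.monom p d"
proof (rule poly_eqI, rule poly_mapping_eqI)
  fix e u
  show "Poly_Mapping.lookup (Polynomial.coeff (components_poly p) e) u =
      Poly_Mapping.lookup (Polynomial.coeff (Polynomial.monom p d) e) u"
    using assms by (auto simp: lookup_coeff_components_poly mpoly_component_def in_keys_iff)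
qed

text \<open>For an ideal \<open>N\<close>, the ideal generated by the homogeneous elements of \<open>N\<close>.\<close>

definition homogeneous_part :: "('x, 'k::comm_ring_1) mpoly set \<Rightarrow> ('x, 'k) mpoly set" where
  "homogeneous_part N = components_poly -` coeffs_in N"

lemma homogeneous_part_subset: "is_ideal N \<Longrightarrow> homogeneous_part N \<subseteq> N"
  using poly_mem_ideal[of N _ 1] poly_components_poly
  by (metis homogeneous_part_def subsetI vimage_eq)

lemma homogeneous_part_mono: "N \<subseteq> N' \<Longrightarrow> homogeneous_part N \<subseteq> homogeneous_part N'"
  unfolding homogeneous_part_def by (intro vimage_mono coeffs_in_mono)

lemma is_prime_homogeneous_part:
  assumes N: "is_ideal N" and "1 \<notin> N"
    and prime: "\<And>a b d e. a \<in> mpoly_component d \<Longrightarrow> b \<in> mpoly_component e \<Longrightarrow> a * b \<in> N \<Longrightarrow> a \<in> N \<or> b \<in> N"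
  shows "is_prime (homogeneous_part N)"
proof -
  have "1 \<notin> homogeneous_part N"
    using homogeneous_part_subset[OF N] \<open>1 \<notin> N\<close> by blast
  moreover have "is_ideal (homogeneous_part N)"
    unfolding homogeneous_part_def
    by (intro ring_morphism.is_ideal_vimage[OF ring_morphism_components_poly] is_ideal_coeffs_in N)
  moreover have "a \<in> homogeneous_part N \<or> b \<in> homogeneous_part N" if "a * b \<in> homogeneous_part N" for a b
  proof -
    have "components_poly a * components_poly b \<in> coeffs_in N"
      using that by (simp add: homogeneous_part_def ring_morphism.mult[OF ring_morphism_components_poly])
    then have "components_poly a \<in> coeffs_in N \<or> components_poly b \<in> coeffs_in N"
      by (rule coeffs_in_mult_cases[OF N]) (rule prime[OF coeff_components_poly coeff_components_poly])
    then show ?thesis by (simp add: homogeneous_part_def)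
  qed
  ultimately show ?thesis by (auto simp: is_prime_def)
qed

lemma homogeneous_ideal_subset_part:
  assumes "homogeneous_ideal UR mpoly_component I"
  shows "I \<subseteq> homogeneous_part I"
proof -
  have I: "is_ideal I" and gen: "Idl\<^bsub>UR\<^esub> (I \<inter> (\<Union>d. mpoly_component d)) = I"
    using assms by (auto simp: homogeneous_ideal_def ideal_UR_iff)
  have "is_ideal (homogeneous_part I)"
    unfolding homogeneous_part_def
    by (intro ring_morphism.is_ideal_vimage[OF ring_morphism_components_poly] is_ideal_coeffs_in I)
  moreover have "I \<inter> (\<Union>d. mpoly_component d) \<subseteq> homogeneous_part I"
    by (auto simp: homogeneous_part_def components_poly_homogeneous coeffs_in_def is_ideal_zero[OF I])
  ultimately have "Idl\<^bsub>UR\<^esub> (I \<inter> (\<Union>d. mpoly_component d)) \<subseteq> homogeneous_part I"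
    by (rule genideal_UR_least)
  then show ?thesis by (simp only: gen)
qed


section \<open>Minimal primes\<close>

lemma minimal_primes_UR:
  "P \<in> minimal_primes UR I \<longleftrightarrow>
    is_prime P \<and> I \<subseteq> P \<and> (\<forall>Q. is_prime Q \<and> I \<subseteq> Q \<and> Q \<subseteq> P \<longrightarrow> Q = P)"
  by (simp add: minimal_primes_def primeideal_UR_iff)

lemma is_prime_Inter_chain:
  assumes "F \<noteq> {}" and prime: "\<And>P. P \<in> F \<Longrightarrow> is_prime P"
    and chain: "\<And>P Q. P \<in> F \<Longrightarrow> Q \<in> F \<Longrightarrow> P \<subseteq> Q \<or> Q \<subseteq> P"
  shows "is_prime (\<Inter>F)"
proof -
  have "is_ideal (\<Inter>F)"
    using prime[THEN is_prime_ideal] by (auto simp: is_ideal_def)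
  moreover have "1 \<notin> \<Inter>F"
    using assms(1) prime[THEN is_prime_one] by blast
  moreover have "a \<in> \<Inter>F \<or> b \<in> \<Inter>F" if ab: "a * b \<in> \<Inter>F" for a b
  proof (rule ccontr)
    assume "\<not> ?thesis"
    then obtain P Q where PQ: "P \<in> F" "a \<notin> P" "Q \<in> F" "b \<notin> Q" by blast
    have "a * b \<in> P" "a * b \<in> Q" using ab PQ by auto
    then have "b \<in> P" "a \<in> Q"
      using PQ is_prime_mult[OF prime] by blast+
    with chain[OF PQ(1,3)] PQ show False by blast
  qed
  ultimately show ?thesis by (auto simp: is_prime_def)
qed

text \<open>Zorn's lemma is applied to complements, since it provides maximal elements.\<close>

lemma minimal_prime_below:
  assumes P: "is_prime P" and I: "I \<subseteq> P"
  shows "\<exists>P0\<in>minimal_primes UR I. P0 \<subseteq> P"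
proof -
  let ?F = "{Q. is_prime Q \<and> I \<subseteq> Q \<and> Q \<subseteq> P}"
  have "\<exists>M\<in>uminus ` ?F. \<forall>Y\<in>uminus ` ?F. M \<subseteq> Y \<longrightarrow> Y = M"
  proof (rule subset_Zorn_nonempty)
    show "uminus ` ?F \<noteq> {}" using assms by auto
    fix \<C> assume "\<C> \<noteq> {}" and chain: "subset.chain (uminus ` ?F) \<C>"
    let ?D = "uminus ` \<C>"
    have D: "Q \<in> ?F" if "Q \<in> ?D" for Q
      using chain that unfolding subset.chain_def by auto
    have "is_prime (\<Inter>?D)"
    proof (rule is_prime_Inter_chain)
      show "Q \<subseteq> Q' \<or> Q' \<subseteq> Q" if "Q \<in> ?D" "Q' \<in> ?D" for Q Q'
      proof -
        have "- Q \<in> \<C>" "- Q' \<in> \<C>" using that by auto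
        then have "- Q \<subseteq> - Q' \<or> - Q' \<subseteq> - Q"
          using chain unfolding subset_chain_def by blast
        then show ?thesis by auto
      qed
    qed (use D \<open>\<C> \<noteq> {}\<close> in auto)
    moreover have "I \<subseteq> \<Inter>?D" "\<Inter>?D \<subseteq> P"
      using D \<open>\<C> \<noteq> {}\<close> by blast+
    ultimately have "\<Inter>?D \<in> ?F" by simp
    moreover have "\<Union>\<C> = - \<Inter>?D" by auto
    ultimately show "\<Union>\<C> \<in> uminus ` ?F" by blast
  qed
  then obtain P0 where P0: "P0 \<in> ?F" and max: "\<And>Q. Q \<in> ?F \<Longrightarrow> - P0 \<subseteq> - Q \<Longrightarrow> - Q = - P0"
    by auto
  have "P0 \<in> minimal_primes UR I"
    unfolding minimal_primes_UR
  proof (intro conjI allI impI)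
    fix Q assume Q: "is_prime Q \<and> I \<subseteq> Q \<and> Q \<subseteq> P0"
    then have "- Q = - P0" using P0 by (intro max) auto
    then show "Q = P0" by (rule Compl_eq_Compl_iff[THEN iffD1])
  qed (use P0 in auto)
  with P0 show ?thesis by blast
qed

text \<open>The homogeneous part of \<open>P\<close> is a prime that still contains \<open>I\<close>, hence equal to \<open>P\<close> by minimality.\<close>

lemma minimal_prime_homogeneous:
  assumes I: "homogeneous_ideal UR mpoly_component I" and P: "P \<in> minimal_primes UR I"
  shows "P \<subseteq> homogeneous_part P"
proof -
  have prime: "is_prime P" and IP: "I \<subseteq> P"
    and min: "\<And>Q. is_prime Q \<Longrightarrow> I \<subseteq> Q \<Longrightarrow> Q \<subseteq> P \<Longrightarrow> Q = P"
    using P by (auto simp: minimal_primes_UR)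
  have "homogeneous_part P = P"
  proof (rule min)
    show "is_prime (homogeneous_part P)"
      using is_prime_mult[OF prime]
      by (intro is_prime_homogeneous_part is_prime_ideal[OF prime] is_prime_one[OF prime]) auto
    show "I \<subseteq> homogeneous_part P"
      using homogeneous_ideal_subset_part[OF I] homogeneous_part_mono[OF IP] by (rule order_trans)
    show "homogeneous_part P \<subseteq> P"
      by (rule homogeneous_part_subset[OF is_prime_ideal[OF prime]])
  qed
  then show ?thesis by simp
qed


section \<open>Primes of the Rees-like algebra\<close>

text \<open>The elements of \<open>RL(I)\<close>: generators of odd degree in \<open>t\<close> come from \<open>I t\<close>, so odd coefficients lie in
  \<open>I\<close>, while even ones are arbitrary.\<close>

definition rees_like_carrier :: "'a::comm_ring_1 set \<Rightarrow> 'a poly set" where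
  "rees_like_carrier I = {p. \<forall>i. odd i \<longrightarrow> Polynomial.coeff p i \<in> I}"

lemma rees_like_carrier_add:
  "is_ideal I \<Longrightarrow> p \<in> rees_like_carrier I \<Longrightarrow> q \<in> rees_like_carrier I \<Longrightarrow> p + q \<in> rees_like_carrier I"
  by (simp add: rees_like_carrier_def is_ideal_add)

lemma rees_like_carrier_mult:
  assumes I: "is_ideal I" and p: "p \<in> rees_like_carrier I" and q: "q \<in> rees_like_carrier I"
  shows "p * q \<in> rees_like_carrier I"
  unfolding rees_like_carrier_def
proof (intro CollectI allI impI)
  fix n :: nat assume "odd n"
  have "Polynomial.coeff p i * Polynomial.coeff q (n - i) \<in> I" if "i \<le> n" for i
  proof -
    have "odd i \<or> odd (n - i)" using \<open>odd n\<close> that by auto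
    then have "Polynomial.coeff p i \<in> I \<or> Polynomial.coeff q (n - i) \<in> I"
      using p q unfolding rees_like_carrier_def by blast
    then show ?thesis
      using is_ideal_mult_left[OF I] is_ideal_mult_right[OF I] by auto
  qed
  then show "Polynomial.coeff (p * q) n \<in> I"
    unfolding coeff_mult by (intro is_ideal_sum[OF I]) simp
qed

lemma monom_in_rees_like_carrier:
  "is_ideal I \<Longrightarrow> Polynomial.monom s i \<in> rees_like_carrier I \<longleftrightarrow> even i \<or> s \<in> I"
  by (auto simp: rees_like_carrier_def is_ideal_zero)

lemma const_in_rees_like_carrier: "is_ideal I \<Longrightarrow> [:s:] \<in> rees_like_carrier I"
  by (auto simp: rees_like_carrier_def coeff_pCons is_ideal_zero split: nat.splits)

lemma generate_ring_power:
  "a \<in> generate_ring UR A \<Longrightarrow> a ^ n \<in> generate_ring UR A"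
proof (induction n)
  case 0
  show ?case using generate_ring.one[of UR A] by simp
next
  case (Suc n)
  then show ?case using generate_ring.eng_mult[of a UR A "a ^ n"] by simp
qed

lemma generate_ring_sum:
  "(\<And>x. x \<in> B \<Longrightarrow> g x \<in> generate_ring UR A) \<Longrightarrow> sum g B \<in> generate_ring UR A"
proof (induction B rule: infinite_finite_induct)
  case (insert x B)
  then show ?case using generate_ring.eng_add[of "g x" UR A "sum g B"] by simp
qed (use UR.zero_in_generate in auto)

lemma carrier_rees_like_algebra:
  assumes I: "is_ideal I"
  shows "carrier (rees_like_algebra I) = rees_like_carrier I"
proof -
  let ?A = "(\<lambda>s. [:s:]) ` UNIV \<union> (\<lambda>a. [:0, a:]) ` I \<union> {[:0, 0, 1:]}"
  have "generate_ring UR ?A \<subseteq> rees_like_carrier I"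
  proof
    fix p assume "p \<in> generate_ring UR ?A"
    then show "p \<in> rees_like_carrier I"
    proof (induction rule: generate_ring.induct)
      case one
      show ?case using const_in_rees_like_carrier[OF I, of 1] by (simp add: one_pCons)
    next
      case (incl h)
      then show ?case
        by (auto simp: rees_like_carrier_def coeff_pCons is_ideal_zero[OF I] split: nat.splits)
    next
      case (a_inv h)
      have "\<ominus>\<^bsub>UR\<^esub> h = - h" using UR.minus_equality[of "- h" h] by simp
      then show ?case
        using a_inv.IH by (simp add: rees_like_carrier_def is_ideal_uminus[OF I])
    qed (simp_all add: rees_like_carrier_add rees_like_carrier_mult I)
  qed
  moreover have "p \<in> generate_ring UR ?A" if p: "p \<in> rees_like_carrier I" for p
  proof -
    have gen: "a \<in> ?A \<Longrightarrow> a \<in> generate_ring UR ?A" for a by (rule generate_ring.incl)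
    have mult: "a \<in> generate_ring UR ?A \<Longrightarrow> b \<in> generate_ring UR ?A \<Longrightarrow> a * b \<in> generate_ring UR ?A" for a b
      using generate_ring.eng_mult[of a UR ?A b] by simp
    have sq: "[:0, 0, 1:] ^ k = Polynomial.monom 1 (2 * k)" for k :: nat
      by (induction k) (simp_all add: monom_Suc one_pCons monom_0)
    have "Polynomial.monom (Polynomial.coeff p i) i \<in> generate_ring UR ?A" for i
    proof (cases "even i")
      case True
      then obtain k where "i = 2 * k" by blast
      then have "Polynomial.monom (Polynomial.coeff p i) i = [:Polynomial.coeff p i:] * [:0, 0, 1:] ^ k"
        unfolding sq by (simp add: smult_monom)
      also have "\<dots> \<in> generate_ring UR ?A"
        by (intro mult generate_ring_power gen) auto
      finally show ?thesis .
    next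
      case False
      then obtain k where "i = 2 * k + 1" using oddE by blast
      then have "Polynomial.monom (Polynomial.coeff p i) i = [:0, Polynomial.coeff p i:] * [:0, 0, 1:] ^ k"
        unfolding sq by (simp add: smult_monom monom_Suc)
      also have "\<dots> \<in> generate_ring UR ?A"
        using p False by (intro mult generate_ring_power gen) (auto simp: rees_like_carrier_def)
      finally show ?thesis .
    qed
    then have "(\<Sum>i\<le>Polynomial.degree p. Polynomial.monom (Polynomial.coeff p i) i) \<in> generate_ring UR ?A"
      by (intro generate_ring_sum)
    then show ?thesis by (simp only: poly_as_sum_of_monoms)
  qed
  ultimately show ?thesis by (auto simp: rees_like_algebra_def)
qed

lemma rees_like_algebra_simps [simp]:
  "a \<oplus>\<^bsub>rees_like_algebra I\<^esub> b = a + b" "a \<otimes>\<^bsub>rees_like_algebra I\<^esub> b = a * b"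
  "\<zero>\<^bsub>rees_like_algebra I\<^esub> = 0" "\<one>\<^bsub>rees_like_algebra I\<^esub> = 1"
  by (simp_all add: rees_like_algebra_def ring_of_type_algebra_def)

lemma cring_rees_like_algebra: "cring (rees_like_algebra I)"
  unfolding rees_like_algebra_def
  by (subst UR.subcring_iff[symmetric]) (auto intro!: UR.subcringI' UR.generate_ring_is_subring)

text \<open>Ideals and primes of the Rees-like algebra, spelled out as subsets of \<open>S[t]\<close>.\<close>

definition rees_like_ideal :: "'a::comm_ring_1 set \<Rightarrow> 'a poly set \<Rightarrow> bool" where
  "rees_like_ideal I q \<longleftrightarrow> q \<subseteq> rees_like_carrier I \<and> 0 \<in> q \<and> (\<forall>a\<in>q. \<forall>b\<in>q. a + b \<in> q) \<and>
     (\<forall>a\<in>q. \<forall>r\<in>rees_like_carrier I. r * a \<in> q)"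

definition rees_like_prime :: "'a::comm_ring_1 set \<Rightarrow> 'a poly set \<Rightarrow> bool" where
  "rees_like_prime I q \<longleftrightarrow> rees_like_ideal I q \<and> 1 \<notin> q \<and>
     (\<forall>a\<in>rees_like_carrier I. \<forall>b\<in>rees_like_carrier I. a * b \<in> q \<longrightarrow> a \<in> q \<or> b \<in> q)"

lemma ideal_rees_like_iff:
  assumes I: "is_ideal I"
  shows "ideal q (rees_like_algebra I) \<longleftrightarrow> rees_like_ideal I q"
proof
  assume "ideal q (rees_like_algebra I)"
  then interpret ideal q "rees_like_algebra I" .
  show "rees_like_ideal I q"
    using a_subset additive_subgroup.a_closed[OF is_additive_subgroup] I_l_closed
      additive_subgroup.zero_closed[OF is_additive_subgroup]
    by (auto simp: rees_like_ideal_def carrier_rees_like_algebra[OF I])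
next
  assume q: "rees_like_ideal I q"
  interpret RL: cring "rees_like_algebra I" by (rule cring_rees_like_algebra)
  have one: "- 1 \<in> rees_like_carrier I"
    using const_in_rees_like_carrier[OF I, of "- 1"] by (simp add: one_pCons)
  show "ideal q (rees_like_algebra I)"
  proof (rule idealI)
    show "subgroup q (add_monoid (rees_like_algebra I))"
    proof (rule group.subgroupI)
      show "Group.group (add_monoid (rees_like_algebra I))" by (rule RL.a_group)
      show "inv\<^bsub>add_monoid (rees_like_algebra I)\<^esub> a \<in> q" if a: "a \<in> q" for a
      proof -
        have aq: "- a \<in> q" using q a one unfolding rees_like_ideal_def by fastforce
        have "\<ominus>\<^bsub>rees_like_algebra I\<^esub> a = - a"
          using RL.minus_equality[of "- a" a] a aq q
          by (auto simp: rees_like_ideal_def carrier_rees_like_algebra[OF I])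
        then show ?thesis using aq by (simp add: a_inv_def)
      qed
    qed (use q in \<open>auto simp: rees_like_ideal_def carrier_rees_like_algebra[OF I]\<close>)
  qed (use q RL.ring_axioms in \<open>auto simp: rees_like_ideal_def carrier_rees_like_algebra[OF I] mult.commute\<close>)
qed

lemma primeideal_rees_like_iff:
  assumes I: "is_ideal I"
  shows "primeideal q (rees_like_algebra I) \<longleftrightarrow> rees_like_prime I q"
proof
  assume "primeideal q (rees_like_algebra I)"
  then interpret primeideal q "rees_like_algebra I" .
  have "rees_like_ideal I q"
    using ideal_axioms ideal_rees_like_iff[OF I] by blast
  moreover have "1 \<notin> q"
    using I_notcarr one_imp_carrier by auto
  ultimately show "rees_like_prime I q"
    using I_prime by (auto simp: rees_like_prime_def carrier_rees_like_algebra[OF I])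
next
  assume q: "rees_like_prime I q"
  have "1 \<in> rees_like_carrier I"
    using const_in_rees_like_carrier[OF I, of 1] by (simp add: one_pCons)
  with q show "primeideal q (rees_like_algebra I)"
    by (intro primeidealI)
      (auto simp: ideal_rees_like_iff[OF I] rees_like_prime_def carrier_rees_like_algebra[OF I]
        cring_rees_like_algebra)
qed

lemma rees_like_ideal_add: "rees_like_ideal I q \<Longrightarrow> a \<in> q \<Longrightarrow> b \<in> q \<Longrightarrow> a + b \<in> q"
  and rees_like_ideal_mult: "rees_like_ideal I q \<Longrightarrow> a \<in> q \<Longrightarrow> r \<in> rees_like_carrier I \<Longrightarrow> r * a \<in> q"
  by (simp_all add: rees_like_ideal_def)

lemma rees_like_prime_ideal: "rees_like_prime I q \<Longrightarrow> rees_like_ideal I q"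
  and rees_like_prime_mult: "rees_like_prime I q \<Longrightarrow> a \<in> rees_like_carrier I \<Longrightarrow>
    b \<in> rees_like_carrier I \<Longrightarrow> a * b \<in> q \<Longrightarrow> a \<in> q \<or> b \<in> q"
  by (simp_all add: rees_like_prime_def)

lemma rees_like_ideal_sum:
  "rees_like_ideal I q \<Longrightarrow> (\<And>x. x \<in> A \<Longrightarrow> g x \<in> q) \<Longrightarrow> sum g A \<in> q"
  by (induction A rule: infinite_finite_induct) (auto simp: rees_like_ideal_def)

lemma is_prime_rees_like_vimage:
  fixes f :: "'m \<Rightarrow> ('n, 'k::field) mpoly"
  assumes I: "is_ideal I" and f: "range f \<subseteq> I" and q: "rees_like_prime I q"
  shows "is_prime (rees_like_map f -` q)" and "RLP f \<subseteq> rees_like_map f -` q"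
proof -
  have C: "rees_like_map f r \<in> rees_like_carrier I" for r
    unfolding rees_like_map_def
  proof (rule mpoly_eval_closed[OF polys_in_UNIV ring_morphism_poly_const])
    fix v :: "('n, 'm) rl_var"
    show "(case v of VarX i \<Rightarrow> [:mvar i:] | VarY j \<Rightarrow> [:0, f j:] | VarZ \<Rightarrow> [:0, 0, 1:]) \<in> rees_like_carrier I"
      using f by (cases v)
        (auto simp: rees_like_carrier_def coeff_pCons is_ideal_zero[OF I] split: nat.splits)
  qed (auto simp: const_in_rees_like_carrier rees_like_carrier_add rees_like_carrier_mult I)
  note hom = morphism_simps[OF ring_morphism_rees_like_map]
  show "is_prime (rees_like_map f -` q)"
    unfolding is_prime_def is_ideal_def using q C
    by (auto simp: rees_like_prime_def rees_like_ideal_def hom)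
  show "RLP f \<subseteq> rees_like_map f -` q"
    using q by (auto simp: rees_like_prime_def rees_like_ideal_def RLP_def)
qed

definition rees_like_prime_over :: "'a::comm_ring_1 set \<Rightarrow> 'a set \<Rightarrow> 'a poly set" where
  "rees_like_prime_over I P = coeffs_in P \<inter> rees_like_carrier I"

lemma rees_like_prime_over:
  assumes I: "is_ideal I" and P: "is_prime P"
  shows "rees_like_prime I (rees_like_prime_over I P)"
proof -
  note N = is_prime_coeffs_in[OF P]
  note iN = is_prime_ideal[OF N]
  have "0 \<in> rees_like_carrier I"
    by (simp add: rees_like_carrier_def is_ideal_zero[OF I])
  then show ?thesis
    using is_ideal_zero[OF iN] is_ideal_add[OF iN] is_ideal_mult_left[OF iN] is_prime_one[OF N]
      rees_like_carrier_add[OF I] rees_like_carrier_mult[OF I] is_prime_mult[OF N]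
    unfolding rees_like_prime_def rees_like_ideal_def rees_like_prime_over_def by auto
qed

lemma const_in_rees_like_prime_over:
  "is_ideal I \<Longrightarrow> is_ideal P \<Longrightarrow> [:s:] \<in> rees_like_prime_over I P \<longleftrightarrow> s \<in> P"
  by (simp add: rees_like_prime_over_def const_in_coeffs_in const_in_rees_like_carrier)

text \<open>An even term of an element of \<open>rees_like_prime_over I P\<close> is a multiple of a constant in \<open>P\<close>. An odd
  term need not be one, but its square is, and \<open>q\<close> is prime.\<close>

lemma rees_like_prime_over_subset:
  assumes I: "is_ideal I" and q: "rees_like_prime I q" and P: "\<And>s. s \<in> P \<Longrightarrow> [:s:] \<in> q"
  shows "rees_like_prime_over I P \<subseteq> q"
proof
  fix p assume p: "p \<in> rees_like_prime_over I P"
  have iq: "rees_like_ideal I q" using q by (simp add: rees_like_prime_def)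
  have even: "[:s:] * Polynomial.monom 1 i \<in> q" if "[:s:] \<in> q" "even i" for s i
  proof -
    have "Polynomial.monom 1 i * [:s:] \<in> q"
      using iq that monom_in_rees_like_carrier[OF I, of 1 i] by (auto simp: rees_like_ideal_def)
    then show ?thesis by (simp only: mult.commute)
  qed
  have "Polynomial.monom (Polynomial.coeff p i) i \<in> q" for i
  proof -
    let ?s = "Polynomial.coeff p i" and ?m = "Polynomial.monom (Polynomial.coeff p i) i"
    have s: "[:?s:] \<in> q"
      using p by (intro P) (simp add: rees_like_prime_over_def coeffs_in_def)
    show ?thesis
    proof (cases "even i")
      case True
      then show ?thesis using even[OF s] by (simp add: smult_monom)
    next
      case False
      have "?s \<in> I"
        using p False by (simp add: rees_like_prime_over_def rees_like_carrier_def)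
      then have m: "?m \<in> rees_like_carrier I"
        by (simp add: monom_in_rees_like_carrier[OF I])
      have "[:?s:] * [:?s:] \<in> q"
        using iq s const_in_rees_like_carrier[OF I] unfolding rees_like_ideal_def by blast
      then have "[:?s * ?s:] * Polynomial.monom 1 (i + i) \<in> q"
        by (intro even) simp_all
      then have "?m * ?m \<in> q" by (simp add: smult_monom mult_monom)
      then show ?thesis using q m unfolding rees_like_prime_def by blast
    qed
  qed
  then have "(\<Sum>i\<le>Polynomial.degree p. Polynomial.monom (Polynomial.coeff p i) i) \<in> q"
    by (intro rees_like_ideal_sum[OF iq])
  then show "p \<in> q" by (simp only: poly_as_sum_of_monoms)
qed


section \<open>The irreducible components of the singular locus\<close>

abbreviation ProjRL_points :: "('n, 'k::field) mpoly set \<Rightarrow> ('n, 'k) mpoly poly set set" where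
  "ProjRL_points I \<equiv> Proj_points (rees_like_algebra I) (rees_like_component I)"

lemma topspace_Proj: "topspace (Proj R A) = Proj_points R A"
  unfolding Proj_def topology_generated_by_topspace by (auto simp: Proj_points_def)

lemma closedin_Proj_vanishing:
  assumes "g \<in> A d"
  shows "closedin (Proj R A) {q \<in> Proj_points R A. g \<in> q}"
proof -
  have "openin (Proj R A) {q \<in> Proj_points R A. g \<notin> q}"
    unfolding Proj_def using assms by (intro topology_generated_by_Basis) auto
  moreover have "Proj_points R A - {q \<in> Proj_points R A. g \<in> q} = {q \<in> Proj_points R A. g \<notin> q}"
    by auto
  ultimately show ?thesis by (simp add: closedin_def topspace_Proj)
qed

text \<open>Basic open sets are stable under passing to smaller primes, so closed sets are stable under passing to larger ones.\<close>

lemma closedin_Proj_specialization: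
  assumes C: "closedin (Proj R A) C" and q: "q \<in> C" and q': "q' \<in> Proj_points R A" "q \<subseteq> q'"
  shows "q' \<in> C"
proof (rule ccontr)
  assume "q' \<notin> C"
  have "generate_topology_on ((\<lambda>g. {q \<in> Proj_points R A. g \<notin> q}) ` (\<Union>d. A d)) (Proj_points R A - C)"
    using C unfolding closedin_def topspace_Proj unfolding Proj_def openin_topology_generated_by_iff by simp
  then have "q' \<in> Proj_points R A - C \<longrightarrow> q \<in> Proj_points R A - C"
  proof (induction rule: generate_topology_on.induct)
    case (Basis s)
    have "q \<in> Proj_points R A" using C q closedin_subset[OF C] by (auto simp: topspace_Proj)
    with Basis q'(2) show ?case by auto
  qed auto
  with q q' \<open>q' \<notin> C\<close> show False by blast
qed

lemma irreducible_in_Proj_vanishing: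
  assumes q: "q \<in> Proj_points R A"
  shows "irreducible_in (Proj R A) {q' \<in> Proj_points R A. q \<subseteq> q'}"
  unfolding irreducible_in_def topspace_Proj
proof (intro conjI allI impI)
  fix C D assume CD: "closedin (Proj R A) C \<and> closedin (Proj R A) D \<and> {q' \<in> Proj_points R A. q \<subseteq> q'} \<subseteq> C \<union> D"
  then have "q \<in> C \<or> q \<in> D" using q by auto
  then show "{q' \<in> Proj_points R A. q \<subseteq> q'} \<subseteq> C \<or> {q' \<in> Proj_points R A. q \<subseteq> q'} \<subseteq> D"
    using CD closedin_Proj_specialization[of R A] by blast
qed (use q in auto)

lemma const_rees_like_component:
  assumes I: "is_ideal I" and "a \<in> mpoly_component d"
  shows "[:a:] \<in> rees_like_component I d"
  using assms(2) const_in_rees_like_carrier[OF I, of a]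
  by (auto simp: rees_like_component_def carrier_rees_like_algebra[OF I] coeff_pCons mpoly_component_zero
      split: nat.splits)

lemma monom_rees_like_component:
  assumes I: "is_ideal I" and "a \<in> mpoly_component d" and "even i \<or> a \<in> I"
  shows "Polynomial.monom a i \<in> rees_like_component I (d + i)"
  using assms(2,3) monom_in_rees_like_carrier[OF I, of a i]
  by (auto simp: rees_like_component_def carrier_rees_like_algebra[OF I] mpoly_component_zero)

text \<open>Homogeneity comes from splitting each coefficient into its homogeneous components: these stay in
  \<open>P\<close>, and for odd powers of \<open>t\<close> also in \<open>I\<close>. The element \<open>t\<close> squared shows that the point is not irrelevant.\<close>

lemma rees_like_prime_over_in_Proj:
  assumes hI: "homogeneous_ideal UR mpoly_component I" and P: "P \<in> minimal_primes UR I"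
  shows "rees_like_prime_over I P \<in> ProjRL_points I"
proof -
  let ?q = "rees_like_prime_over I P" and ?R = "rees_like_algebra I"
  let ?H = "\<Union>d. rees_like_component I d"
  have I: "is_ideal I" using hI by (simp add: homogeneous_ideal_def ideal_UR_iff)
  have prime: "is_prime P" using P by (simp add: minimal_primes_UR)
  have iP: "is_ideal P" using prime by (rule is_prime_ideal)
  have q: "rees_like_prime I ?q" by (rule rees_like_prime_over[OF I prime])
  interpret RL: cring ?R by (rule cring_rees_like_algebra)
  have ideal: "ideal ?q ?R"
    using q by (simp add: ideal_rees_like_iff[OF I] rees_like_prime_def)
  have sub: "?q \<inter> ?H \<subseteq> carrier ?R"
    by (auto simp: rees_like_prime_over_def carrier_rees_like_algebra[OF I])
  have gen: "rees_like_ideal I (Idl\<^bsub>?R\<^esub> (?q \<inter> ?H))"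
    using RL.genideal_ideal[OF sub] by (simp add: ideal_rees_like_iff[OF I])
  have "?q \<subseteq> Idl\<^bsub>?R\<^esub> (?q \<inter> ?H)"
  proof
    fix p assume p: "p \<in> ?q"
    have "Polynomial.monom (Polynomial.coeff p i) i \<in> Idl\<^bsub>?R\<^esub> (?q \<inter> ?H)" for i
    proof -
      let ?c = "\<lambda>d. Polynomial.coeff (components_poly (Polynomial.coeff p i)) d"
      have c: "?c d \<in> P" "even i \<or> ?c d \<in> I" for d
        using p minimal_prime_homogeneous[OF hI P] homogeneous_ideal_subset_part[OF hI]
        by (auto simp: rees_like_prime_over_def coeffs_in_def rees_like_carrier_def homogeneous_part_def)
      have "Polynomial.monom (?c d) i \<in> Idl\<^bsub>?R\<^esub> (?q \<inter> ?H)" for d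
      proof -
        have "Polynomial.monom (?c d) i \<in> ?H"
          using monom_rees_like_component[OF I coeff_components_poly c(2)] by blast
        moreover have "Polynomial.monom (?c d) i \<in> ?q"
          using c monom_in_rees_like_carrier[OF I] is_ideal_zero[OF iP]
          by (auto simp: rees_like_prime_over_def coeffs_in_def)
        ultimately show ?thesis using RL.genideal_self[OF sub] by blast
      qed
      then have "(\<Sum>d\<le>Polynomial.degree (components_poly (Polynomial.coeff p i)). Polynomial.monom (?c d) i)
          \<in> Idl\<^bsub>?R\<^esub> (?q \<inter> ?H)"
        by (intro rees_like_ideal_sum[OF gen])
      also have "(\<Sum>d\<le>Polynomial.degree (components_poly (Polynomial.coeff p i)). Polynomial.monom (?c d) i) =
          Polynomial.monom (poly (components_poly (Polynomial.coeff p i)) 1) i"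
        by (rule poly_eqI) (simp add: poly_altdef coeff_sum)
      finally show ?thesis by (simp only: poly_components_poly)
    qed
    then have "(\<Sum>i\<le>Polynomial.degree p. Polynomial.monom (Polynomial.coeff p i) i) \<in> Idl\<^bsub>?R\<^esub> (?q \<inter> ?H)"
      by (intro rees_like_ideal_sum[OF gen])
    then show "p \<in> Idl\<^bsub>?R\<^esub> (?q \<inter> ?H)" by (simp only: poly_as_sum_of_monoms)
  qed
  moreover have "Idl\<^bsub>?R\<^esub> (?q \<inter> ?H) \<subseteq> ?q"
    by (rule RL.genideal_minimal[OF ideal]) auto
  ultimately have "homogeneous_ideal ?R (rees_like_component I) ?q"
    using ideal unfolding homogeneous_ideal_def by blast
  moreover have "Polynomial.monom 1 2 \<in> rees_like_component I (0 + 2)"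
    by (rule monom_rees_like_component[OF I]) (auto simp: mpoly_component_def mono_degree_def)
  moreover have "Polynomial.monom 1 2 \<notin> ?q"
    using is_prime_one[OF prime] by (auto simp: rees_like_prime_over_def coeffs_in_def intro!: exI[of _ 2])
  ultimately show ?thesis
    using q by (auto simp: Proj_points_def primeideal_rees_like_iff[OF I] subset_iff)
qed

lemma Sing_iff:
  fixes f :: "'m::finite \<Rightarrow> ('n::finite, 'k::field) mpoly"
  assumes I: "Idl\<^bsub>UR\<^esub> (range f) = I" and nz: "\<And>j. f j \<noteq> 0"
    and G: "finite G" "Idl\<^bsub>UR\<^esub> G = RLP f"
  shows "q \<in> Sing f G I \<longleftrightarrow> q \<in> ProjRL_points I \<and> (\<forall>s\<in>I. [:s:] \<in> q)"
proof -
  have iI: "is_ideal I" unfolding I[symmetric] by (rule is_ideal_genideal)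
  have f: "range f \<subseteq> I" unfolding I[symmetric] by (rule genideal_UR_superset)
  have "jacobian_ideal f G \<subseteq> rees_like_map f -` q \<longleftrightarrow> (\<forall>s\<in>I. [:s:] \<in> q)" if "q \<in> ProjRL_points I"
  proof -
    have "rees_like_prime I q"
      using that by (simp add: Proj_points_def primeideal_rees_like_iff[OF iI])
    note V = is_prime_rees_like_vimage[OF iI f this]
    show ?thesis
      unfolding jacobian_ideal_subset_prime_iff[OF I nz G V(1)] using V(2) by auto
  qed
  then show ?thesis by (auto simp: Sing_def ProjRL_def topspace_Proj)
qed

text \<open>Let \<open>N\<close> be the ideal of all elements of \<open>S\<close> that lie in every point of \<open>A\<close>. Irreducibility can only
  be used on the closed sets of homogeneous elements, so it shows that \<open>N\<close> is prime on these and that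
  its homogeneous part is a prime ideal.\<close>

lemma irreducible_subset_of_Sing:
  assumes hI: "homogeneous_ideal UR mpoly_component I"
    and irr: "irreducible_in (ProjRL I) A" and A: "\<And>q s. q \<in> A \<Longrightarrow> s \<in> I \<Longrightarrow> [:s:] \<in> q"
  shows "\<exists>P\<in>minimal_primes UR I. \<forall>q\<in>A. rees_like_prime_over I P \<subseteq> q"
proof -
  have I: "is_ideal I" using hI by (simp add: homogeneous_ideal_def ideal_UR_iff)
  have sub: "A \<subseteq> ProjRL_points I" and "A \<noteq> {}"
    and split: "\<And>C D. closedin (ProjRL I) C \<Longrightarrow> closedin (ProjRL I) D \<Longrightarrow> A \<subseteq> C \<union> D \<Longrightarrow> A \<subseteq> C \<or> A \<subseteq> D"
    using irr by (auto simp: irreducible_in_def ProjRL_def topspace_Proj)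
  have prime: "rees_like_prime I q" if "q \<in> A" for q
    using that sub by (auto simp: Proj_points_def primeideal_rees_like_iff[OF I])
  define N where "N = {s. \<forall>q\<in>A. [:s:] \<in> q}"
  have iN: "is_ideal N"
    unfolding is_ideal_def
  proof (intro conjI ballI allI)
    show "0 \<in> N"
      using prime by (simp add: N_def rees_like_prime_def rees_like_ideal_def)
    show "a + b \<in> N" if "a \<in> N" "b \<in> N" for a b
    proof -
      have "[:a:] + [:b:] \<in> q" if "q \<in> A" for q
        using \<open>a \<in> N\<close> \<open>b \<in> N\<close> that
        by (intro rees_like_ideal_add[OF rees_like_prime_ideal[OF prime[OF that]]]) (simp_all add: N_def)
      then show ?thesis by (simp add: N_def)
    qed
    show "r * a \<in> N" if "a \<in> N" for a r
    proof -
      have "[:r:] * [:a:] \<in> q" if "q \<in> A" for q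
        using \<open>a \<in> N\<close> that
        by (intro rees_like_ideal_mult[OF rees_like_prime_ideal[OF prime[OF that]]]
            const_in_rees_like_carrier[OF I]) (simp add: N_def)
      then show ?thesis by (simp add: N_def mult.commute)
    qed
  qed
  have "is_prime (homogeneous_part N)"
  proof (rule is_prime_homogeneous_part[OF iN])
    show "1 \<notin> N"
      using \<open>A \<noteq> {}\<close> prime by (auto simp: N_def rees_like_prime_def one_pCons)
    fix a b d e assume a: "a \<in> mpoly_component d" and b: "b \<in> mpoly_component e" and ab: "a * b \<in> N"
    let ?V = "\<lambda>a. {q \<in> ProjRL_points I. [:a:] \<in> q}"
    have closed: "closedin (ProjRL I) (?V c)" if "c \<in> mpoly_component i" for c i
      unfolding ProjRL_def
      by (rule closedin_Proj_vanishing[of _ "rees_like_component I" i])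
        (rule const_rees_like_component[OF I that])
    have "A \<subseteq> ?V a \<union> ?V b"
    proof
      fix q assume q: "q \<in> A"
      have "[:a:] * [:b:] \<in> q" using ab q by (simp add: N_def mult.commute)
      then have "[:a:] \<in> q \<or> [:b:] \<in> q"
        by (rule rees_like_prime_mult[OF prime[OF q] const_in_rees_like_carrier[OF I]
            const_in_rees_like_carrier[OF I]])
      then show "q \<in> ?V a \<union> ?V b" using q sub by blast
    qed
    then have "A \<subseteq> ?V a \<or> A \<subseteq> ?V b"
      by (rule split[OF closed[OF a] closed[OF b]])
    then show "a \<in> N \<or> b \<in> N" by (auto simp: N_def)
  qed
  moreover have "I \<subseteq> N" using A by (auto simp: N_def)
  then have "I \<subseteq> homogeneous_part N"
    using homogeneous_ideal_subset_part[OF hI] homogeneous_part_mono by blast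
  ultimately obtain P where P: "P \<in> minimal_primes UR I" "P \<subseteq> homogeneous_part N"
    using minimal_prime_below by blast
  then have "P \<subseteq> N" using homogeneous_part_subset[OF iN] by blast
  then have "rees_like_prime_over I P \<subseteq> q" if "q \<in> A" for q
    using that by (intro rees_like_prime_over_subset[OF I prime[OF that]]) (auto simp: N_def)
  with P(1) show ?thesis by blast
qed

text \<open>The components are the closures \<open>V P\<close> of the points \<open>rees_like_prime_over I P\<close>; a closure determines
  \<open>P\<close> because this point is its smallest element.\<close>

theorem irreducible_components_Sing:
  fixes f :: "'m::finite \<Rightarrow> ('n::finite, 'k::field) mpoly"
  assumes hI: "homogeneous_ideal UR mpoly_component I"
    and I: "Idl\<^bsub>UR\<^esub> (range f) = I" and nz: "\<And>j. f j \<noteq> 0"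
    and G: "finite G" "Idl\<^bsub>UR\<^esub> G = RLP f"
  defines "V \<equiv> \<lambda>P. {q \<in> ProjRL_points I. rees_like_prime_over I P \<subseteq> q}"
  shows "bij_betw V (minimal_primes UR I) (irreducible_components (ProjRL I) (Sing f G I))"
proof -
  let ?M = "minimal_primes UR I"
  have iI: "is_ideal I" unfolding I[symmetric] by (rule is_ideal_genideal)
  note Sing = Sing_iff[OF I nz G]
  have iP: "is_ideal P" if "P \<in> ?M" for P
    by (rule is_prime_ideal) (use that in \<open>simp add: minimal_primes_UR\<close>)
  have point: "rees_like_prime_over I P \<in> V P" if "P \<in> ?M" for P
    using rees_like_prime_over_in_Proj[OF hI that] by (simp add: V_def)
  have irr: "irreducible_in (ProjRL I) (V P)" if "P \<in> ?M" for P
    unfolding ProjRL_def V_def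
    by (rule irreducible_in_Proj_vanishing[OF rees_like_prime_over_in_Proj[OF hI that]])
  have V_Sing: "V P \<subseteq> Sing f G I" if "P \<in> ?M" for P
  proof
    fix q assume q: "q \<in> V P"
    have "[:s:] \<in> q" if "s \<in> I" for s
    proof -
      have "s \<in> P" using \<open>P \<in> ?M\<close> that by (auto simp: minimal_primes_UR)
      then have "[:s:] \<in> rees_like_prime_over I P"
        by (simp add: const_in_rees_like_prime_over[OF iI iP[OF \<open>P \<in> ?M\<close>]])
      then show ?thesis using q by (auto simp: V_def)
    qed
    with q show "q \<in> Sing f G I" by (simp add: Sing V_def)
  qed
  have V_subset: "P' = P" if P: "P \<in> ?M" "P' \<in> ?M" and VV: "V P \<subseteq> V P'" for P P'
  proof -
    have "rees_like_prime_over I P' \<subseteq> rees_like_prime_over I P"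
      using point[OF P(1)] VV by (auto simp: V_def)
    then have "P' \<subseteq> P"
      using const_in_rees_like_prime_over[OF iI iP] P by blast
    with P show ?thesis by (auto simp: minimal_primes_UR)
  qed
  have cover: "\<exists>P\<in>?M. A \<subseteq> V P" if A: "irreducible_in (ProjRL I) A" "A \<subseteq> Sing f G I" for A
  proof -
    have "[:s:] \<in> q" if "q \<in> A" "s \<in> I" for q s
      using A(2) that Sing by blast
    from irreducible_subset_of_Sing[OF hI A(1) this] obtain P
      where "P \<in> ?M" "\<forall>q\<in>A. rees_like_prime_over I P \<subseteq> q" by blast
    moreover have "A \<subseteq> ProjRL_points I" using A(2) Sing by blast
    ultimately show ?thesis by (auto simp: V_def)
  qed
  have "inj_on V ?M"
    by (rule inj_onI) (use V_subset in auto)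
  moreover have "V ` ?M = irreducible_components (ProjRL I) (Sing f G I)"
  proof
    show "V ` ?M \<subseteq> irreducible_components (ProjRL I) (Sing f G I)"
    proof
      fix A assume "A \<in> V ` ?M"
      then obtain P where P: "P \<in> ?M" and A: "A = V P" by blast
      have "B = A" if B: "irreducible_in (ProjRL I) B \<and> B \<subseteq> Sing f G I \<and> A \<subseteq> B" for B
      proof -
        obtain P' where P': "P' \<in> ?M" "B \<subseteq> V P'" using cover B by blast
        then have "V P \<subseteq> V P'" using B A by blast
        then have "P' = P" by (rule V_subset[OF P P'(1)])
        with P' B A show ?thesis by blast
      qed
      then show "A \<in> irreducible_components (ProjRL I) (Sing f G I)"
        using irr[OF P] V_Sing[OF P] A by (simp add: irreducible_components_def)
    qed
    show "irreducible_components (ProjRL I) (Sing f G I) \<subseteq> V ` ?M"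
    proof
      fix A assume A: "A \<in> irreducible_components (ProjRL I) (Sing f G I)"
      then obtain P where P: "P \<in> ?M" "A \<subseteq> V P"
        using cover[of A] by (auto simp: irreducible_components_def)
      then have "V P = A"
        using A irr[OF P(1)] V_Sing[OF P(1)] by (simp add: irreducible_components_def)
      with P(1) show "A \<in> V ` ?M" by blast
    qed
  qed
  ultimately show ?thesis by (simp add: bij_betw_def)
qed

theorem theoremA:
  fixes I :: "('n::finite, 'k::field) mpoly set"
    and f :: "'m::finite \<Rightarrow> ('n, 'k) mpoly"
    and G :: "('n, 'm, 'k) rl_mpoly set"
  assumes "perfect_field TYPE('k)"
    and "homogeneous_ideal UR mpoly_component I" and "I \<noteq> {0}" and "I \<noteq> UNIV"
    and "minimal_homogeneous_generators f I"
    and "CHAR('k) = 0 \<or> (CHAR('k) > 2 \<and> (\<forall>j. \<not> CHAR('k) dvd total_degree (f j)))"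
    and "finite G" and "Idl\<^bsub>UR\<^esub> G = RLP f"
  shows "(\<exists>h. bij_betw h (irreducible_components (ProjRL I) (Sing f G I)) (minimal_primes UR I)) \<and>
         codim_Sing f G = height UR I"
proof
  have gen: "Idl\<^bsub>UR\<^esub> (range f) = I"
    and min: "\<And>j. f j \<notin> Idl\<^bsub>UR\<^esub> (f ` (UNIV - {j}))"
    using assms(5) by (auto simp: minimal_homogeneous_generators_def)
  have nz: "f j \<noteq> 0" for j
    using min[of j] is_ideal_zero[OF is_ideal_genideal, of "f ` (UNIV - {j})"] by metis
  show "codim_Sing f G = height UR I"
    by (rule codim_Sing_eq_height[OF gen nz assms(7,8)])
  show "\<exists>h. bij_betw h (irreducible_components (ProjRL I) (Sing f G I)) (minimal_primes UR I)"
    using irreducible_components_Sing[OF assms(2) gen nz assms(7,8)] bij_betw_inv_into by blast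
qed

end
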